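(* Let $(\bar u,\bar\mu)\in\mathcal D$ and let $(u,\mu)$ be a conservative solution of the generalized Hunter–Saxton system subject to the initial data $(\bar u,\bar\mu)$. Write $\bar u(-\infty):=\lim_{x\to-\infty}\bar u(x)$ when this limit exists. Assume that $$\lim_{x\to-\infty}|x|^{1-\theta_1}\,\bar\mu\big((-\infty,-|x|^{1+\theta_1})\big)=A_1$$ for some constants $0\le\theta_1<1$ and $A_1\ge0$. Then for any $x\in\mathbb R$: (i) if $A_1>0$ and $0<\theta_1<1$, then $$\lim_{t\to+\infty}\frac{u(x,t)}{t^{\theta_1}}=2\left(\frac{A_1}{4}\right)^{\frac{1+\theta_1}{2}};$$ (ii) if $A_1>0$, $\theta_1=0$ and $\bar u(-\infty)$ exists, then $$\lim_{t\to+\infty}u(x,t)=\sqrt{\bar u^2(-\infty)+A_1};$$ (iii) if $A_1=0$, $0<\theta_1<1$, and $\bar\mu((-\infty,z))>0$ for any $z\in\mathbb R$, then $$\lim_{t\to+\infty}\frac{u(x,t)}{t^{\theta_1}}=0;$$ (iv) if $A_1=\theta_1=0$, $\bar\mu((-\infty,z))>0$ for any $z\in\mathbb R$, and $\bar u(-\infty)$ exists, then $$\lim_{t\to+\infty}u(x,t)=|\bar u(-\infty)|.$$ If $\bar\mu$ satisfies $\ell:=\inf\operatorname{supp}\{\bar\mu\}>-\infty$, then also $\lim_{t\to+\infty}u(x,t)=|\bar u(-\infty)|$ for any $x\in\mathbb R$, provided that $\bar u(-\infty)$ exists.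
   Context: Notation. $C_b(\mathbb R)$ is the space of bounded continuous functions on $\mathbb R$ with the sup-norm; $\mathcal M_+(\mathbb R)$ is the set of finite nonnegative Radon measures on $\mathbb R$ endowed with the weak topology. The space $\mathcal D$ is the set of all pairs $(u,\mu)$ such that (i) $u\in C_b(\mathbb R)$ and $u_x\in L^2(\mathbb R)$; (ii) $\mu\in\mathcal M_+(\mathbb R)$; (iii) $d\mu_{ac}=u_x^2\,dx$, where $\mu_{ac}$ is the absolutely continuous part of $\mu$ with respect to Lebesgue measure $dx$. Generalized Hunter–Saxton system: for $x,t\in\mathbb R$, $$u_t+uu_x=\tfrac12\int_{-\infty}^x d\mu(t),\qquad \mu_t+(u\mu)_x=0,\qquad d\mu_{ac}(t)=u_x^2(x,t)\,dx.$$ Conservative solution. Given $(\bar u,\bar\mu)\in\mathcal D$, a pair $(u(t),\mu(t))$, $t\in\mathbb R$, is a (global-in-time) conservative solution with initial data $(\bar u,\bar\mu)$ if: (i) $u\in C(\mathbb R;C_b(\mathbb R))\cap C^{1/2}_{loc}(\mathbb R\times\mathbb R)$, $u_t\in L^2_{loc}(\mathbb R\times\mathbb R)$, $u_x(\cdot,t)\in L^2(\mathbb R)$ for all $t\in\mathbb R$, and $\mu\in C(\mathbb R;\mathcal M_+(\mathbb R))$; (ii) $(u(\cdot,0),\mu(0))=(\bar u,\bar\mu)$, and $d\mu(t)=u_x^2(x,t)\,dx$ for a.e. $t\in\mathbb R$; (iii) for all $\phi\in C_c^\infty(\mathbb R\times\mathbb R)$, $\int_{\mathbb R}\int_{\mathbb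 R}u\phi_t-\phi\left(uu_x-\tfrac12F\right)dx\,dt=0$, where $F(x,t):=\int_{-\infty}^x d\mu(t)$; (iv) for all $\phi\in C_c^\infty(\mathbb R\times\mathbb R)$, $\int_{\mathbb R}\int_{\mathbb R}(\phi_t+u\phi_x)\,d\mu(t)\,dt=0$; (v) $d\mu_{ac}(t)=u_x^2(x,t)\,dx$ for all $t\in\mathbb R$.
   Formalization: In the last claim the measure μ̄ is required to be nonzero (its support is nonempty, so ℓ is a real number): for μ̄ = 0 and ū ≡ c < 0 the solution u ≡ c has limit c, not |c|. *)

theory Defs
  imports "HOL-Analysis.Analysis"
begin

text \<open>Directional derivative; for functions on \<open>real \<times> real\<close>, whose points are written
  \<open>(x, t)\<close>, the directions \<open>(1, 0)\<close> and \<open>(0, 1)\<close> give \<open>\<partial>/\<partial>x\<close> and \<open>\<partial>/\<partial>t\<close>.\<close>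

definition dir_deriv :: "'a::euclidean_space \<Rightarrow> ('a \<Rightarrow> real) \<Rightarrow> 'a \<Rightarrow> real"
  where "dir_deriv v f p = frechet_derivative f (at p) v"

abbreviation deriv_x :: "(real \<times> real \<Rightarrow> real) \<Rightarrow> real \<times> real \<Rightarrow> real"
  where "deriv_x \<equiv> dir_deriv (1, 0)"

abbreviation deriv_t :: "(real \<times> real \<Rightarrow> real) \<Rightarrow> real \<times> real \<Rightarrow> real"
  where "deriv_t \<equiv> dir_deriv (0, 1)"

primrec Ck :: "nat \<Rightarrow> ('a::euclidean_space \<Rightarrow> real) \<Rightarrow> bool"
  where
    "Ck 0 f \<longleftrightarrow> continuous_on UNIV f"
  | "Ck (Suc k) f \<longleftrightarrow> (\<forall>p. f differentiable (at p)) \<and> (\<forall>v. Ck k (dir_deriv v f))"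

definition test_function :: "('a::euclidean_space \<Rightarrow> real) \<Rightarrow> bool"
  where "test_function \<phi> \<longleftrightarrow> (\<forall>k. Ck k \<phi>) \<and> compact (closure {p. \<phi> p \<noteq> 0})"

definition locally_integrable :: "('a::euclidean_space \<Rightarrow> real) \<Rightarrow> bool"
  where "locally_integrable f \<longleftrightarrow>
    f \<in> borel_measurable borel \<and> (\<forall>K. compact K \<longrightarrow> set_integrable lborel K f)"

definition square_integrable :: "('a::euclidean_space \<Rightarrow> real) \<Rightarrow> bool"
  where "square_integrable f \<longleftrightarrow>
    f \<in> borel_measurable borel \<and> integrable lborel (\<lambda>p. (f p)\<^sup>2)"

definition locally_square_integrable :: "('a::euclidean_space \<Rightarrow> real) \<Rightarrow> bool"
  where "locally_square_integrable f \<longleftrightarrow>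
    f \<in> borel_measurable borel \<and> (\<forall>K. compact K \<longrightarrow> set_integrable lborel K (\<lambda>p. (f p)\<^sup>2))"

text \<open>\<open>has_weak_deriv v f g\<close>: \<open>g\<close> is (a Borel representative of) the distributional derivative
  of \<open>f\<close> in direction \<open>v\<close>.\<close>

definition has_weak_deriv ::
    "'a::euclidean_space \<Rightarrow> ('a \<Rightarrow> real) \<Rightarrow> ('a \<Rightarrow> real) \<Rightarrow> bool"
  where "has_weak_deriv v f g \<longleftrightarrow>
    locally_integrable f \<and> locally_integrable g \<and>
    (\<forall>\<phi>. test_function \<phi> \<longrightarrow>
      (LINT p|lborel. f p * dir_deriv v \<phi> p) = - (LINT p|lborel. g p * \<phi> p))"

definition locally_half_hoelder :: "(real \<times> real \<Rightarrow> real) \<Rightarrow> bool"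
  where "locally_half_hoelder f \<longleftrightarrow>
    (\<forall>K. compact K \<longrightarrow> (\<exists>C. \<forall>p\<in>K. \<forall>q\<in>K. \<bar>f p - f q\<bar> \<le> C * sqrt (dist p q)))"

text \<open>Every finite Borel measure on the real line is Radon.\<close>

definition finite_radon_measures :: "real measure set" (\<open>\<M>\<^sub>+\<close>)
  where "\<M>\<^sub>+ = {\<mu>. sets \<mu> = sets borel \<and> finite_measure \<mu>}"

text \<open>Continuity into \<open>\<M>\<^sub>+\<close> for the weak topology, that is, the initial topology of the maps
  \<open>\<mu> \<mapsto> \<integral>f d\<mu>\<close> with \<open>f\<close> bounded and continuous.\<close>

definition weakly_continuous :: "(real \<Rightarrow> real measure) \<Rightarrow> bool"
  where "weakly_continuous \<mu> \<longleftrightarrow>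
    (\<forall>t. \<mu> t \<in> \<M>\<^sub>+) \<and>
    (\<forall>f :: real \<Rightarrow>\<^sub>C real. continuous_on UNIV (\<lambda>t. LINT x|\<mu> t. f x))"

text \<open>\<open>is_ac_part \<mu> \<nu>\<close>: \<open>\<nu>\<close> is the absolutely continuous part in the Lebesgue decomposition
  \<open>\<mu> = \<nu> + \<sigma>\<close> with respect to Lebesgue measure.\<close>

definition is_ac_part :: "real measure \<Rightarrow> real measure \<Rightarrow> bool"
  where "is_ac_part \<mu> \<nu> \<longleftrightarrow>
    sets \<nu> = sets borel \<and> absolutely_continuous lborel \<nu> \<and>
    (\<exists>\<sigma>. sets \<sigma> = sets borel \<and>
      (\<exists>N\<in>null_sets lborel. emeasure \<sigma> (- N) = 0) \<and>
      (\<forall>A\<in>sets borel. emeasure \<mu> A = emeasure \<nu> A + emeasure \<sigma> A))"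

definition sq_density :: "(real \<Rightarrow> real) \<Rightarrow> real measure"
  where "sq_density g = density lborel (\<lambda>x. ennreal ((g x)\<^sup>2))"

definition measure_support :: "real measure \<Rightarrow> real set"
  where "measure_support \<mu> = {x. \<forall>U. open U \<and> x \<in> U \<longrightarrow> emeasure \<mu> U > 0}"

definition data_space :: "((real \<Rightarrow>\<^sub>C real) \<times> real measure) set" (\<open>\<D>\<close>)
  where "\<D> = {(u, \<mu>). \<mu> \<in> \<M>\<^sub>+ \<and>
    (\<exists>ux. has_weak_deriv 1 (apply_bcontfun u) ux \<and> square_integrable ux \<and>
      is_ac_part \<mu> (sq_density ux))}"

text \<open>Here \<open>u(x,t)\<close> is \<open>u t x\<close> and \<open>ux t\<close> is a representative of the weak derivative
  \<open>u\<^sub>x(\<cdot>,t)\<close>; all conditions are insensitive to its choice on Lebesgue null sets. For the same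
  reason it is immaterial whether \<open>F(x,t)\<close> is the mass of
  \<open>(-\<infinity>,x]\<close> or of \<open>(-\<infinity>,x)\<close>.\<close>

definition conservative_solution ::
    "(real \<Rightarrow>\<^sub>C real) \<Rightarrow> real measure \<Rightarrow> (real \<Rightarrow> (real \<Rightarrow>\<^sub>C real)) \<Rightarrow> (real \<Rightarrow> real measure) \<Rightarrow> bool"
  where "conservative_solution ubar \<mu>bar u \<mu> \<longleftrightarrow>
    continuous_on UNIV u \<and>
    locally_half_hoelder (\<lambda>(x, t). u t x) \<and>
    (\<exists>ut. has_weak_deriv (0, 1) (\<lambda>(x, t). u t x) ut \<and> locally_square_integrable ut) \<and>
    weakly_continuous \<mu> \<and>
    u 0 = ubar \<and> \<mu> 0 = \<mu>bar \<and>
    (\<exists>ux.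
      (\<forall>t. has_weak_deriv 1 (apply_bcontfun (u t)) (ux t) \<and> square_integrable (ux t)) \<and>
      (AE t in lborel. \<mu> t = sq_density (ux t)) \<and>
      (\<forall>\<phi>. test_function \<phi> \<longrightarrow>
        (LINT t|lborel. LINT x|lborel.
          u t x * deriv_t \<phi> (x, t)
          - \<phi> (x, t) * (u t x * ux t x - 1/2 * measure (\<mu> t) {..x})) = 0) \<and>
      (\<forall>\<phi>. test_function \<phi> \<longrightarrow>
        (LINT t|lborel. LINT x|\<mu> t. deriv_t \<phi> (x, t) + u t x * deriv_x \<phi> (x, t)) = 0) \<and>
      (\<forall>t. is_ac_part (\<mu> t) (sq_density (ux t))))"

end

theory Submission
  imports Defs "HOL-Computational_Algebra.Polynomial" "HOL-Probability.Distribution_Functions"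
begin

text \<open>Think of the solution as a cloud of particles, each labelled by the mass \<open>\<eta>\<close> to its left. The
  equation for \<open>\<mu>\<close> says that the particle \<open>\<eta>\<close> moves with velocity \<open>u\<close>, and the equation for \<open>u\<close> says that
  its acceleration is half the mass to its left, the constant \<open>\<eta> / 2\<close>. So particles move on the parabolas
  \<open>x = X + w t + \<eta> t\<^sup>2 / 4\<close>, with \<open>X\<close> the initial position and \<open>w\<close> the initial velocity at \<open>X\<close>, and
  \<open>u (x, t) = w + \<eta> t / 2\<close>. Eliminating \<open>t\<close> gives the identity \<open>u\<^sup>2 = w\<^sup>2 + \<eta> (x - X)\<close>. For fixed \<open>x\<close> and
  \<open>t \<rightarrow> \<infinity>\<close>, particles of positive label have all passed \<open>x\<close>, hence \<open>\<eta> \<rightarrow> 0\<close> for the particle that is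
  at \<open>x\<close> at time \<open>t\<close>. If there is initial mass arbitrarily far to the left, \<open>X\<close> tends to minus infinity
  and \<open>\<eta> \<bar>X\<bar>\<close> is governed by the decay of the initial measure there; if the support is bounded below,
  \<open>\<eta> (x - X)\<close> tends to zero. All the stated limits can be read off; the sign of \<open>u\<close> comes from the fact
  that a particle which arrives at \<open>x\<close> late from the left has a mean velocity that is not much below
  zero, and its final velocity is at least its mean velocity.

  The work lies in justifying this picture from the weak formulation, where \<open>u\<close> is not Lipschitz and
  \<open>\<mu> t\<close> may be singular at exceptional times. Testing in moving frames turns both equations into
  ordinary derivatives in time (\<open>transport_law\<close>, \<open>momentum_law\<close>). Comparing quantiles of \<open>\<mu> t\<close> with
  fronts of constant speed shows that they are characteristics, at every time
  (\<open>quantile_has_derivative\<close>). Along such a curve the velocity, averaged over a short interval to the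
  right, changes at a rate that differs from half the averaged distribution function by a commutator;
  the square integrability of \<open>u\<^sub>x\<close> bounds the commutator by the mass of a shrinking interval
  (\<open>force_commutator\<close>), so that the acceleration is \<open>\<eta> / 2\<close> (\<open>velocity_on_quantile\<close>). Points that are
  not quantiles lie in gaps of \<open>\<mu> t\<close>, across which \<open>u\<close> is constant, and this extends the parabolas to
  all points (\<open>parabola_through_point\<close>).\<close>

section \<open>Smooth functions\<close>

lemma Ck_Suc_D: "Ck (Suc k) f \<Longrightarrow> Ck k f"
proof (induction k arbitrary: f)
  case 0
  then have "f differentiable_on UNIV"
    by (simp add: differentiable_on_def)
  then show ?case
    by (simp add: differentiable_imp_continuous_on)
next
  case (Suc k)
  have "Ck k (dir_deriv v f)" for v
    using Suc.prems by (intro Suc.IH) (simp only: Ck.simps(2) simp_thms)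
  with Suc.prems show ?case
    by (simp only: Ck.simps(2)) blast
qed

lemma dir_deriv_eqI: "(f has_derivative D) (at p) \<Longrightarrow> dir_deriv v f p = D v"
  unfolding dir_deriv_def by (metis frechet_derivative_at)

lemma Ck_const: "Ck k (\<lambda>_. c)"
proof (induction k arbitrary: c)
  case (Suc k)
  have "dir_deriv v (\<lambda>_. c) = (\<lambda>_::'a. 0)" for v :: 'a
    by (rule ext, rule dir_deriv_eqI) (rule has_derivative_const)
  then show ?case by (simp add: Suc)
qed simp

lemma dir_deriv_has_derivative:
  "f differentiable (at p) \<Longrightarrow> (f has_derivative (\<lambda>v. dir_deriv v f p)) (at p)"
  unfolding dir_deriv_def by (metis frechet_derivative_works)

lemma dir_deriv_real_eqI:
  "(h has_real_derivative d) (at x) \<Longrightarrow> dir_deriv v h x = v * d"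
  by (subst dir_deriv_eqI[of h "(*) d"]) (auto simp: has_field_derivative_def)

lemma dir_deriv_real_has_derivative:
  fixes h :: "real \<Rightarrow> real"
  assumes "h differentiable (at x)"
  shows "(h has_real_derivative dir_deriv 1 h x) (at x)"
proof -
  obtain d where "(h has_real_derivative d) (at x)"
    using assms real_differentiable_def by blast
  then show ?thesis
    using dir_deriv_real_eqI[of h d x 1] by simp
qed

lemma dir_deriv_locally_constant:
  fixes f :: "real \<Rightarrow> real"
  assumes "open S" "x \<in> S" "\<And>y. y \<in> S \<Longrightarrow> f y = c"
  shows "dir_deriv 1 f x = 0"
proof -
  have "(f has_real_derivative 0) (at x)"
    by (rule has_field_derivative_transform_within_open[OF DERIV_const, of S x c])
      (use assms in simp_all)
  then show ?thesis using dir_deriv_real_eqI[of f 0 x 1] by simp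
qed

lemma Ck_linear:
  assumes "bounded_linear f"
  shows "Ck k f"
proof (cases k)
  case (Suc j)
  have "(f has_derivative f) (at p)" for p
    using assms by (rule bounded_linear_imp_has_derivative)
  then have "f differentiable (at p)" "dir_deriv v f p = f v" for p v
    by (auto simp: dir_deriv_eqI differentiable_def)
  then have "dir_deriv v f = (\<lambda>_. f v)" for v by auto
  then show ?thesis
    using Suc \<open>\<And>p. f differentiable (at p)\<close> by (simp add: Ck_const)
qed (simp add: assms linear_continuous_on)

lemma Ck_add: "Ck k f \<Longrightarrow> Ck k g \<Longrightarrow> Ck k (\<lambda>x. f x + g x)"
proof (induction k arbitrary: f g)
  case (Suc k)
  have "dir_deriv v (\<lambda>x. f x + g x) = (\<lambda>x. dir_deriv v f x + dir_deriv v g x)" for v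
    using Suc.prems
    by (intro ext dir_deriv_eqI has_derivative_add dir_deriv_has_derivative) auto
  with Suc show ?case by (auto intro: differentiable_add)
qed (auto intro: continuous_on_add)

lemma Ck_mult: "Ck k f \<Longrightarrow> Ck k g \<Longrightarrow> Ck k (\<lambda>x. f x * g x)"
proof (induction k arbitrary: f g)
  case (Suc k)
  have "dir_deriv v (\<lambda>x. f x * g x) = (\<lambda>x. f x * dir_deriv v g x + dir_deriv v f x * g x)" for v
    using Suc.prems
    by (intro ext dir_deriv_eqI has_derivative_mult dir_deriv_has_derivative) auto
  moreover have "Ck k f" "Ck k g"
    using Suc.prems Ck_Suc_D by blast+
  ultimately show ?case using Suc
    by (auto intro!: differentiable_mult Ck_add)
qed (auto intro: continuous_on_mult)

lemma Ck_compose: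
  fixes h :: "real \<Rightarrow> real"
  shows "Ck k h \<Longrightarrow> Ck k f \<Longrightarrow> Ck k (\<lambda>x. h (f x))"
proof (induction k arbitrary: f h)
  case 0
  then show ?case by (auto intro: continuous_on_compose2)
next
  case (Suc k)
  have *: "((\<lambda>x. h (f x)) has_derivative (\<lambda>v. dir_deriv 1 h (f p) * dir_deriv v f p)) (at p)" for p
  proof -
    have "(h has_derivative (*) (dir_deriv 1 h (f p))) (at (f p))"
      using dir_deriv_real_has_derivative[of h "f p"] Suc.prems
      by (simp add: has_field_derivative_def)
    then show ?thesis
      using has_derivative_compose[OF dir_deriv_has_derivative[of f p], of h "(*) (dir_deriv 1 h (f p))"]
        Suc.prems by simp
  qed
  have "dir_deriv v (\<lambda>x. h (f x)) = (\<lambda>x. dir_deriv 1 h (f x) * dir_deriv v f x)" for v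
    using dir_deriv_eqI[OF *] by auto
  moreover have "(\<lambda>x. h (f x)) differentiable (at p)" for p
    using * by (auto simp: differentiable_def)
  moreover have "Ck k (\<lambda>x. dir_deriv 1 h (f x) * dir_deriv v f x)" for v
    by (rule Ck_mult[OF Suc.IH]) (use Suc.prems Ck_Suc_D in auto)
  ultimately show ?case by simp
qed

lemma Ck_inverse:
  "Ck k f \<Longrightarrow> (\<And>x. f x \<noteq> 0) \<Longrightarrow> Ck k (\<lambda>x. inverse (f x))"
proof (induction k arbitrary: f)
  case (Suc k)
  have "f differentiable (at p)" for p
    using Suc.prems(1) by simp
  note * = Deriv.has_derivative_inverse[OF Suc.prems(2) dir_deriv_has_derivative[OF this]]
  have "dir_deriv v (\<lambda>x. inverse (f x))
      = (\<lambda>x. (-1) * (inverse (f x) * dir_deriv v f x * inverse (f x)))" for v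
    using dir_deriv_eqI[OF *] by auto
  moreover have "(\<lambda>x. inverse (f x)) differentiable (at p)" for p
    using * by (auto simp: differentiable_def)
  moreover have "Ck k (\<lambda>x. (-1) * (inverse (f x) * dir_deriv v f x * inverse (f x)))" for v
  proof -
    have "Ck k (\<lambda>x. inverse (f x))" "Ck k (dir_deriv v f)"
      using Suc.IH[OF Ck_Suc_D[OF Suc.prems(1)] Suc.prems(2)] Suc.prems(1) by simp_all
    then show ?thesis
      by (intro Ck_mult Ck_const)
  qed
  ultimately show ?case by (simp only: Ck.simps(2) simp_thms)
qed (simp add: Topological_Spaces.continuous_on_def Limits.tendsto_inverse)

lemma Ck_real_derivI:
  fixes h :: "real \<Rightarrow> real"
  assumes "\<And>x. (h has_real_derivative h' x) (at x)" "Ck k h'"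
  shows "Ck (Suc k) h"
proof -
  have "dir_deriv v h = (\<lambda>x. v * h' x)" for v
    using assms dir_deriv_real_eqI by blast
  moreover have "h differentiable (at x)" for x
    using assms real_differentiable_def by blast
  ultimately show ?thesis
    by (auto intro: Ck_mult Ck_const assms(2))
qed

text \<open>The functions \<open>p (1 / x) exp (- 1 / x)\<close>, extended by zero to \<open>x \<le> 0\<close>. Carrying the
  polynomial along makes the family closed under differentiation, so that smoothness follows by one
  induction.\<close>

definition flat :: "real poly \<Rightarrow> real \<Rightarrow> real"
  where "flat p x = (if x > 0 then poly p (1 / x) * exp (- (1 / x)) else 0)"

lemma poly_exp_tendsto_0: "((\<lambda>y::real. poly p y * exp (- y)) \<longlongrightarrow> 0) at_top"
proof -
  have "((\<lambda>y::real. y ^ k * exp (- y)) \<longlongrightarrow> 0) at_top" for k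
    using tendsto_power_div_exp_0[of k] by (simp add: exp_minus divide_inverse)
  then have "((\<lambda>y. \<Sum>i\<le>degree (p). coeff (p) i * (y ^ i * exp (- y))) \<longlongrightarrow> (\<Sum>i\<le>degree (p). coeff (p) i * 0)) at_top"
    by (intro tendsto_sum tendsto_mult tendsto_const)
  then show ?thesis
    by (simp only: poly_altdef sum_distrib_right mult.assoc mult_zero_right sum.neutral_const)
qed

lemma flat_has_derivative:
  "(flat p has_real_derivative flat ([:0, 0, 1:] * (p - pderiv p)) x) (at x)"
proof -
  consider "x > 0" | "x < 0" | "x = 0" by linarith
  then show ?thesis
  proof cases
    case 1
    have i: "((\<lambda>x. 1 / x) has_real_derivative - ((1 / x) * (1 / x))) (at x)"
      using 1 by (auto intro!: derivative_eq_intros)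
    have "((\<lambda>x. poly p (1 / x) * exp (- (1 / x))) has_real_derivative
        poly (pderiv p) (1 / x) * - ((1 / x) * (1 / x)) * exp (- (1 / x))
        + exp (- (1 / x)) * - (- ((1 / x) * (1 / x))) * poly p (1 / x)) (at x)"
      by (intro DERIV_mult DERIV_chain2[OF poly_DERIV i] DERIV_chain2[OF DERIV_exp] DERIV_minus i)
    also have "poly (pderiv p) (1 / x) * - ((1 / x) * (1 / x)) * exp (- (1 / x))
        + exp (- (1 / x)) * - (- ((1 / x) * (1 / x))) * poly p (1 / x)
        = flat ([:0, 0, 1:] * (p - pderiv p)) x"
      using 1 by (simp only: flat_def) (simp add: algebra_simps)
    finally have "((\<lambda>x. poly p (1 / x) * exp (- (1 / x))) has_real_derivative
        flat ([:0, 0, 1:] * (p - pderiv p)) x) (at x)" .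
    then show ?thesis
      by (rule has_field_derivative_transform_within_open[of _ _ _ "{0<..}"])
        (use 1 in \<open>auto simp: flat_def\<close>)
  next
    case 2
    have "((\<lambda>x::real. 0) has_real_derivative flat ([:0, 0, 1:] * (p - pderiv p)) x) (at x)"
      using 2 by (auto simp: flat_def)
    then show ?thesis
      by (rule has_field_derivative_transform_within_open[of _ _ _ "{..<0}"])
        (use 2 in \<open>auto simp: flat_def\<close>)
  next
    case 3
    have "((\<lambda>y. poly (pCons 0 p) y * exp (- y)) \<longlongrightarrow> 0) at_top"
      by (rule poly_exp_tendsto_0)
    then have "((\<lambda>x. poly (pCons 0 p) (1 / x) * exp (- (1 / x))) \<longlongrightarrow> 0) (at_right (0::real))"
      by (rule filterlim_compose) (rule filterlim_inverse_at_top_right[unfolded inverse_eq_divide])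
    then have "((\<lambda>h. flat p h / h) \<longlongrightarrow> 0) (at_right 0)"
      by (rule Lim_transform_eventually)
        (auto simp: flat_def eventually_at_right_less eventually_at_filter)
    moreover have "((\<lambda>h. flat p h / h) \<longlongrightarrow> 0) (at_left 0)"
      by (rule Lim_transform_eventually[OF tendsto_const])
        (auto simp: flat_def eventually_at_filter)
    ultimately have "((\<lambda>h. flat p h / h) \<longlongrightarrow> 0) (at 0)"
      by (simp add: filterlim_at_split)
    then show ?thesis
      using 3 by (simp add: DERIV_def flat_def)
  qed
qed

lemma Ck_flat: "Ck k (flat p)"
proof (induction k arbitrary: p)
  case 0
  show ?case
    by (auto intro!: continuous_at_imp_continuous_on DERIV_isCont[OF flat_has_derivative])
next
  case (Suc k)
  show ?case
    by (rule Ck_real_derivI[OF flat_has_derivative Suc])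
qed

text \<open>A smooth transition from 0 to 1 inside \<open>[0, 1]\<close>. From it come all test functions below: its
  derivative is a bump of integral 1, and differences of steeper copies approximate indicators of
  intervals.\<close>

definition smooth_step :: "real \<Rightarrow> real"
  where "smooth_step x = flat 1 x * inverse (flat 1 x + flat 1 (1 - x))"

definition bump :: "real \<Rightarrow> real"
  where "bump = dir_deriv 1 smooth_step"

lemma flat_1_nonneg: "flat 1 x \<ge> 0"
  by (simp add: flat_def)

lemma smooth_step_denom_pos: "flat 1 x + flat 1 (1 - x) > 0"
  using flat_1_nonneg[of x] flat_1_nonneg[of "1 - x"]
  by (cases "x > 0") (auto simp: flat_def add_pos_pos)

lemma Ck_reflect: "Ck k (\<lambda>x::real. 1 - x)"
  using Ck_add[OF Ck_const[of k 1] Ck_mult[OF Ck_const[of k "-1"] Ck_linear[OF bounded_linear_ident]]]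
  by simp

lemma Ck_smooth_step: "Ck k smooth_step"
  unfolding smooth_step_def[abs_def]
  by (intro Ck_mult Ck_inverse Ck_add Ck_flat Ck_compose[OF Ck_flat] Ck_reflect)
    (metis smooth_step_denom_pos less_irrefl)

lemma Ck_bump: "Ck k bump"
  using Ck_smooth_step[of "Suc k"] by (simp add: bump_def)

lemma smooth_step_has_derivative [derivative_intros]:
  "(smooth_step has_real_derivative bump x) (at x)"
  unfolding bump_def using Ck_smooth_step[of 1]
  by (intro dir_deriv_real_has_derivative) auto

lemma smooth_step_0: "x \<le> 0 \<Longrightarrow> smooth_step x = 0"
  by (simp add: smooth_step_def flat_def)

lemma smooth_step_1: "x \<ge> 1 \<Longrightarrow> smooth_step x = 1"
  using smooth_step_denom_pos[of x] by (simp add: smooth_step_def flat_def)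

lemma smooth_step_range: "0 \<le> smooth_step x" "smooth_step x \<le> 1"
  using smooth_step_denom_pos[of x] flat_1_nonneg[of x] flat_1_nonneg[of "1 - x"]
  by (auto simp: smooth_step_def field_simps)

lemma bump_nonneg: "bump x \<ge> 0"
proof -
  let ?F = "flat 1" and ?G = "flat ([:0, 0, 1:] * (1 - pderiv 1))"
  have d: "(flat 1 has_real_derivative ?G x) (at x)" for x
    by (rule flat_has_derivative)
  have G: "?G x \<ge> 0" for x by (auto simp: flat_def)
  have 1: "((\<lambda>x. ?F (1 - x)) has_real_derivative - ?G (1 - x)) (at x)"
  proof -
    have "((\<lambda>x. 1 - x) has_real_derivative - 1) (at x)"
      by (auto intro!: derivative_eq_intros)
    from DERIV_chain2[OF d this] show ?thesis by simp
  qed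
  have "((\<lambda>x. ?F x / (?F x + ?F (1 - x))) has_real_derivative
     (?G x * (?F x + ?F (1 - x)) - ?F x * (?G x + - ?G (1 - x))) / ((?F x + ?F (1 - x)) * (?F x + ?F (1 - x)))) (at x)"
    by (intro DERIV_divide DERIV_add d 1) (rule less_imp_neq[OF smooth_step_denom_pos, symmetric])
  then have "(smooth_step has_real_derivative
     (?G x * (?F x + ?F (1 - x)) - ?F x * (?G x + - ?G (1 - x))) / ((?F x + ?F (1 - x)) * (?F x + ?F (1 - x)))) (at x)"
    by (simp only: smooth_step_def[abs_def] divide_inverse)
  from DERIV_unique[OF smooth_step_has_derivative this]
  have "bump x = (?G x * (?F x + ?F (1 - x)) - ?F x * (?G x + - ?G (1 - x))) / ((?F x + ?F (1 - x)) * (?F x + ?F (1 - x)))" .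
  also have "\<dots> = (?G x * ?F (1 - x) + ?F x * ?G (1 - x)) / (?F x + ?F (1 - x))\<^sup>2"
    by (simp only: power2_eq_square) (simp only: ring_distribs mult_minus_right, simp)
  also have "\<dots> \<ge> 0"
    by (intro divide_nonneg_nonneg add_nonneg_nonneg mult_nonneg_nonneg G flat_1_nonneg) auto
  finally show ?thesis .
qed

lemma bump_0: "x \<notin> {0..1} \<Longrightarrow> bump x = 0"
  unfolding bump_def
proof (cases "x < 0")
  case True
  then show "dir_deriv 1 smooth_step x = 0"
    by (intro dir_deriv_locally_constant[of "{..<0}"]) (auto simp: smooth_step_0)
next
  case False
  assume "x \<notin> {0..1}"
  with False show "dir_deriv 1 smooth_step x = 0"
    by (intro dir_deriv_locally_constant[of "{1<..}"]) (auto simp: smooth_step_1)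
qed

section \<open>Test functions of one and of two variables\<close>

lemma test_functionI:
  fixes a :: "real \<Rightarrow> real"
  assumes "\<And>k. Ck k a" "\<And>x. R < \<bar>x\<bar> \<Longrightarrow> a x = 0"
  shows "test_function a"
proof -
  have "{p. a p \<noteq> 0} \<subseteq> {-R..R}"
    using assms(2) by (force simp: abs_if not_less split: if_splits)
  then show ?thesis
    unfolding test_function_def using assms(1)
    by (auto intro: bounded_subset[OF bounded_closed_interval])
qed

lemma test_function_Ck: "test_function \<phi> \<Longrightarrow> Ck k \<phi>"
  by (simp add: test_function_def)

lemma test_function_continuous: "test_function \<phi> \<Longrightarrow> continuous_on A \<phi>"
  using test_function_Ck[of \<phi> 0] continuous_on_subset by auto

lemma test_function_differentiable: "test_function \<phi> \<Longrightarrow> \<phi> differentiable (at p)"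
  using test_function_Ck[of \<phi> 1] by simp

lemma test_function_has_derivative:
  fixes a :: "real \<Rightarrow> real"
  shows "test_function a \<Longrightarrow> (a has_real_derivative dir_deriv 1 a x) (at x)"
  by (intro dir_deriv_real_has_derivative test_function_differentiable)

lemma test_function_support:
  fixes a :: "real \<Rightarrow> real"
  assumes "test_function a"
  obtains R where "R > 0" "\<And>x. R < \<bar>x\<bar> \<Longrightarrow> a x = 0"
proof -
  have "bounded {p. a p \<noteq> 0}"
    using assms by (auto simp: test_function_def)
  then obtain R where "\<forall>x\<in>{p. a p \<noteq> 0}. norm x \<le> R" "R > 0"
    using bounded_pos by blast
  then show ?thesis using that by (force simp: not_le)
qed

lemma test_function_deriv:
  fixes a :: "real \<Rightarrow> real"
  assumes "test_function a"
  shows "test_function (dir_deriv 1 a)"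
proof -
  obtain R where R: "R > 0" "\<And>x. R < \<bar>x\<bar> \<Longrightarrow> a x = 0"
    using test_function_support[OF assms] by blast
  show ?thesis
  proof (rule test_functionI[where R = R])
    show "Ck k (dir_deriv 1 a)" for k
      using test_function_Ck[OF assms, of "Suc k"] by simp
    fix x :: real assume x: "R < \<bar>x\<bar>"
    have "open {x::real. R < \<bar>x\<bar>}"
      by (intro open_Collect_less continuous_intros)
    then show "dir_deriv 1 a x = 0"
      by (rule dir_deriv_locally_constant) (use x R in auto)
  qed
qed

lemma test_function_bounded:
  fixes a :: "real \<Rightarrow> real"
  assumes "test_function a"
  obtains B where "B > 0" "\<And>x. \<bar>a x\<bar> \<le> B"
proof -
  obtain R where R: "R > 0" "\<And>x. R < \<bar>x\<bar> \<Longrightarrow> a x = 0"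
    using test_function_support[OF assms] by blast
  have "compact (a ` {-R..R})"
    by (intro compact_continuous_image test_function_continuous assms) auto
  then obtain B where B: "\<forall>y\<in>a ` {-R..R}. norm y \<le> B" "B > 0"
    using bounded_pos compact_imp_bounded by blast
  have "\<bar>a x\<bar> \<le> B" for x
    using B R(2)[of x] by (cases "\<bar>x\<bar> \<le> R") (auto simp: abs_le_iff)
  then show ?thesis using that B by blast
qed

lemma test_function_bump: "test_function bump"
  by (rule test_functionI[where R = 1]) (auto intro: Ck_bump bump_0)

lemma Ck_affine: "Ck k (\<lambda>x::real. c * x + d)"
  by (intro Ck_add Ck_const Ck_mult Ck_linear bounded_linear_ident)

lemma test_function_affine:
  fixes a :: "real \<Rightarrow> real"
  assumes "test_function a" "c \<noteq> 0"
  shows "test_function (\<lambda>x. a (c * x + d))"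
proof -
  obtain R where R: "R > 0" "\<And>x. R < \<bar>x\<bar> \<Longrightarrow> a x = 0"
    using test_function_support[OF assms(1)] by blast
  show ?thesis
  proof (rule test_functionI[where R = "(R + \<bar>d\<bar>) / \<bar>c\<bar>"])
    show "Ck k (\<lambda>x. a (c * x + d))" for k
      by (rule Ck_compose[OF test_function_Ck[OF assms(1)] Ck_affine])
    fix x :: real assume "(R + \<bar>d\<bar>) / \<bar>c\<bar> < \<bar>x\<bar>"
    then have "R + \<bar>d\<bar> < \<bar>c * x\<bar>"
      using assms(2) by (simp add: field_simps abs_mult)
    then show "a (c * x + d) = 0"
      by (intro R(2)) linarith
  qed
qed

text \<open>Products \<open>a (x - c t) b t\<close> are the only test functions of two variables that the proof needs:
  the factor \<open>b\<close> localizes in time, and \<open>a\<close> observes the solution from a frame of speed \<open>c\<close>.\<close>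

lemma moving_frame_product:
  fixes a b :: "real \<Rightarrow> real" and c x t :: real
  assumes a: "test_function a" and b: "test_function b"
  defines "\<phi> \<equiv> \<lambda>(x, t). a (x - c * t) * b t"
  shows "test_function \<phi>"
    and "deriv_x \<phi> (x, t) = dir_deriv 1 a (x - c * t) * b t"
    and "deriv_t \<phi> (x, t) = a (x - c * t) * dir_deriv 1 b t - c * dir_deriv 1 a (x - c * t) * b t"
proof -
  have \<phi>: "\<phi> = (\<lambda>p. a (fst p - c * snd p) * b (snd p))"
    by (auto simp: \<phi>_def)
  obtain R where R: "R > 0" "\<And>x. R < \<bar>x\<bar> \<Longrightarrow> a x = 0"
    using test_function_support[OF a] by blast
  obtain Q where Q: "Q > 0" "\<And>x. Q < \<bar>x\<bar> \<Longrightarrow> b x = 0"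
    using test_function_support[OF b] by blast
  have "{p. \<phi> p \<noteq> 0} \<subseteq> cbox (- R - \<bar>c\<bar> * Q, - Q) (R + \<bar>c\<bar> * Q, Q)"
  proof
    fix p assume "p \<in> {p. \<phi> p \<noteq> 0}"
    then have "\<bar>fst p - c * snd p\<bar> \<le> R" and t: "\<bar>snd p\<bar> \<le> Q"
      using R Q by (force simp: \<phi>)+
    moreover have "\<bar>c * snd p\<bar> \<le> \<bar>c\<bar> * Q"
      using t by (simp add: abs_mult mult_left_mono)
    ultimately show "p \<in> cbox (- R - \<bar>c\<bar> * Q, - Q) (R + \<bar>c\<bar> * Q, Q)"
      by (cases p) (auto simp: cbox_Pair_eq)
  qed
  moreover have "bounded_linear (\<lambda>p::real \<times> real. fst p - c * snd p)"
    by (intro bounded_linear_sub bounded_linear_fst bounded_linear_const_mult bounded_linear_snd)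
  then have "Ck k \<phi>" for k
    unfolding \<phi>
    by (rule Ck_mult[OF Ck_compose[OF test_function_Ck[OF a] Ck_linear]
          Ck_compose[OF test_function_Ck[OF b] Ck_linear[OF bounded_linear_snd]]])
  ultimately show "test_function \<phi>"
    unfolding test_function_def by (auto intro: bounded_subset[OF bounded_cbox])
  have "(\<phi> has_derivative (\<lambda>h. a (x - c * t) * (dir_deriv 1 b t * snd h)
      + (dir_deriv 1 a (x - c * t) * (fst h - c * snd h)) * b t)) (at (x, t))"
  proof -
    have 1: "((\<lambda>p. a (fst p - c * snd p)) has_derivative
        (\<lambda>h. dir_deriv 1 a (x - c * t) * (fst h - c * snd h))) (at (x, t))"
      using test_function_has_derivative[OF a, of "x - c * t"]
      by (intro has_derivative_compose[where g = a and f = "\<lambda>p. fst p - c * snd p"])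
        (auto simp: has_field_derivative_def intro!: derivative_eq_intros)
    have 2: "((\<lambda>p. b (snd p)) has_derivative (\<lambda>h. dir_deriv 1 b t * snd h)) (at (x, t))"
      using test_function_has_derivative[OF b, of t]
      by (intro has_derivative_compose[where g = b and f = snd])
        (auto simp: has_field_derivative_def intro!: derivative_eq_intros)
    show ?thesis
      unfolding \<phi> using has_derivative_mult[OF 1 2] by simp
  qed
  note D = dir_deriv_eqI[OF this]
  show "deriv_x \<phi> (x, t) = dir_deriv 1 a (x - c * t) * b t"
    and "deriv_t \<phi> (x, t) = a (x - c * t) * dir_deriv 1 b t - c * dir_deriv 1 a (x - c * t) * b t"
    using D[of "(1, 0)"] D[of "(0, 1)"] by (simp_all add: algebra_simps)
qed

lemma integrable_compact_support:
  fixes f :: "real \<Rightarrow> real"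
  assumes "continuous_on UNIV f" "\<And>x. R < \<bar>x\<bar> \<Longrightarrow> f x = 0"
  shows "integrable lborel f"
proof -
  have "integrable lborel (\<lambda>x. indicator {-R..R} x *\<^sub>R f x)"
    by (intro borel_integrable_compact continuous_on_subset[OF assms(1)]) auto
  also have "(\<lambda>x. indicator {-R..R} x *\<^sub>R f x) = f"
    using assms(2) by (force simp: indicator_def fun_eq_iff not_le)
  finally show ?thesis .
qed

lemma integrable_mult_test_function:
  fixes a w :: "real \<Rightarrow> real"
  assumes "test_function a" "continuous_on UNIV w"
  shows "integrable lborel (\<lambda>x. a x * w x)"
proof -
  obtain R where "\<And>x. R < \<bar>x\<bar> \<Longrightarrow> a x = 0"
    using test_function_support[OF assms(1)] by blast
  then show ?thesis
    by (intro integrable_compact_support[where R = R] continuous_on_mult assms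
        test_function_continuous) auto
qed

text \<open>A mollifier supported in \<open>[0, 1 / (n + 1)]\<close>. It looks to the right only, as suits distribution
  functions, which are continuous from the right; \<open>step n\<close> is its primitive.\<close>

definition delta :: "nat \<Rightarrow> real \<Rightarrow> real"
  where "delta n x = real (Suc n) * bump (real (Suc n) * x)"

definition step :: "nat \<Rightarrow> real \<Rightarrow> real"
  where "step n x = smooth_step (real (Suc n) * x)"

lemma test_function_delta: "test_function (\<lambda>x. delta n (x - y))"
proof -
  have *: "test_function (\<lambda>x. bump (real (Suc n) * x + - (real (Suc n) * y)))"
    by (rule test_function_affine[OF test_function_bump]) simp
  have "Ck k (\<lambda>x. real (Suc n) * bump (real (Suc n) * x + - (real (Suc n) * y)))" for k
    by (rule Ck_mult[OF Ck_const test_function_Ck[OF *]])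
  moreover obtain R where "\<And>x. R < \<bar>x\<bar> \<Longrightarrow> bump (real (Suc n) * x + - (real (Suc n) * y)) = 0"
    using test_function_support[OF *] by blast
  moreover have "(\<lambda>x. delta n (x - y)) = (\<lambda>x. real (Suc n) * bump (real (Suc n) * x + - (real (Suc n) * y)))"
    by (simp add: delta_def[abs_def] algebra_simps)
  ultimately show ?thesis
    using test_functionI[of "\<lambda>x. real (Suc n) * bump (real (Suc n) * x + - (real (Suc n) * y))" R]
    by (simp only: mult_zero_right)
qed

lemma delta_0: "x \<notin> {0..1 / real (Suc n)} \<Longrightarrow> delta n x = 0"
  unfolding delta_def by (subst bump_0) (auto simp: field_simps zero_le_mult_iff simp del: of_nat_Suc)

lemma step_has_derivative:
  "((\<lambda>x. step n (x - y)) has_real_derivative delta n (x - y)) (at x)"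
  unfolding step_def delta_def
  by (rule DERIV_chain2[OF smooth_step_has_derivative, of _ "real (Suc n)", THEN DERIV_cong])
    (auto intro!: derivative_eq_intros simp del: of_nat_Suc)

lemma Ck_step: "Ck k (\<lambda>x. step n (x - y))"
  using Ck_compose[OF Ck_smooth_step Ck_affine[of k "real (Suc n)" "- real (Suc n) * y"]]
  by (simp add: step_def[abs_def] algebra_simps)

lemma step_tendsto: "(\<lambda>n. step n x) \<longlonglongrightarrow> indicator {0<..} x"
proof (cases "x > 0")
  case True
  obtain N where N: "1 < real (Suc N) * x"
  proof -
    obtain N where "1 / x < real N"
      using reals_Archimedean2 by blast
    then have "1 < real (Suc N) * x"
      using True by (simp add: field_simps)
    then show ?thesis using that by blast
  qed
  have "step n x = 1" if "n \<ge> N" for n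
  proof -
    have "real (Suc N) * x \<le> real (Suc n) * x"
      using that True by (intro mult_right_mono) auto
    with N show ?thesis
      unfolding step_def by (intro smooth_step_1) linarith
  qed
  then have "eventually (\<lambda>n. step n x = indicator {0<..} x) sequentially"
    using True by (auto simp: eventually_sequentially)
  then show ?thesis by (rule tendsto_eventually)
next
  case False
  then have "step n x = 0" for n
    unfolding step_def by (intro smooth_step_0) (simp add: mult_nonneg_nonpos)
  with False show ?thesis by simp
qed

lemma step_0: "x \<le> 0 \<Longrightarrow> step n x = 0"
  unfolding step_def by (intro smooth_step_0) (simp add: mult_nonneg_nonpos)

lemma step_1: "1 / real (Suc n) \<le> x \<Longrightarrow> step n x = 1"
  unfolding step_def by (intro smooth_step_1) (simp add: field_simps)

lemma step_range: "0 \<le> step n x" "step n x \<le> 1"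
  by (auto simp: step_def smooth_step_range)

lemma integrable_bump: "integrable lborel bump" and integral_bump: "(LINT x|lborel. bump x) = 1"
proof -
  have i: "bump x * indicator {0..1} x = bump x" for x
    using bump_0[of x] by (auto simp: indicator_def)
  have c: "isCont bump x" for x
    using test_function_continuous[OF test_function_bump, of UNIV]
    by (simp add: continuous_on_eq_continuous_at)
  show "integrable lborel bump"
    using integrable_mult_test_function[OF test_function_bump, of "\<lambda>_. 1"] by simp
  show "(LINT x|lborel. bump x) = 1"
    using integral_FTC_Icc_real[of 0 1 smooth_step bump] smooth_step_has_derivative c i
    by (simp add: smooth_step_0 smooth_step_1)
qed

lemma borel_measurable_bump [measurable]: "bump \<in> borel_measurable borel"
  using test_function_continuous[OF test_function_bump] by (intro borel_measurable_continuous_onI)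

lemma borel_measurable_delta [measurable]: "delta n \<in> borel_measurable borel"
  unfolding delta_def[abs_def] by measurable

lemma delta_integral_scaled:
  "(LINT x|lborel. delta n (x - y) * w x) = (LINT s|lborel. bump s * w (y + s / real (Suc n)))"
proof -
  have "(LINT x|lborel. delta n (x - y) * w x)
      = (1 / real (Suc n)) * (LINT s|lborel. real (Suc n) * (bump s * w (y + s / real (Suc n))))"
    by (subst lborel_integral_real_affine[where c = "1 / real (Suc n)" and t = y])
      (auto simp: delta_def mult.assoc simp del: of_nat_Suc)
  then show ?thesis
    by (simp only: integral_mult_right_zero) simp
qed

text \<open>Since the mollifier looks to the right, a right limit of \<open>w\<close> suffices.\<close>

lemma delta_tendsto:
  fixes w :: "real \<Rightarrow> real"
  assumes [measurable]: "w \<in> borel_measurable borel"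
    and B: "\<And>x. x \<in> {y..y+1} \<Longrightarrow> \<bar>w x\<bar> \<le> B"
    and lim: "(w \<longlongrightarrow> w y) (at_right y)"
  shows "(\<lambda>n. LINT x|lborel. delta n (x - y) * w x) \<longlonglongrightarrow> w y"
proof -
  have "(\<lambda>n. LINT s|lborel. bump s * w (y + s / real (Suc n))) \<longlonglongrightarrow> (LINT s|lborel. bump s * w y)"
  proof (rule integral_dominated_convergence[where w = "\<lambda>s. bump s * B"])
    show "integrable lborel (\<lambda>s. bump s * B)"
      using integrable_bump by simp
    show "AE s in lborel. norm (bump s * w (y + s / real (Suc n))) \<le> bump s * B" for n
    proof (rule AE_I2)
      fix s :: real
      show "norm (bump s * w (y + s / real (Suc n))) \<le> bump s * B"
      proof (cases "s \<in> {0..1}")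
        case True
        then have "s / real (Suc n) \<le> 1" "0 \<le> s / real (Suc n)"
          by (auto simp: field_simps)
        then show ?thesis
          using B[of "y + s / real (Suc n)"] bump_nonneg[of s]
          by (simp add: abs_mult mult_left_mono)
      qed (simp add: bump_0)
    qed
    show "AE s in lborel. (\<lambda>n. bump s * w (y + s / real (Suc n))) \<longlonglongrightarrow> bump s * w y"
    proof (rule AE_I2)
      fix s :: real
      show "(\<lambda>n. bump s * w (y + s / real (Suc n))) \<longlonglongrightarrow> bump s * w y"
      proof (cases "s \<in> {0..1}")
        case True
        show ?thesis
        proof (cases "s = 0")
          case False
          with True have s: "s > 0" by simp
          have "(\<lambda>n. y + s / real (Suc n)) \<longlonglongrightarrow> y + 0"
            by (intro tendsto_add tendsto_const LIMSEQ_Suc[OF lim_const_over_n])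
          then have "filterlim (\<lambda>n. y + s / real (Suc n)) (at_right y) sequentially"
            using s by (auto simp: filterlim_at)
          from filterlim_compose[OF lim this] show ?thesis
            by (intro tendsto_mult tendsto_const)
        qed simp
      qed (simp add: bump_0)
    qed
  qed auto
  also have "(LINT s|lborel. bump s * w y) = w y"
    using integral_bump by simp
  finally show ?thesis
    by (simp add: delta_integral_scaled del: of_nat_Suc)
qed

section \<open>Primitives and weak derivatives on the line\<close>

text \<open>\<open>f\<close> is locally absolutely continuous with almost everywhere derivative \<open>g\<close>, expressed through
  increments so that no differentiation theorem is involved.\<close>

definition primitive :: "(real \<Rightarrow> real) \<Rightarrow> (real \<Rightarrow> real) \<Rightarrow> bool"
  where "primitive f g \<longleftrightarrow> continuous_on UNIV f \<and> g \<in> borel_measurable borel \<and>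
    (\<forall>x y. x \<le> y \<longrightarrow> set_integrable lborel {x..y} g \<and> f y - f x = (LINT s:{x..y}|lborel. g s))"

text \<open>The lemma of du Bois-Reymond: the difference of a steep step at \<open>x\<close> and a steep step at \<open>y\<close> is a
  test function that approximates the indicator of \<open>(x, y]\<close>, while its derivative evaluates \<open>w\<close>
  at the two end points.\<close>

lemma weak_deriv_primitive:
  assumes wd: "has_weak_deriv 1 w g" and w: "continuous_on UNIV w"
  shows "primitive w g"
proof -
  have gm [measurable]: "g \<in> borel_measurable borel"
    and gi: "set_integrable lborel {x..y} g" for x y
    using wd by (auto simp: has_weak_deriv_def locally_integrable_def)
  have wm [measurable]: "w \<in> borel_measurable borel"
    using w by (intro borel_measurable_continuous_onI)
  have "w y - w x = (LINT s:{x..y}|lborel. g s)" if xy: "x \<le> y" for x y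
  proof -
    define b where "b n s = step n (s - x) - step n (s - y)" for n s
    have b_deriv: "(b n has_real_derivative delta n (s - x) - delta n (s - y)) (at s)" for n s
      unfolding b_def[abs_def] by (intro DERIV_diff step_has_derivative)
    have b_0: "b n s = 0" if "s \<notin> {x..y+1}" for n s
    proof (cases "s < x")
      case True
      then show ?thesis using xy by (simp add: b_def step_0)
    next
      case False
      then have "s > y + 1" using that by auto
      moreover have "1 / real (Suc n) \<le> 1" by simp
      ultimately have "1 / real (Suc n) \<le> s - x" "1 / real (Suc n) \<le> s - y"
        using xy by linarith+
      then show ?thesis by (simp only: b_def step_1)
    qed
    have b_1: "\<bar>b n s\<bar> \<le> 1" for n s
      using step_range[of n "s - x"] step_range[of n "s - y"] by (simp add: b_def)
    have b_cont: "continuous_on UNIV (b n)" for n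
      using b_deriv by (intro continuous_at_imp_continuous_on) (auto dest: DERIV_isCont)
    have bm [measurable]: "b n \<in> borel_measurable borel" for n
      by (rule borel_measurable_continuous_onI[OF b_cont])
    have b_test: "test_function (b n)" for n
    proof (rule test_functionI[where R = "\<bar>x\<bar> + \<bar>y\<bar> + 1"])
      have "Ck k (\<lambda>s. step n (s - x) + (-1) * step n (s - y))" for k
        by (intro Ck_add Ck_mult[OF Ck_const] Ck_step)
      then show "Ck k (b n)" for k
        by (simp add: b_def[abs_def])
      show "b n s = 0" if "\<bar>x\<bar> + \<bar>y\<bar> + 1 < \<bar>s\<bar>" for s
        using that by (intro b_0) auto
    qed
    have id: "(LINT s|lborel. delta n (s - x) * w s) - (LINT s|lborel. delta n (s - y) * w s)
        = - (LINT s|lborel. g s * b n s)" for n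
    proof -
      have "(LINT s|lborel. w s * dir_deriv 1 (b n) s) = - (LINT s|lborel. g s * b n s)"
        using wd b_test by (simp add: has_weak_deriv_def)
      moreover have "w s * dir_deriv 1 (b n) s = delta n (s - x) * w s - delta n (s - y) * w s" for s
        by (simp add: dir_deriv_real_eqI[OF b_deriv] algebra_simps)
      ultimately show ?thesis
        using integrable_mult_test_function[OF test_function_delta w] by simp
    qed
    have lim_w: "(\<lambda>n. LINT s|lborel. delta n (s - z) * w s) \<longlonglongrightarrow> w z" for z
    proof -
      have "compact (w ` {z..z+1})"
        using w by (intro compact_continuous_image continuous_on_subset[OF w]) auto
      then obtain B where "\<forall>v\<in>w ` {z..z+1}. norm v \<le> B"
        using compact_imp_bounded bounded_iff by blast
      then have "\<And>s. s \<in> {z..z+1} \<Longrightarrow> \<bar>w s\<bar> \<le> B" by auto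
      moreover have "(w \<longlongrightarrow> w z) (at_right z)"
        using w by (simp add: continuous_on_eq_continuous_at continuous_at_imp_continuous_at_within
            continuous_within[symmetric])
      ultimately show ?thesis by (intro delta_tendsto) auto
    qed
    have lim_g: "(\<lambda>n. LINT s|lborel. g s * b n s) \<longlonglongrightarrow> (LINT s|lborel. g s * indicator {x<..y} s)"
    proof (rule integral_dominated_convergence[where w = "\<lambda>s. \<bar>indicator {x..y+1} s *\<^sub>R g s\<bar>"])
      show "integrable lborel (\<lambda>s. \<bar>indicator {x..y+1} s *\<^sub>R g s\<bar>)"
        using gi[of x "y + 1"] unfolding set_integrable_def by (rule integrable_abs)
      show "AE s in lborel. norm (g s * b n s) \<le> \<bar>indicator {x..y+1} s *\<^sub>R g s\<bar>" for n
      proof (rule AE_I2)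
        fix s
        show "norm (g s * b n s) \<le> \<bar>indicator {x..y+1} s *\<^sub>R g s\<bar>"
          using b_0[of s n] b_1[of n s]
          by (cases "s \<in> {x..y+1}") (auto simp: abs_mult intro: mult_left_le)
      qed
      show "AE s in lborel. (\<lambda>n. g s * b n s) \<longlonglongrightarrow> g s * indicator {x<..y} s"
      proof (rule AE_I2)
        fix s
        have "(\<lambda>n. b n s) \<longlonglongrightarrow> indicator {0<..} (s - x) - indicator {0<..} (s - y)"
          unfolding b_def by (intro tendsto_diff step_tendsto)
        also have "indicator {0<..} (s - x) - indicator {0<..} (s - y) = (indicator {x<..y} s :: real)"
          using xy by (auto simp: indicator_def)
        finally show "(\<lambda>n. g s * b n s) \<longlonglongrightarrow> g s * indicator {x<..y} s"
          by (intro tendsto_mult tendsto_const)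
      qed
    qed auto
    have "w x - w y = - (LINT s|lborel. g s * indicator {x<..y} s)"
      by (rule LIMSEQ_unique[OF tendsto_diff[OF lim_w lim_w]])
        (simp only: id tendsto_minus[OF lim_g])
    also have "(LINT s|lborel. g s * indicator {x<..y} s) = (LINT s:{x..y}|lborel. g s)"
      unfolding set_lebesgue_integral_def
    proof (rule integral_cong_AE)
      have "AE s in lborel. s \<noteq> x" by (rule AE_lborel_singleton)
      then show "AE s in lborel. g s * indicator {x<..y} s = indicator {x..y} s *\<^sub>R g s"
        by eventually_elim (auto simp: indicator_def)
    qed auto
    finally show ?thesis by simp
  qed
  then show ?thesis using gm gi w by (simp add: primitive_def)
qed

lemma has_weak_derivI_continuous:
  fixes g n :: "real \<Rightarrow> real"
  assumes "continuous_on UNIV g" "continuous_on UNIV n"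
    and "\<And>b. test_function b \<Longrightarrow>
      (LINT t|lborel. g t * dir_deriv 1 b t) = - (LINT t|lborel. n t * b t)"
  shows "has_weak_deriv 1 g n"
proof -
  have "locally_integrable f" if "continuous_on UNIV f" for f :: "real \<Rightarrow> real"
    unfolding locally_integrable_def set_integrable_def
    by (intro conjI allI impI borel_measurable_continuous_onI borel_integrable_compact
        continuous_on_subset[OF that] subset_UNIV)
  then show ?thesis
    using assms by (simp add: has_weak_deriv_def)
qed

text \<open>With a continuous density this upgrades an identity between distributions in time to
  differentiability at every time.\<close>

lemma primitive_has_derivative:
  assumes p: "primitive g n" and n: "continuous_on UNIV n"
  shows "(g has_real_derivative n t) (at t)"
proof -
  have "((\<lambda>y. g (t - 1) + integral {t-1..y} n) has_real_derivative n t) (at t within {t-1..t+1})"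
    by (rule DERIV_cong[OF DERIV_add[OF DERIV_const integral_has_real_derivative]])
      (auto intro: continuous_on_subset[OF n])
  then have "(g has_real_derivative n t) (at t within {t-1..t+1})"
  proof (rule has_field_derivative_transform_within[OF _ zero_less_one])
    fix y assume "y \<in> {t-1..t+1}" "dist y t < 1"
    then have "set_integrable lborel {t-1..y} n" "g y - g (t - 1) = (LINT s:{t-1..y}|lborel. n s)"
      using p by (auto simp: primitive_def)
    then show "g (t - 1) + integral {t-1..y} n = g y"
      using set_borel_integral_eq_integral(2) by fastforce
  qed auto
  then show ?thesis
    by (simp add: at_within_Icc_at)
qed

lemma primitiveI_derivative:
  assumes "\<And>x. (f has_real_derivative g x) (at x)" "continuous_on UNIV g"
  shows "primitive f g"
  unfolding primitive_def
proof (intro conjI allI impI)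
  show "continuous_on UNIV f"
    using assms(1) by (intro continuous_at_imp_continuous_on) (auto dest: DERIV_isCont)
  show "g \<in> borel_measurable borel"
    using assms(2) by (rule borel_measurable_continuous_onI)
  fix x y :: real assume xy: "x \<le> y"
  show "set_integrable lborel {x..y} g"
    unfolding set_integrable_def
    by (intro borel_integrable_compact continuous_on_subset[OF assms(2)]) auto
  show "f y - f x = (LINT s:{x..y}|lborel. g s)"
    using integral_FTC_Icc_real[OF xy, of f g] assms
    by (simp add: set_lebesgue_integral_def mult.commute continuous_on_eq_continuous_at)
qed

text \<open>The product rule. Writing \<open>f\<close> and \<open>h\<close> as integrals of their densities, the two halves of the
  right-hand side become integrals of \<open>g x k y\<close> over the triangles below and above the diagonal of
  a square; by Fubini's theorem they add up to the integral over the square.\<close>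

lemma primitive_mult:
  assumes fg: "primitive f g" and hk: "primitive h k"
  shows "primitive (\<lambda>x. f x * h x) (\<lambda>x. g x * h x + f x * k x)"
  unfolding primitive_def
proof (intro conjI allI impI)
  have fc: "continuous_on UNIV f" and hc: "continuous_on UNIV h"
    and gm [measurable]: "g \<in> borel_measurable borel" and km [measurable]: "k \<in> borel_measurable borel"
    using fg hk by (auto simp: primitive_def)
  have fm [measurable]: "f \<in> borel_measurable borel" and hm [measurable]: "h \<in> borel_measurable borel"
    using fc hc by (auto intro: borel_measurable_continuous_onI)
  show "continuous_on UNIV (\<lambda>x. f x * h x)"
    by (intro continuous_on_mult fc hc)
  show "(\<lambda>x. g x * h x + f x * k x) \<in> borel_measurable borel"
    by measurable
  fix \<alpha> \<beta> :: real assume ab: "\<alpha> \<le> \<beta>"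
  define G where "G x = indicator {\<alpha>..\<beta>} x * g x" for x
  define K where "K x = indicator {\<alpha>..\<beta>} x * k x" for x
  have [measurable]: "G \<in> borel_measurable borel" "K \<in> borel_measurable borel"
    unfolding G_def[abs_def] K_def[abs_def] by measurable
  have Gi: "integrable lborel G" and Ki: "integrable lborel K"
    using fg hk ab by (auto simp: primitive_def set_integrable_def G_def[abs_def] K_def[abs_def])
  have bdd: "integrable lborel (\<lambda>x. v x * p x)"
    if v: "integrable lborel v" "\<And>x. x \<notin> {\<alpha>..\<beta>} \<Longrightarrow> v x = 0" and p: "continuous_on UNIV p"
    for v p :: "real \<Rightarrow> real"
  proof -
    have "compact (p ` {\<alpha>..\<beta>})"
      by (intro compact_continuous_image continuous_on_subset[OF p]) auto
    then obtain B where B: "\<And>x. x \<in> {\<alpha>..\<beta>} \<Longrightarrow> \<bar>p x\<bar> \<le> B"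
      using compact_imp_bounded bounded_iff by (metis image_eqI real_norm_def)
    have [measurable]: "p \<in> borel_measurable borel" "v \<in> borel_measurable lborel"
      using p v by (auto intro: borel_measurable_continuous_onI)
    show ?thesis
    proof (rule Bochner_Integration.integrable_bound)
      show "integrable lborel (\<lambda>x. v x * B)" using v by simp
      show "AE x in lborel. norm (v x * p x) \<le> norm (v x * B)"
      proof (rule AE_I2)
        fix x
        show "norm (v x * p x) \<le> norm (v x * B)"
          using B[of x] v(2)[of x] by (cases "x \<in> {\<alpha>..\<beta>}") (auto simp: abs_mult intro!: mult_left_mono)
      qed
    qed measurable
  qed
  have Ghi: "integrable lborel (\<lambda>x. G x * h x)" and Kfi: "integrable lborel (\<lambda>x. K x * f x)"
    by (intro bdd Gi Ki fc hc; simp add: G_def K_def)+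
  have split: "indicator {\<alpha>..\<beta>} x *\<^sub>R (g x * h x + f x * k x) = G x * h x + K x * f x" for x
    by (simp add: G_def K_def algebra_simps)
  show "set_integrable lborel {\<alpha>..\<beta>} (\<lambda>x. g x * h x + f x * k x)"
    unfolding set_integrable_def split using Ghi Kfi by simp
  have IG: "integral\<^sup>L lborel G = f \<beta> - f \<alpha>" and IK: "integral\<^sup>L lborel K = h \<beta> - h \<alpha>"
    using fg hk ab by (auto simp: primitive_def set_lebesgue_integral_def G_def[abs_def] K_def[abs_def])
  have rep: "q x = q \<alpha> + (LINT s|lborel. indicator {\<alpha>..\<beta>} s * r s * indicator {..x} s)"
    if "primitive q r" "x \<in> {\<alpha>..\<beta>}" for q r x
  proof -
    have "q x - q \<alpha> = (LINT s:{\<alpha>..x}|lborel. r s)"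
      using that by (auto simp: primitive_def)
    also have "\<dots> = (LINT s|lborel. indicator {\<alpha>..\<beta>} s * r s * indicator {..x} s)"
      unfolding set_lebesgue_integral_def using that(2)
      by (intro Bochner_Integration.integral_cong) (auto simp: indicator_def)
    finally show ?thesis by simp
  qed
  have Gh: "G x * h x = h \<alpha> * G x + (LINT y|lborel. G x * K y * indicator {..x} y)" for x
  proof (cases "x \<in> {\<alpha>..\<beta>}")
    case True
    have "(LINT y|lborel. G x * K y * indicator {..x} y) = G x * (LINT y|lborel. K y * indicator {..x} y)"
      by (simp only: mult.assoc integral_mult_right_zero)
    then show ?thesis
      using rep[OF hk True] by (simp add: K_def algebra_simps)
  qed (simp add: G_def)
  have Kf: "K y * f y = f \<alpha> * K y + (LINT x|lborel. G x * K y * indicator {..y} x)" for y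
  proof (cases "y \<in> {\<alpha>..\<beta>}")
    case True
    have "(LINT x|lborel. G x * K y * indicator {..y} x) = (LINT x|lborel. K y * (G x * indicator {..y} x))"
      by (simp add: mult_ac)
    also have "\<dots> = K y * (LINT x|lborel. G x * indicator {..y} x)"
      by (rule integral_mult_right_zero)
    finally show ?thesis
      using rep[OF fg True] by (simp add: G_def algebra_simps)
  qed (simp add: K_def)
  have prod: "integrable (lborel \<Otimes>\<^sub>M lborel) (\<lambda>(x, y). G x * K y)"
  proof (rule lborel_pair.Fubini_integrable)
    have "(LINT y|lborel. norm (case (x, y) of (x, y) \<Rightarrow> G x * K y)) = \<bar>G x\<bar> * (LINT y|lborel. \<bar>K y\<bar>)" for x
      by (simp add: abs_mult)
    then show "integrable lborel (\<lambda>x. LINT y|lborel. norm (case (x, y) of (x, y) \<Rightarrow> G x * K y))"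
      using Gi by simp
    show "AE x in lborel. integrable lborel (\<lambda>y. case (x, y) of (x, y) \<Rightarrow> G x * K y)"
      using Ki by simp
  qed measurable
  have tri: "integrable (lborel \<Otimes>\<^sub>M lborel) (\<lambda>(x, y). G x * K y * indicator {..y} x)"
    by (rule Bochner_Integration.integrable_bound[OF prod])
      (auto simp: indicator_def abs_mult)
  have tri': "integrable (lborel \<Otimes>\<^sub>M lborel) (\<lambda>(x, y). G x * K y * indicator {..x} y)"
    by (rule Bochner_Integration.integrable_bound[OF prod])
      (auto simp: indicator_def abs_mult)
  have swap: "(LINT y|lborel. LINT x|lborel. G x * K y * indicator {..y} x)
      = (LINT x|lborel. LINT y|lborel. G x * K y * indicator {..y} x)"
    by (rule lborel_pair.Fubini_integral[OF tri])
  have sum: "(LINT y|lborel. G x * K y * indicator {..x} y) + (LINT y|lborel. G x * K y * indicator {..y} x)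
      = G x * integral\<^sup>L lborel K" for x
  proof -
    have i: "integrable lborel (\<lambda>y. G x * K y * indicator {..x} y)"
        "integrable lborel (\<lambda>y. G x * K y * indicator {..y} x)"
      by (rule Bochner_Integration.integrable_bound[of _ "\<lambda>y. G x * K y"]; use Ki in \<open>auto simp: indicator_def abs_mult\<close>)+
    have "(LINT y|lborel. G x * K y * indicator {..x} y) + (LINT y|lborel. G x * K y * indicator {..y} x)
       = (LINT y|lborel. G x * K y * indicator {..x} y + G x * K y * indicator {..y} x)"
      using i by simp
    also have "\<dots> = (LINT y|lborel. G x * K y)"
    proof (rule integral_cong_AE)
      have "AE y in lborel. y \<noteq> x" by (rule AE_lborel_singleton)
      then show "AE y in lborel. G x * K y * indicator {..x} y + G x * K y * indicator {..y} x = G x * K y"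
        by eventually_elim (auto simp: indicator_def)
    qed (use borel_measurable_integrable[OF Bochner_Integration.integrable_add[OF i]] in auto)
    finally show ?thesis by simp
  qed
  have i1: "integrable lborel (\<lambda>x. LINT y|lborel. G x * K y * indicator {..x} y)"
    and i2: "integrable lborel (\<lambda>x. LINT y|lborel. G x * K y * indicator {..y} x)"
    and i3: "integrable lborel (\<lambda>y. LINT x|lborel. G x * K y * indicator {..y} x)"
    using lborel_pair.integrable_fst[OF tri'] lborel_pair.integrable_fst[OF tri]
      lborel_pair.integrable_snd[OF tri] by auto
  have "(LINT x:{\<alpha>..\<beta>}|lborel. g x * h x + f x * k x)
      = (LINT x|lborel. G x * h x) + (LINT x|lborel. K x * f x)"
    unfolding set_lebesgue_integral_def split using Ghi Kfi by simp
  also have "\<dots> = h \<alpha> * (f \<beta> - f \<alpha>) + f \<alpha> * (h \<beta> - h \<alpha>)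
      + ((LINT x|lborel. LINT y|lborel. G x * K y * indicator {..x} y)
       + (LINT x|lborel. LINT y|lborel. G x * K y * indicator {..y} x))"
    unfolding Gh Kf using i1 i3 Gi Ki by (simp add: IG IK swap)
  also have "(LINT x|lborel. LINT y|lborel. G x * K y * indicator {..x} y)
       + (LINT x|lborel. LINT y|lborel. G x * K y * indicator {..y} x)
     = (LINT x|lborel. G x * integral\<^sup>L lborel K)"
    using i1 i2 by (simp flip: sum)
  also have "\<dots> = (f \<beta> - f \<alpha>) * (h \<beta> - h \<alpha>)"
    by (simp add: IG IK)
  finally show "f \<beta> * h \<beta> - f \<alpha> * h \<alpha> = (LINT x:{\<alpha>..\<beta>}|lborel. g x * h x + f x * k x)"
    by (simp add: algebra_simps)
qed

text \<open>Integration by parts on an interval beyond the support of \<open>a\<close>.\<close>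

lemma integral_test_function_primitive:
  assumes a: "test_function a" and wg: "primitive w g"
  shows "integrable lborel (\<lambda>x. a x * g x)"
    and "(LINT x|lborel. a x * g x) = - (LINT x|lborel. dir_deriv 1 a x * w x)"
proof -
  obtain R where R: "R > 0" "\<And>x. R < \<bar>x\<bar> \<Longrightarrow> a x = 0"
    using test_function_support[OF a] by blast
  obtain B where B: "B > 0" "\<And>x. \<bar>a x\<bar> \<le> B"
    using test_function_bounded[OF a] by blast
  have gm [measurable]: "g \<in> borel_measurable borel" and wc: "continuous_on UNIV w"
    using wg by (auto simp: primitive_def)
  have am [measurable]: "a \<in> borel_measurable borel"
    by (intro borel_measurable_continuous_onI test_function_continuous a)
  define I where "I = {-(R+1)..R+1}"
  have gi: "integrable lborel (\<lambda>x. indicator I x *\<^sub>R g x)"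
    using wg R(1) by (auto simp: primitive_def set_integrable_def I_def)
  have aI: "a x \<noteq> 0 \<Longrightarrow> x \<in> I" for x
    using R(2)[of x] by (force simp: I_def not_less abs_le_iff)
  show i: "integrable lborel (\<lambda>x. a x * g x)"
  proof (rule Bochner_Integration.integrable_bound)
    show "integrable lborel (\<lambda>x. B * (indicator I x *\<^sub>R g x))" using gi by simp
    show "AE x in lborel. norm (a x * g x) \<le> norm (B * (indicator I x *\<^sub>R g x))"
    proof (rule AE_I2)
      fix x
      show "norm (a x * g x) \<le> norm (B * (indicator I x *\<^sub>R g x))"
        using B aI[of x] by (cases "a x = 0") (auto simp: abs_mult intro!: mult_right_mono)
    qed
  qed measurable
  have "primitive a (dir_deriv 1 a)"
    using a by (intro primitiveI_derivative test_function_has_derivative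
        test_function_continuous test_function_deriv)
  from primitive_mult[OF this wg]
  have e1: "a (R+1) * w (R+1) - a (-(R+1)) * w (-(R+1)) = (LINT x:I|lborel. dir_deriv 1 a x * w x + a x * g x)"
    using R(1) by (simp only: primitive_def I_def)
  have e2: "indicator I x *\<^sub>R (dir_deriv 1 a x * w x + a x * g x) = dir_deriv 1 a x * w x + a x * g x" for x
  proof (cases "x \<in> I")
    case False
    then have "R < \<bar>x\<bar>" using R(1) by (auto simp: I_def not_le)
    have "open {x::real. R < \<bar>x\<bar>}"
      by (intro open_Collect_less continuous_intros)
    then have "dir_deriv 1 a x = 0"
      by (rule dir_deriv_locally_constant) (use \<open>R < \<bar>x\<bar>\<close> R in auto)
    with aI False show ?thesis by auto
  qed simp
  have "(LINT x|lborel. dir_deriv 1 a x * w x + a x * g x) = 0"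
    using e1 R unfolding set_lebesgue_integral_def e2 by simp
  then show "(LINT x|lborel. a x * g x) = - (LINT x|lborel. dir_deriv 1 a x * w x)"
    using i integrable_mult_test_function[OF test_function_deriv[OF a] wc] by simp
qed

text \<open>The integral of \<open>(g - m)\<^sup>2\<close> is nonnegative, where \<open>m\<close> is the mean slope of \<open>w\<close> between \<open>x\<close>
  and \<open>y\<close>.\<close>

lemma primitive_Cauchy_Schwarz:
  assumes wg: "primitive w g" and sq: "integrable lborel (\<lambda>x. (g x)\<^sup>2)" and xy: "x \<le> y"
  shows "(w y - w x)\<^sup>2 \<le> (y - x) * (LINT s:{x..y}|lborel. (g s)\<^sup>2)"
proof (cases "x < y")
  case True
  have gm [measurable]: "g \<in> borel_measurable borel" and gi: "set_integrable lborel {x..y} g"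
    and inc: "w y - w x = (LINT s:{x..y}|lborel. g s)"
    using wg xy by (auto simp: primitive_def)
  have sqi: "set_integrable lborel {x..y} (\<lambda>s. (g s)\<^sup>2)"
    unfolding set_integrable_def using sq by (intro integrable_mult_indicator) auto
  define m where "m = (w y - w x) / (y - x)"
  have ci: "set_integrable lborel {x..y} (\<lambda>s. m\<^sup>2)"
    unfolding set_integrable_def by (intro borel_integrable_compact) auto
  have "0 \<le> (LINT s:{x..y}|lborel. (g s - m)\<^sup>2)"
    unfolding set_lebesgue_integral_def by (intro integral_nonneg_AE AE_I2) auto
  also have "\<dots> = (LINT s:{x..y}|lborel. (g s)\<^sup>2 - 2 * m * g s + m\<^sup>2)"
    by (simp add: power2_eq_square algebra_simps)
  also have "\<dots> = (LINT s:{x..y}|lborel. (g s)\<^sup>2) - 2 * m * (LINT s:{x..y}|lborel. g s)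
      + (LINT s:{x..y}|lborel. m\<^sup>2)"
    using sqi gi ci by (simp add: set_integral_add set_integral_diff)
  also have "(LINT s:{x..y}|lborel. m\<^sup>2) = m\<^sup>2 * (y - x)"
    using xy by (simp add: set_lebesgue_integral_def)
  also have "(LINT s:{x..y}|lborel. (g s)\<^sup>2) - 2 * m * (LINT s:{x..y}|lborel. g s) + m\<^sup>2 * (y - x)
      = (LINT s:{x..y}|lborel. (g s)\<^sup>2) - (w y - w x)\<^sup>2 / (y - x)"
  proof -
    have "m * (y - x) = w y - w x" "(w y - w x)\<^sup>2 / (y - x) = m * (w y - w x)"
      using True by (auto simp: m_def power2_eq_square)
    then have "m\<^sup>2 * (y - x) = m * (w y - w x)"
      by (simp add: power2_eq_square mult.assoc)
    with \<open>(w y - w x)\<^sup>2 / (y - x) = m * (w y - w x)\<close> show ?thesis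
      by (simp add: inc[symmetric])
  qed
  finally show ?thesis
    using True by (simp add: field_simps)
qed (use xy in simp)

text \<open>The open interval on the right will matter: end points carry no Lebesgue measure, but they may
  be atoms of \<open>\<mu>\<close>.\<close>

lemma sq_density_le:
  assumes ac: "is_ac_part \<mu> (sq_density g)" and fin: "finite_measure \<mu>"
    and g: "g \<in> borel_measurable borel" "integrable lborel (\<lambda>x. (g x)\<^sup>2)" and xy: "x \<le> y"
  shows "(LINT s:{x..y}|lborel. (g s)\<^sup>2) \<le> measure \<mu> {x<..<y}"
proof -
  note [measurable] = g(1)
  have "ennreal (LINT s|lborel. indicator {x..y} s *\<^sub>R (g s)\<^sup>2)
      = (\<integral>\<^sup>+s. ennreal (indicator {x..y} s *\<^sub>R (g s)\<^sup>2) \<partial>lborel)"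
    using g by (intro nn_integral_eq_integral[symmetric] integrable_mult_indicator) auto
  also have "\<dots> = (\<integral>\<^sup>+s. ennreal ((g s)\<^sup>2) * indicator {x<..<y} s \<partial>lborel)"
  proof (rule nn_integral_cong_AE)
    have "AE s in lborel. s \<noteq> x" "AE s in lborel. s \<noteq> y" by (rule AE_lborel_singleton)+
    then show "AE s in lborel. ennreal (indicator {x..y} s *\<^sub>R (g s)\<^sup>2) = ennreal ((g s)\<^sup>2) * indicator {x<..<y} s"
      by eventually_elim (auto simp: indicator_def)
  qed
  also have "\<dots> = emeasure (sq_density g) {x<..<y}"
    unfolding sq_density_def by (subst emeasure_density) auto
  also have "\<dots> \<le> emeasure \<mu> {x<..<y}"
  proof -
    obtain \<sigma> where "\<forall>A\<in>sets borel. emeasure \<mu> A = emeasure (sq_density g) A + emeasure \<sigma> A"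
      using ac by (auto simp: is_ac_part_def)
    then show ?thesis by simp
  qed
  also have "\<dots> = ennreal (measure \<mu> {x<..<y})"
    using fin by (simp add: finite_measure.emeasure_eq_measure)
  finally show ?thesis
    by (simp add: set_lebesgue_integral_def)
qed

section \<open>Balance laws in moving frames\<close>

lemma integrable_finite_measure_bounded:
  fixes f :: "real \<Rightarrow> real"
  assumes "\<nu> \<in> \<M>\<^sub>+" "continuous_on UNIV f" "\<And>x. \<bar>f x\<bar> \<le> B"
  shows "integrable \<nu> f"
proof -
  have "finite_measure \<nu>" and s [measurable_cong]: "sets \<nu> = sets borel"
    using assms(1) by (auto simp: finite_radon_measures_def)
  moreover have "f \<in> borel_measurable \<nu>"
    using borel_measurable_continuous_onI[OF assms(2)] by measurable
  ultimately show ?thesis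
    using assms(3) by (intro finite_measure.integrable_const_bound[of _ _ B]) auto
qed

text \<open>Weak continuity tests against a fixed function; here the function may move with time, uniformly
  in space. The error is controlled because the total mass stays locally bounded.\<close>

lemma weakly_continuous_pairing:
  fixes f :: "real \<Rightarrow> real \<Rightarrow> real"
  assumes \<mu>: "weakly_continuous \<mu>"
    and f: "\<And>t. continuous_on UNIV (f t)" "\<And>t. bounded (range (f t))"
    and lim: "uniform_limit UNIV f (f t0) (at t0)"
  shows "((\<lambda>t. LINT x|\<mu> t. f t x) \<longlongrightarrow> (LINT x|\<mu> t0. f t0 x)) (at t0)"
proof -
  have M: "\<mu> t \<in> \<M>\<^sub>+" for t
    using \<mu> by (simp add: weakly_continuous_def)
  have tendsto: "((\<lambda>t. LINT x|\<mu> t. p x) \<longlongrightarrow> (LINT x|\<mu> t0. p x)) (at t0)"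
    if p: "continuous_on UNIV p" "bounded (range p)" for p :: "real \<Rightarrow> real"
  proof -
    have "p \<in> bcontfun" using p by (simp add: bcontfun_def)
    then have "apply_bcontfun (Bcontfun p) = p" by (simp add: Bcontfun_inverse)
    moreover have "continuous_on UNIV (\<lambda>t. LINT x|\<mu> t. apply_bcontfun (Bcontfun p) x)"
      using \<mu> by (simp add: weakly_continuous_def)
    ultimately show ?thesis
      by (simp add: continuous_on_def)
  qed
  have int: "integrable (\<mu> t) (f s)" for s t
  proof -
    obtain B where "\<And>x. \<bar>f s x\<bar> \<le> B"
      using f(2)[of s] by (auto simp: bounded_iff)
    then show ?thesis
      by (intro integrable_finite_measure_bounded[OF M f(1)])
  qed
  have space: "space (\<mu> t) = UNIV" for t
    using M[of t] sets_eq_imp_space_eq[of "\<mu> t" borel] by (simp add: finite_radon_measures_def)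
  have one: "(LINT x|\<mu> t. (1::real)) = measure (\<mu> t) UNIV" for t
    by (simp add: space)
  have mass: "((\<lambda>t. measure (\<mu> t) UNIV) \<longlongrightarrow> measure (\<mu> t0) UNIV) (at t0)"
    using tendsto[of "\<lambda>_. 1"] unfolding one by simp
  have "((\<lambda>t. (LINT x|\<mu> t. f t x) - (LINT x|\<mu> t. f t0 x)) \<longlongrightarrow> 0) (at t0)"
  proof (rule tendstoI)
    fix e :: real assume e: "e > 0"
    define m where "m = measure (\<mu> t0) UNIV + 1"
    have m: "m > 0" by (simp add: m_def add_nonneg_pos)
    have "eventually (\<lambda>t. \<forall>x\<in>UNIV. dist (f t x) (f t0 x) < e / (2 * m)) (at t0)"
      using lim e m by (intro uniform_limitD) auto
    moreover have "eventually (\<lambda>t. measure (\<mu> t) UNIV < m) (at t0)"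
      using mass by (rule order_tendstoD) (simp add: m_def)
    ultimately show "eventually (\<lambda>t. dist ((LINT x|\<mu> t. f t x) - (LINT x|\<mu> t. f t0 x)) 0 < e) (at t0)"
    proof eventually_elim
      case (elim t)
      have "\<bar>LINT x|\<mu> t. f t x - f t0 x\<bar> \<le> (LINT x|\<mu> t. e / (2 * m))"
        using elim(1) int M[of t]
        by (intro integral_abs_bound_integral)
          (auto simp: dist_real_def finite_radon_measures_def finite_measure.integrable_const intro: less_imp_le)
      also have "\<dots> = e / (2 * m) * measure (\<mu> t) UNIV"
        by (simp add: space)
      also have "\<dots> \<le> e / (2 * m) * m"
        using elim(2) e m by (intro mult_left_mono) auto
      also have "\<dots> < e" using e m by simp
      finally show ?case using int by simp
    qed
  qed
  from tendsto_add[OF this tendsto[OF f, of t0]] show ?thesis by simp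
qed

lemma compact_support_pairing:
  fixes f :: "real \<Rightarrow> real \<Rightarrow> real"
  assumes f: "\<And>t. continuous_on UNIV (f t)"
    and supp: "\<And>t x. \<bar>t - t0\<bar> < 1 \<Longrightarrow> R < \<bar>x\<bar> \<Longrightarrow> f t x = 0"
    and lim: "uniform_limit UNIV f (f t0) (at t0)"
  shows "((\<lambda>t. LINT x|lborel. f t x) \<longlongrightarrow> (LINT x|lborel. f t0 x)) (at t0)"
proof -
  have int: "integrable lborel (f t)" if "\<bar>t - t0\<bar> < 1" for t
    by (rule integrable_compact_support[OF f supp[OF that]])
  have R: "R < \<bar>R\<bar> + 1" by simp
  show ?thesis
  proof (rule tendstoI)
    fix e :: real assume e: "e > 0"
    define m where "m = 2 * (\<bar>R\<bar> + 1)"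
    have m: "m > 0" by (simp add: m_def)
    have "eventually (\<lambda>t. \<forall>x\<in>UNIV. dist (f t x) (f t0 x) < e / (2 * m)) (at t0)"
      using lim e m by (intro uniform_limitD) auto
    moreover have "eventually (\<lambda>t. \<bar>t - t0\<bar> < 1) (at t0)"
      by (auto simp: eventually_at dist_real_def intro!: exI[of _ 1])
    ultimately show "eventually (\<lambda>t. dist (LINT x|lborel. f t x) (LINT x|lborel. f t0 x) < e) (at t0)"
    proof eventually_elim
      case (elim t)
      have "\<bar>LINT x|lborel. f t x - f t0 x\<bar> \<le> (LINT x|lborel. e / (2 * m) * indicator {-(\<bar>R\<bar>+1)..\<bar>R\<bar>+1} x)"
      proof (rule integral_abs_bound_integral)
        show "integrable lborel (\<lambda>x. f t x - f t0 x)"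
          using elim(2) by (intro Bochner_Integration.integrable_diff int) auto
        fix x
        show "\<bar>f t x - f t0 x\<bar> \<le> e / (2 * m) * indicator {-(\<bar>R\<bar>+1)..\<bar>R\<bar>+1} x"
        proof (cases "x \<in> {-(\<bar>R\<bar>+1)..\<bar>R\<bar>+1}")
          case True
          then show ?thesis using elim(1) by (simp add: dist_real_def less_imp_le)
        next
          case False
          then have "R < \<bar>x\<bar>" by auto
          then show ?thesis using supp[of t x] supp[of t0 x] elim(2) False by simp
        qed
      qed auto
      also have "\<dots> = e / (2 * m) * m" by (simp add: m_def)
      also have "\<dots> < e" using e m by simp
      finally show ?case
        using int[OF elim(2)] int[of t0] by (simp add: dist_real_def)
    qed
  qed
qed

lemma uniform_limit_shift:
  fixes p :: "real \<Rightarrow> real"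
  assumes "\<And>x y. \<bar>p x - p y\<bar> \<le> L * \<bar>x - y\<bar>"
  shows "uniform_limit UNIV (\<lambda>t x. p (x - c * t)) (\<lambda>x. p (x - c * t0)) (at t0)"
proof (rule uniform_limitI)
  fix e :: real assume e: "e > 0"
  define m where "m = \<bar>L\<bar> * \<bar>c\<bar> + 1"
  have m: "m > 0" by (simp add: m_def add_nonneg_pos)
  have "eventually (\<lambda>t. \<bar>t - t0\<bar> < e / m) (at t0)"
    using e m by (auto simp: eventually_at dist_real_def intro!: exI[of _ "e / m"])
  then show "eventually (\<lambda>t. \<forall>x\<in>UNIV. dist (p (x - c * t)) (p (x - c * t0)) < e) (at t0)"
  proof (eventually_elim, intro ballI)
    fix t x assume t: "\<bar>t - t0\<bar> < e / m"
    have "\<bar>p (x - c * t) - p (x - c * t0)\<bar> \<le> L * \<bar>c * (t0 - t)\<bar>"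
      using assms[of "x - c * t" "x - c * t0"] by (simp add: algebra_simps)
    also have "\<dots> \<le> \<bar>L\<bar> * \<bar>c * (t0 - t)\<bar>" by (intro mult_right_mono) auto
    also have "\<dots> = (\<bar>L\<bar> * \<bar>c\<bar>) * \<bar>t - t0\<bar>" by (simp add: abs_mult abs_minus_commute)
    also have "\<dots> \<le> m * \<bar>t - t0\<bar>" by (intro mult_right_mono) (auto simp: m_def)
    also have "\<dots> < e" using t m by (simp add: field_simps)
    finally show "dist (p (x - c * t)) (p (x - c * t0)) < e" by (simp add: dist_real_def)
  qed
qed

lemma test_function_Lipschitz:
  fixes a :: "real \<Rightarrow> real"
  assumes "test_function a"
  obtains L where "\<And>x y. \<bar>a x - a y\<bar> \<le> L * \<bar>x - y\<bar>"
proof -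
  obtain B where B: "\<And>x. \<bar>dir_deriv 1 a x\<bar> \<le> B"
    using test_function_bounded[OF test_function_deriv[OF assms]] by blast
  have "norm (a x - a y) \<le> B * norm (x - y)" for x y
    by (rule field_differentiable_bound[of UNIV])
      (use B test_function_has_derivative[OF assms] in auto)
  then show ?thesis by (intro that[of B]) auto
qed

lemma test_function_shift: "test_function a \<Longrightarrow> test_function (\<lambda>x::real. a (x - d))"
  using test_function_affine[of a 1 "- d"] by simp

lemma deriv_shift: "test_function a \<Longrightarrow> dir_deriv 1 (\<lambda>x::real. a (x - d)) x = dir_deriv 1 a (x - d)"
  by (subst dir_deriv_real_eqI[OF DERIV_chain2[OF test_function_has_derivative, of a "\<lambda>x. x - d" 1]])
    (auto intro!: derivative_eq_intros)

lemma bounded_range_test_function: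
  "test_function a \<Longrightarrow> bounded (range (\<lambda>x::real. a (x - d) :: real))"
  by (metis (no_types, lifting) test_function_bounded boundedI imageE real_norm_def)

text \<open>Integrating the distribution function of \<open>\<nu>\<close> against \<open>a\<close> amounts to integrating \<open>tail a\<close> with
  respect to \<open>\<nu>\<close>. The second form is visibly continuous for the weak topology.\<close>

definition tail :: "(real \<Rightarrow> real) \<Rightarrow> real \<Rightarrow> real"
  where "tail a y = (LINT s|lborel. a s * indicator {y..} s)"

lemma tail_bounds:
  assumes a: "test_function a"
  shows "\<exists>L. \<forall>x y. \<bar>tail a x - tail a y\<bar> \<le> L * \<bar>x - y\<bar>" "\<exists>B. \<forall>x. \<bar>tail a x\<bar> \<le> B"
proof -
  obtain L where L: "\<And>x. \<bar>a x\<bar> \<le> L"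
    using test_function_bounded[OF a] by blast
  have ai: "integrable lborel a"
    using integrable_mult_test_function[OF a, of "\<lambda>_. 1"] by simp
  have int: "integrable lborel (\<lambda>s. a s * indicator A s)" if "A \<in> sets borel" for A
    using integrable_mult_indicator[of A lborel a] ai that by (simp add: mult.commute)
  have le: "\<bar>tail a x - tail a y\<bar> \<le> L * (y - x)" if "x \<le> y" for x y
  proof -
    have "tail a x - tail a y = (LINT s|lborel. a s * indicator {x..} s - a s * indicator {y..} s)"
      unfolding tail_def using int by simp
    also have "\<bar>\<dots>\<bar> \<le> (LINT s|lborel. L * indicator {x..y} s)"
    proof (rule integral_abs_bound_integral)
      fix s show "\<bar>a s * indicator {x..} s - a s * indicator {y..} s\<bar> \<le> L * indicator {x..y} s"
        using L[of s] that by (auto simp: indicator_def)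
    qed (use int in \<open>auto simp: emeasure_lborel_Icc_eq intro!: integrable_real_indicator\<close>)
    also have "\<dots> = L * (y - x)" using that by simp
    finally show ?thesis .
  qed
  have "\<bar>tail a x - tail a y\<bar> \<le> L * \<bar>x - y\<bar>" for x y
    using le[of x y] le[of y x] by (cases "x \<le> y") (auto simp: abs_minus_commute)
  then show "\<exists>L. \<forall>x y. \<bar>tail a x - tail a y\<bar> \<le> L * \<bar>x - y\<bar>" by blast
  have "\<bar>tail a x\<bar> \<le> (LINT s|lborel. \<bar>a s\<bar>)" for x
    unfolding tail_def
  proof (rule integral_abs_bound_integral)
    show "integrable lborel (\<lambda>s. a s * indicator {x..} s)" by (rule int) simp
    show "integrable lborel (\<lambda>s. \<bar>a s\<bar>)" using ai by simp
  qed (auto simp: indicator_def)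
  then show "\<exists>B. \<forall>x. \<bar>tail a x\<bar> \<le> B" by blast
qed

lemma tail_continuous: "test_function a \<Longrightarrow> continuous_on UNIV (tail a)"
proof -
  assume "test_function a"
  then obtain L where L: "\<And>x y. \<bar>tail a x - tail a y\<bar> \<le> L * \<bar>x - y\<bar>"
    using tail_bounds(1) by blast
  have "\<bar>L\<bar>-lipschitz_on UNIV (tail a)"
  proof (rule lipschitz_onI)
    show "dist (tail a x) (tail a y) \<le> \<bar>L\<bar> * dist x y" for x y
      unfolding dist_real_def by (rule order_trans[OF L mult_right_mono]) auto
  qed simp
  then show ?thesis by (rule lipschitz_on_continuous_on)
qed

lemma measure_atMost_borel [measurable]:
  assumes "\<nu> \<in> \<M>\<^sub>+"
  shows "(\<lambda>x. measure \<nu> {..x}) \<in> borel_measurable borel"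
  using assms
  by (intro borel_measurable_mono monoI finite_measure.finite_measure_mono)
    (auto simp: finite_radon_measures_def)

lemma integral_distribution_function:
  assumes \<nu>: "\<nu> \<in> \<M>\<^sub>+" and a: "test_function a"
  shows "integrable lborel (\<lambda>x. a (x - d) * measure \<nu> {..x})"
    and "(LINT x|lborel. a (x - d) * measure \<nu> {..x}) = (LINT y|\<nu>. tail a (y - d))"
proof -
  have fin: "finite_measure \<nu>" and s [measurable_cong]: "sets \<nu> = sets borel"
    using \<nu> by (auto simp: finite_radon_measures_def)
  interpret finite_measure \<nu> by fact
  interpret pair_sigma_finite lborel \<nu> ..
  define b where "b x = a (x - d)" for x
  have b: "test_function b" unfolding b_def[abs_def] using a by (rule test_function_shift)
  have [measurable]: "b \<in> borel_measurable borel"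
    by (intro borel_measurable_continuous_onI test_function_continuous b)
  have bi: "integrable lborel b"
    using integrable_mult_test_function[OF b, of "\<lambda>_. 1"] by simp
  have F: "measure \<nu> {..x} = (LINT y|\<nu>. indicator {..x} y)" for x
    by simp
  have int: "integrable (lborel \<Otimes>\<^sub>M \<nu>) (\<lambda>(x, y). b x * indicator {..x} y)"
  proof (rule Bochner_Integration.integrable_bound)
    show "integrable (lborel \<Otimes>\<^sub>M \<nu>) (\<lambda>(x, y). b x)"
    proof (rule Fubini_integrable)
      show "integrable lborel (\<lambda>x. LINT y|\<nu>. norm (case (x, y) of (x, y) \<Rightarrow> b x))"
        using bi by simp
    qed auto
  qed (auto simp: indicator_def)
  have in_eq: "(LINT y|\<nu>. b x * indicator {..x} y) = a (x - d) * measure \<nu> {..x}" for x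
    by (simp add: b_def)
  show "integrable lborel (\<lambda>x. a (x - d) * measure \<nu> {..x})"
    using integrable_fst[OF int] unfolding in_eq .
  have "(LINT x|lborel. a (x - d) * measure \<nu> {..x}) = (LINT x|lborel. LINT y|\<nu>. b x * indicator {..x} y)"
    by (simp only: in_eq)
  also have "\<dots> = (LINT y|\<nu>. LINT x|lborel. b x * indicator {..x} y)"
    by (rule Fubini_integral[OF int, symmetric])
  also have "(\<lambda>y. LINT x|lborel. b x * indicator {..x} y) = (\<lambda>y. tail a (y - d))"
  proof
    fix y
    show "(LINT x|lborel. b x * indicator {..x} y) = tail a (y - d)"
      unfolding tail_def
      by (subst lborel_integral_real_affine[where c = 1 and t = d])
        (auto simp: b_def indicator_def intro!: Bochner_Integration.integral_cong)
  qed
  finally show "(LINT x|lborel. a (x - d) * measure \<nu> {..x}) = (LINT y|\<nu>. tail a (y - d))" .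
qed

lemma uniform_limit_of_continuous:
  fixes u :: "real \<Rightarrow> (real \<Rightarrow>\<^sub>C real)"
  assumes "continuous_on UNIV u"
  shows "uniform_limit UNIV (\<lambda>t. apply_bcontfun (u t)) (apply_bcontfun (u t0)) (at t0)"
  using assms
  by (intro tendsto_bcontfun_uniform_limit) (auto simp: continuous_on_def)

lemma bounded_range_apply_bcontfun: "bounded (range (apply_bcontfun f))"
  using apply_bcontfun[of f] by (auto simp: bcontfun_def)

lemma bounded_range_mult:
  fixes f g :: "real \<Rightarrow> real"
  assumes "bounded (range f)" "bounded (range g)"
  shows "bounded (range (\<lambda>x. f x * g x))"
proof -
  obtain B C where "\<And>x. \<bar>f x\<bar> \<le> B" "\<And>x. \<bar>g x\<bar> \<le> C"
    using assms by (auto simp: bounded_iff)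
  then have "\<bar>f x * g x\<bar> \<le> B * C" for x
    unfolding abs_mult by (meson abs_ge_zero mult_mono order_trans)
  then show ?thesis by (auto simp: bounded_iff)
qed

text \<open>Testing with \<open>a (x - c t) b t\<close> says that the two time functions below are derivative and
  primitive in the sense of distributions. Both are continuous, so the identity holds classically and
  at every time, also when \<open>\<mu> t\<close> has a singular part.\<close>

lemma transport_law:
  fixes u :: "real \<Rightarrow> (real \<Rightarrow>\<^sub>C real)" and \<mu> :: "real \<Rightarrow> real measure" and c t :: real
  assumes u: "continuous_on UNIV u" and \<mu>: "weakly_continuous \<mu>"
    and weak: "\<And>\<phi>. test_function \<phi> \<Longrightarrow>
        (LINT t|lborel. LINT x|\<mu> t. deriv_t \<phi> (x, t) + u t x * deriv_x \<phi> (x, t)) = 0"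
    and a: "test_function a"
  shows "((\<lambda>t. LINT x|\<mu> t. a (x - c * t)) has_real_derivative
      (LINT x|\<mu> t. (apply_bcontfun (u t) x - c) * dir_deriv 1 a (x - c * t))) (at t)"
proof -
  let ?a' = "dir_deriv 1 a"
  define g where "g t = (LINT x|\<mu> t. a (x - c * t))" for t
  define n where "n t = (LINT x|\<mu> t. (u t x - c) * ?a' (x - c * t))" for t
  have M: "\<mu> t \<in> \<M>\<^sub>+" for t
    using \<mu> by (simp add: weakly_continuous_def)
  have a': "test_function ?a'" by (rule test_function_deriv[OF a])
  have c1: "continuous_on UNIV (\<lambda>x. a (x - d))" and c2: "continuous_on UNIV (\<lambda>x. ?a' (x - d))" for d
    by (intro test_function_continuous test_function_shift a a')+
  have c3: "continuous_on UNIV (\<lambda>x. (u t x - c) * ?a' (x - d))" for t d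
    by (intro continuous_on_mult continuous_on_diff continuous_on_apply_bcontfun continuous_on_const c2)
  have bd_u: "bounded (range (\<lambda>x. u t x - c))" for t
    using bounded_minus_comp[OF bounded_range_apply_bcontfun[of "u t"], of "\<lambda>_. c"] by auto
  have b3: "bounded (range (\<lambda>x. (u t x - c) * ?a' (x - d)))" for t d
    by (intro bounded_range_mult bd_u bounded_range_test_function a')
  have ul: "uniform_limit UNIV (\<lambda>t x. q (x - c * t)) (\<lambda>x. q (x - c * t0)) (at t0)"
    if "test_function q" for q t0
    using test_function_Lipschitz[OF that] uniform_limit_shift by metis
  have "((\<lambda>t. LINT x|\<mu> t. a (x - c * t)) \<longlongrightarrow> (LINT x|\<mu> t0. a (x - c * t0))) (at t0)" for t0
    by (intro weakly_continuous_pairing \<mu> c1 bounded_range_test_function a ul)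
  then have gc: "continuous_on UNIV g"
    by (simp add: g_def[abs_def] continuous_on_def)
  have "((\<lambda>t. LINT x|\<mu> t. (u t x - c) * ?a' (x - c * t)) \<longlongrightarrow> (LINT x|\<mu> t0. (u t0 x - c) * ?a' (x - c * t0))) (at t0)" for t0
    by (intro weakly_continuous_pairing \<mu> c3 b3 uniform_lim_mult uniform_limit_minus
        uniform_limit_of_continuous[OF u] uniform_limit_const ul a' bd_u bounded_range_test_function)
  then have nc: "continuous_on UNIV n"
    by (simp add: n_def[abs_def] continuous_on_def)
  have "has_weak_deriv 1 g n"
  proof (rule has_weak_derivI_continuous[OF gc nc])
    fix b :: "real \<Rightarrow> real" assume b: "test_function b"
    have "(LINT x|\<mu> t. deriv_t (\<lambda>(x, t). a (x - c * t) * b t) (x, t)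
          + u t x * deriv_x (\<lambda>(x, t). a (x - c * t) * b t) (x, t))
        = dir_deriv 1 b t * g t + b t * n t" for t
    proof -
      have i: "integrable (\<mu> t) (\<lambda>x. a (x - c * t))"
          "integrable (\<mu> t) (\<lambda>x. (u t x - c) * ?a' (x - c * t))"
      proof -
        show "integrable (\<mu> t) (\<lambda>x. a (x - c * t))"
          using bounded_range_test_function[OF a, of "c * t"] integrable_finite_measure_bounded[OF M c1]
          by (fastforce simp: bounded_iff)
        obtain B where "\<And>x. \<bar>(u t x - c) * ?a' (x - c * t)\<bar> \<le> B"
          using b3[of t "c * t"] unfolding bounded_iff by auto
        then show "integrable (\<mu> t) (\<lambda>x. (u t x - c) * ?a' (x - c * t))"
          by (rule integrable_finite_measure_bounded[OF M c3])
      qed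
      have "deriv_t (\<lambda>(x, t). a (x - c * t) * b t) (x, t)
          + u t x * deriv_x (\<lambda>(x, t). a (x - c * t) * b t) (x, t)
          = dir_deriv 1 b t * a (x - c * t) + b t * ((u t x - c) * ?a' (x - c * t))" for x
        by (simp only: moving_frame_product[OF a b] prod.case) (simp add: algebra_simps)
      then show ?thesis using i by (simp add: g_def n_def)
    qed
    then have "(LINT t|lborel. dir_deriv 1 b t * g t + b t * n t) = 0"
      using weak[OF moving_frame_product(1)[OF a b, of c]] by simp
    moreover have "integrable lborel (\<lambda>t. dir_deriv 1 b t * g t)" "integrable lborel (\<lambda>t. b t * n t)"
      by (intro integrable_mult_test_function test_function_deriv b gc nc)+
    ultimately show "(LINT t|lborel. g t * dir_deriv 1 b t) = - (LINT t|lborel. n t * b t)"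
      by (simp add: mult.commute)
  qed
  from primitive_has_derivative[OF weak_deriv_primitive[OF this gc] nc]
  show ?thesis by (simp add: g_def[abs_def] n_def)
qed

text \<open>The same argument for the equation of \<open>u\<close>. The product rule turns \<open>u u\<^sub>x\<close> into the derivative of
  \<open>u\<^sup>2 / 2\<close> at each fixed time; only after this step is the right-hand side seen to be continuous in
  time.\<close>

lemma momentum_law:
  fixes u :: "real \<Rightarrow> (real \<Rightarrow>\<^sub>C real)" and \<mu> :: "real \<Rightarrow> real measure" and c t :: real
  assumes u: "continuous_on UNIV u" and \<mu>: "weakly_continuous \<mu>"
    and ux: "\<And>t. has_weak_deriv 1 (apply_bcontfun (u t)) (ux t)"
    and weak: "\<And>\<phi>. test_function \<phi> \<Longrightarrow>
        (LINT t|lborel. LINT x|lborel. u t x * deriv_t \<phi> (x, t)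
          - \<phi> (x, t) * (u t x * ux t x - 1/2 * measure (\<mu> t) {..x})) = 0"
    and a: "test_function a"
  shows "((\<lambda>t. LINT x|lborel. a (x - c * t) * apply_bcontfun (u t) x) has_real_derivative
      (LINT x|lborel. dir_deriv 1 a (x - c * t) * ((apply_bcontfun (u t) x)\<^sup>2 / 2 - c * apply_bcontfun (u t) x))
       + 1/2 * (LINT x|lborel. a (x - c * t) * measure (\<mu> t) {..x})) (at t)"
proof -
  let ?a' = "dir_deriv 1 a"
  define g where "g t = (LINT x|lborel. a (x - c * t) * u t x)" for t
  define n where "n t = (LINT x|lborel. ?a' (x - c * t) * ((u t x)\<^sup>2 / 2 - c * u t x))
      + 1/2 * (LINT x|lborel. a (x - c * t) * measure (\<mu> t) {..x})" for t
  have M: "\<mu> t \<in> \<M>\<^sub>+" for t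
    using \<mu> by (simp add: weakly_continuous_def)
  have a': "test_function ?a'" by (rule test_function_deriv[OF a])
  have ul: "uniform_limit UNIV (\<lambda>t x. q (x - c * t)) (\<lambda>x. q (x - c * t0)) (at t0)"
    if "test_function q" for q t0
    using test_function_Lipschitz[OF that] uniform_limit_shift by metis
  have bu: "bounded (range (apply_bcontfun (u t)))" for t
    by (rule bounded_range_apply_bcontfun)
  have ulu: "uniform_limit UNIV (\<lambda>t. apply_bcontfun (u t)) (apply_bcontfun (u t0)) (at t0)" for t0
    by (rule uniform_limit_of_continuous[OF u])
  have pair: "continuous_on UNIV (\<lambda>t. LINT x|lborel. q (x - c * t) * w t x)"
    if q: "test_function q" and w: "\<And>t. continuous_on UNIV (w t)" "\<And>t. bounded (range (w t))"
      "\<And>t0. uniform_limit UNIV w (w t0) (at t0)" for q w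
  proof -
    obtain R where R: "R > 0" "\<And>x. R < \<bar>x\<bar> \<Longrightarrow> q x = 0"
      using test_function_support[OF q] by blast
    have "((\<lambda>t. LINT x|lborel. q (x - c * t) * w t x) \<longlongrightarrow> (LINT x|lborel. q (x - c * t0) * w t0 x)) (at t0)" for t0
    proof (rule compact_support_pairing[where R = "R + \<bar>c\<bar> * (\<bar>t0\<bar> + 1)"])
      show "continuous_on UNIV (\<lambda>x. q (x - c * t) * w t x)" for t
        by (intro continuous_on_mult w test_function_continuous test_function_shift q)
      show "uniform_limit UNIV (\<lambda>t x. q (x - c * t) * w t x) (\<lambda>x. q (x - c * t0) * w t0 x) (at t0)"
        by (intro uniform_lim_mult ul w q bounded_range_test_function)
      fix t x assume t: "\<bar>t - t0\<bar> < 1" and x: "R + \<bar>c\<bar> * (\<bar>t0\<bar> + 1) < \<bar>x\<bar>"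
      have "\<bar>c * t\<bar> \<le> \<bar>c\<bar> * (\<bar>t0\<bar> + 1)"
        unfolding abs_mult using t by (intro mult_left_mono) auto
      then have "R < \<bar>x - c * t\<bar>" using x by linarith
      then show "q (x - c * t) * w t x = 0" by (simp add: R)
    qed
    then show ?thesis by (simp add: continuous_on_def)
  qed
  have gc: "continuous_on UNIV g"
    unfolding g_def[abs_def] by (intro pair a bu ulu continuous_on_apply_bcontfun)
  have n1: "continuous_on UNIV (\<lambda>t. LINT x|lborel. ?a' (x - c * t) * (u t x * (u t x / 2 - c)))"
  proof -
    have b2: "bounded (range (\<lambda>x. u t x * (1/2) - c))" for t
      using bounded_range_mult[OF bu[of t], of "\<lambda>_. 1/2"]
        bounded_minus_comp[of "\<lambda>x. u t x * (1/2)" UNIV "\<lambda>_. c"] by auto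
    have u2: "uniform_limit UNIV (\<lambda>t x. u t x * (1/2) - c) (\<lambda>x. u t0 x * (1/2) - c) (at t0)" for t0
      by (rule uniform_limit_minus[OF uniform_lim_mult[OF ulu uniform_limit_const bu] uniform_limit_const]) auto
    have "continuous_on UNIV (\<lambda>t. LINT x|lborel. ?a' (x - c * t) * (u t x * (u t x * (1/2) - c)))"
    proof (rule pair[OF a'])
      show "continuous_on UNIV (\<lambda>x. u t x * (u t x * (1/2) - c))" for t
        by (intro continuous_intros continuous_on_apply_bcontfun)
      show "bounded (range (\<lambda>x. u t x * (u t x * (1/2) - c)))" for t
        by (rule bounded_range_mult[OF bu b2])
      show "uniform_limit UNIV (\<lambda>t x. u t x * (u t x * (1/2) - c)) (\<lambda>x. u t0 x * (u t0 x * (1/2) - c)) (at t0)" for t0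
        by (rule uniform_lim_mult[OF ulu u2 bu b2])
    qed
    then show ?thesis by simp
  qed
  obtain L B where LB: "\<And>x y. \<bar>tail a x - tail a y\<bar> \<le> L * \<bar>x - y\<bar>" "\<And>x. \<bar>tail a x\<bar> \<le> B"
    using tail_bounds[OF a] by auto
  have "((\<lambda>t. LINT x|\<mu> t. tail a (x - c * t)) \<longlongrightarrow> (LINT x|\<mu> t0. tail a (x - c * t0))) (at t0)" for t0
  proof (intro weakly_continuous_pairing \<mu> uniform_limit_shift[OF LB(1)])
    show "continuous_on UNIV (\<lambda>x. tail a (x - c * t))" for t
      by (rule continuous_on_compose2[OF tail_continuous[OF a]]) (auto intro!: continuous_intros)
    show "bounded (range (\<lambda>x. tail a (x - c * t)))" for t
      using LB(2) by (auto simp: bounded_iff)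
  qed
  then have n2: "continuous_on UNIV (\<lambda>t. LINT x|\<mu> t. tail a (x - c * t))"
    by (simp add: continuous_on_def)
  have nc: "continuous_on UNIV n"
    using continuous_on_add[OF n1 continuous_on_mult[OF continuous_on_const[of _ "1/2"] n2]]
    unfolding n_def[abs_def] integral_distribution_function(2)[OF M a]
    by (simp add: algebra_simps power2_eq_square)
  have "has_weak_deriv 1 g n"
  proof (rule has_weak_derivI_continuous[OF gc nc])
    fix b :: "real \<Rightarrow> real" assume b: "test_function b"
    let ?\<phi> = "\<lambda>(x, t). a (x - c * t) * b t"
    have "(LINT x|lborel. u t x * deriv_t ?\<phi> (x, t)
        - ?\<phi> (x, t) * (u t x * ux t x - 1/2 * measure (\<mu> t) {..x}))
        = dir_deriv 1 b t * g t + b t * n t" for t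
    proof -
      have p: "primitive (apply_bcontfun (u t)) (ux t)"
        by (rule weak_deriv_primitive[OF ux]) simp
      have sh: "test_function (\<lambda>x. a (x - c * t))" and sh': "test_function (\<lambda>x. ?a' (x - c * t))"
        by (intro test_function_shift a a')+
      note q = integral_test_function_primitive[OF sh primitive_mult[OF p p]]
      have i1: "integrable lborel (\<lambda>x. a (x - c * t) * u t x)"
        and i2: "integrable lborel (\<lambda>x. ?a' (x - c * t) * u t x)"
        and i4: "integrable lborel (\<lambda>x. ?a' (x - c * t) * (u t x)\<^sup>2)"
        by (intro integrable_mult_test_function sh sh' continuous_intros continuous_on_apply_bcontfun)+
      have q1: "a (x - c * t) * (ux t x * u t x + u t x * ux t x) = 2 * (a (x - c * t) * (u t x * ux t x))" for x
        by simp
      have i3: "integrable lborel (\<lambda>x. a (x - c * t) * (u t x * ux t x))"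
        using q(1) unfolding q1 by simp
      have q3: "(LINT x|lborel. a (x - c * t) * (u t x * ux t x)) = - (LINT x|lborel. ?a' (x - c * t) * (u t x)\<^sup>2) / 2"
        using q(2) unfolding q1 by (simp add: deriv_shift[OF a] power2_eq_square)
      have i5: "integrable lborel (\<lambda>x. a (x - c * t) * measure (\<mu> t) {..x})"
        by (rule integral_distribution_function(1)[OF M a])
      have "u t x * deriv_t ?\<phi> (x, t) - ?\<phi> (x, t) * (u t x * ux t x - 1/2 * measure (\<mu> t) {..x})
        = dir_deriv 1 b t * (a (x - c * t) * u t x)
         + b t * (1/2 * (a (x - c * t) * measure (\<mu> t) {..x}) - c * (?a' (x - c * t) * u t x)
             - a (x - c * t) * (u t x * ux t x))" for x
        by (simp only: moving_frame_product[OF a b] prod.case) (simp add: algebra_simps)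
      then have "(LINT x|lborel. u t x * deriv_t ?\<phi> (x, t)
          - ?\<phi> (x, t) * (u t x * ux t x - 1/2 * measure (\<mu> t) {..x}))
        = dir_deriv 1 b t * g t + b t * (1/2 * (LINT x|lborel. a (x - c * t) * measure (\<mu> t) {..x})
          - c * (LINT x|lborel. ?a' (x - c * t) * u t x) - (LINT x|lborel. a (x - c * t) * (u t x * ux t x)))"
        using i1 i2 i3 i5 by (simp add: g_def)
      also have "1/2 * (LINT x|lborel. a (x - c * t) * measure (\<mu> t) {..x})
          - c * (LINT x|lborel. ?a' (x - c * t) * u t x) - (LINT x|lborel. a (x - c * t) * (u t x * ux t x))
          = n t"
      proof -
        have "(LINT x|lborel. ?a' (x - c * t) * ((u t x)\<^sup>2 / 2 - c * u t x))
          = (LINT x|lborel. (?a' (x - c * t) * (u t x)\<^sup>2) / 2 - c * (?a' (x - c * t) * u t x))"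
          by (simp add: algebra_simps)
        also have "\<dots> = (LINT x|lborel. ?a' (x - c * t) * (u t x)\<^sup>2) / 2 - c * (LINT x|lborel. ?a' (x - c * t) * u t x)"
          using i2 i4 by simp
        finally show ?thesis unfolding n_def q3 by simp
      qed
      finally show ?thesis .
    qed
    then have "(LINT t|lborel. dir_deriv 1 b t * g t + b t * n t) = 0"
      using weak[OF moving_frame_product(1)[OF a b, of c]] by (simp only:)
    moreover have "integrable lborel (\<lambda>t. dir_deriv 1 b t * g t)" "integrable lborel (\<lambda>t. b t * n t)"
      by (intro integrable_mult_test_function test_function_deriv b gc nc)+
    ultimately show "(LINT t|lborel. g t * dir_deriv 1 b t) = - (LINT t|lborel. n t * b t)"
      by (simp add: mult.commute)
  qed
  from primitive_has_derivative[OF weak_deriv_primitive[OF this gc] nc]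
  show ?thesis by (simp add: g_def[abs_def] n_def)
qed

section \<open>Conservation laws of the flow\<close>

text \<open>The consequences of the weak formulation on which the Lagrangian picture rests: both balance laws
  in moving frames, control of the oscillation of \<open>u t\<close> by the mass in between, and the absence of
  atoms at almost every time.\<close>

locale hs_flow =
  fixes u :: "real \<Rightarrow> (real \<Rightarrow>\<^sub>C real)" and \<mu> :: "real \<Rightarrow> real measure"
  assumes u_continuous: "continuous_on UNIV u"
    and \<mu>_continuous: "weakly_continuous \<mu>"
    and transport: "test_function a \<Longrightarrow>
      ((\<lambda>t. LINT x|\<mu> t. a (x - c * t)) has_real_derivative
        (LINT x|\<mu> t. (u t x - c) * dir_deriv 1 a (x - c * t))) (at t)"
    and momentum: "test_function a \<Longrightarrow>
      ((\<lambda>t. LINT x|lborel. a (x - c * t) * u t x) has_real_derivative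
        (LINT x|lborel. dir_deriv 1 a (x - c * t) * ((u t x)\<^sup>2 / 2 - c * u t x))
         + 1/2 * (LINT x|lborel. a (x - c * t) * measure (\<mu> t) {..x})) (at t)"
    and energy: "x \<le> y \<Longrightarrow> (u t y - u t x)\<^sup>2 \<le> (y - x) * measure (\<mu> t) {x<..<y}"
    and no_atoms: "AE t in lborel. \<forall>x. measure (\<mu> t) {x} = 0"

lemma sq_density_singleton:
  assumes "g \<in> borel_measurable borel"
  shows "measure (sq_density g) {x} = 0"
proof -
  note [measurable] = assms
  have "emeasure (sq_density g) {x} = (\<integral>\<^sup>+s. ennreal ((g s)\<^sup>2) * indicator {x} s \<partial>lborel)"
    unfolding sq_density_def by (subst emeasure_density) auto
  also have "\<dots> = (\<integral>\<^sup>+s. 0 \<partial>(lborel :: real measure))"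
  proof (rule nn_integral_cong_AE)
    have "AE s in lborel. s \<noteq> x" by (rule AE_lborel_singleton)
    then show "AE s in lborel. ennreal ((g s)\<^sup>2) * indicator {x} s = 0"
      by eventually_elim auto
  qed
  finally show ?thesis by (simp add: measure_def)
qed

lemma conservative_solution_hs_flow:
  assumes "conservative_solution ubar \<mu>bar u \<mu>"
  shows "hs_flow u \<mu>"
proof -
  have u: "continuous_on UNIV u" and \<mu>: "weakly_continuous \<mu>"
    using assms by (auto simp: conservative_solution_def)
  have M: "finite_measure (\<mu> t)" for t
    using \<mu> by (simp add: weakly_continuous_def finite_radon_measures_def)
  obtain ux where ux: "\<And>t. has_weak_deriv 1 (apply_bcontfun (u t)) (ux t)" "\<And>t. square_integrable (ux t)"
    and ae: "AE t in lborel. \<mu> t = sq_density (ux t)"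
    and mom: "\<And>\<phi>. test_function \<phi> \<Longrightarrow>
        (LINT t|lborel. LINT x|lborel.
          u t x * deriv_t \<phi> (x, t)
          - \<phi> (x, t) * (u t x * ux t x - 1/2 * measure (\<mu> t) {..x})) = 0"
    and tra: "\<And>\<phi>. test_function \<phi> \<Longrightarrow>
        (LINT t|lborel. LINT x|\<mu> t. deriv_t \<phi> (x, t) + u t x * deriv_x \<phi> (x, t)) = 0"
    and ac: "\<And>t. is_ac_part (\<mu> t) (sq_density (ux t))"
    using assms unfolding conservative_solution_def by blast
  have uxm: "ux t \<in> borel_measurable borel" "integrable lborel (\<lambda>x. (ux t x)\<^sup>2)" for t
    using ux(2) by (auto simp: square_integrable_def)
  show ?thesis
  proof
    show "continuous_on UNIV u" "weakly_continuous \<mu>" by fact+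
    show "((\<lambda>t. LINT x|\<mu> t. a (x - c * t)) has_real_derivative
        (LINT x|\<mu> t. (u t x - c) * dir_deriv 1 a (x - c * t))) (at t)" if "test_function a" for a c t
      by (rule transport_law[OF u \<mu> tra that])
    show "((\<lambda>t. LINT x|lborel. a (x - c * t) * u t x) has_real_derivative
        (LINT x|lborel. dir_deriv 1 a (x - c * t) * ((u t x)\<^sup>2 / 2 - c * u t x))
         + 1/2 * (LINT x|lborel. a (x - c * t) * measure (\<mu> t) {..x})) (at t)"
      if "test_function a" for a c t
      by (rule momentum_law[OF u \<mu> ux(1) mom that])
    show "(u t y - u t x)\<^sup>2 \<le> (y - x) * measure (\<mu> t) {x<..<y}" if xy: "x \<le> y" for x y t
    proof -
      have "(u t y - u t x)\<^sup>2 \<le> (y - x) * (LINT s:{x..y}|lborel. (ux t s)\<^sup>2)"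
        by (rule primitive_Cauchy_Schwarz[OF weak_deriv_primitive[OF ux(1)] uxm(2) xy]) simp
      also have "\<dots> \<le> (y - x) * measure (\<mu> t) {x<..<y}"
        using xy sq_density_le[OF ac M uxm xy] by (intro mult_left_mono) auto
      finally show ?thesis .
    qed
    show "AE t in lborel. \<forall>x. measure (\<mu> t) {x} = 0"
      using ae by eventually_elim (simp add: sq_density_singleton uxm)
  qed
qed

lemma le_of_small_add:
  fixes A B \<rho> :: real
  assumes \<rho>: "\<rho> > 0" and le: "\<And>r. 0 < r \<Longrightarrow> r < \<rho> \<Longrightarrow> A \<le> B + 2 * r"
  shows "A \<le> B"
proof (rule field_le_epsilon)
  fix e :: real assume "e > 0"
  define r where "r = min (\<rho> / 2) (e / 2)"
  have "0 < r" "r < \<rho>" "2 * r \<le> e"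
    using \<rho> \<open>e > 0\<close> by (auto simp: r_def min_def)
  then show "A \<le> B + e"
    using le[of r] by simp
qed

context hs_flow
begin

lemma isCont_u: "isCont (apply_bcontfun (u t)) x"
  by (metis UNIV_I continuous_on_apply_bcontfun continuous_on_eq_continuous_at open_UNIV)

definition F :: "real \<Rightarrow> real \<Rightarrow> real" where "F t y = measure (\<mu> t) {..y}"

definition mass :: "real \<Rightarrow> real" where "mass t = measure (\<mu> t) UNIV"

lemma \<mu>_radon: "\<mu> t \<in> \<M>\<^sub>+"
  using \<mu>_continuous by (simp add: weakly_continuous_def)

lemma \<mu>_borel: "finite_borel_measure (\<mu> t)"
  using \<mu>_radon[of t]
  by (simp add: finite_borel_measure_def finite_borel_measure_axioms_def finite_radon_measures_def)

lemma sets_\<mu> [simp, measurable_cong]: "sets (\<mu> t) = sets borel"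
  using \<mu>_radon[of t] by (simp add: finite_radon_measures_def)

lemma finite_\<mu>: "finite_measure (\<mu> t)"
  using \<mu>_radon[of t] by (simp add: finite_radon_measures_def)

lemma space_\<mu> [simp]: "space (\<mu> t) = UNIV"
  using sets_eq_imp_space_eq[OF sets_\<mu>] by simp

lemma F_cdf: "F t = cdf (\<mu> t)"
  by (auto simp: F_def cdf_def)

lemma F_mono: "x \<le> y \<Longrightarrow> F t x \<le> F t y"
  unfolding F_cdf by (rule finite_borel_measure.cdf_nondecreasing[OF \<mu>_borel])

lemma F_nonneg: "0 \<le> F t x"
  by (simp add: F_def)

lemma F_le_mass: "F t x \<le> mass t"
  unfolding F_def mass_def by (rule finite_measure.finite_measure_mono[OF finite_\<mu>]) auto

lemma F_at_bot: "(F t \<longlongrightarrow> 0) at_bot"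
  unfolding F_cdf by (rule finite_borel_measure.cdf_lim_at_bot[OF \<mu>_borel])

lemma F_at_top: "(F t \<longlongrightarrow> mass t) at_top"
  using finite_borel_measure.cdf_lim_at_top[OF \<mu>_borel[of t]] unfolding F_cdf mass_def by simp

lemma F_right: "(F t \<longlongrightarrow> F t y) (at_right y)"
  using finite_borel_measure.cdf_is_right_cont[OF \<mu>_borel[of t], of y]
  unfolding F_cdf by (simp add: continuous_within)

lemma continuous_mass: "continuous_on UNIV mass"
proof -
  have "continuous_on UNIV (\<lambda>t. LINT x|\<mu> t. apply_bcontfun f x)" for f :: "real \<Rightarrow>\<^sub>C real"
    using \<mu>_continuous by (auto simp: weakly_continuous_def)
  from this[of "const_bcontfun 1"] show ?thesis by (simp add: const_bcontfun.rep_eq mass_def[abs_def])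
qed

text \<open>A smoothed indicator of the half-line to the left of a front that moves with speed \<open>c\<close>. Mass
  crosses the front only where the indicator decreases, that is in a window of width \<open>r\<close>; if \<open>u\<close>
  does not exceed \<open>c\<close> there (\<open>\<sigma> = 1\<close>), the mass behind the front cannot decrease, and for \<open>u\<close> not
  below \<open>c\<close> (\<open>\<sigma> = - 1\<close>) it cannot increase. The cutoff \<open>q n\<close> makes the indicator compactly
  supported; its slope is of order \<open>1 / n\<close>, so its flux disappears in the limit.\<close>

lemma front_monotone:
  assumes st: "s \<le> t" and r: "r > 0" and sg: "\<sigma> = 1 \<or> \<sigma> = -1"
    and sign: "\<And>\<tau> x. s \<le> \<tau> \<Longrightarrow> \<tau> \<le> t \<Longrightarrow> z \<le> x - c * \<tau> \<Longrightarrow> x - c * \<tau> \<le> z + r \<Longrightarrow>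
      \<sigma> * (u \<tau> x - c) \<le> 0"
  defines "g \<equiv> \<lambda>\<tau>. LINT x|\<mu> \<tau>. 1 - smooth_step ((x - c * \<tau> - z) / r)"
  shows "\<sigma> * g s \<le> \<sigma> * g t"
proof -
  define a where "a x = 1 - smooth_step ((x - z) / r)" for x
  define q where "q n x = smooth_step (x / real (Suc n) + 2)" for n x
  have a01: "0 \<le> a x" "a x \<le> 1" for x
    using smooth_step_range[of "(x - z) / r"] by (auto simp: a_def)
  have q01: "0 \<le> q n x" "q n x \<le> 1" for n x
    using smooth_step_range[of "x / real (Suc n) + 2"] by (auto simp: q_def)
  have da: "(a has_real_derivative - (bump ((x - z) / r) / r)) (at x)" for x
    unfolding a_def[abs_def]
    by (rule DERIV_cong[OF DERIV_diff[OF DERIV_const DERIV_chain2[OF smooth_step_has_derivative]]])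
      (use r in \<open>auto intro!: derivative_eq_intros\<close>)
  have dq: "(q n has_real_derivative bump (x / real (Suc n) + 2) / real (Suc n)) (at x)" for n x
    unfolding q_def[abs_def]
    by (rule DERIV_cong[OF DERIV_chain2[OF smooth_step_has_derivative]])
      (auto intro!: derivative_eq_intros simp del: of_nat_Suc)
  define d where "d n x = bump (x / real (Suc n) + 2) / real (Suc n) * a x + - (bump ((x - z) / r) / r) * q n x" for n x
  have dA: "((\<lambda>x. q n x * a x) has_real_derivative d n x) (at x)" for n x
    unfolding d_def by (rule DERIV_mult[OF dq da])
  have test: "test_function (\<lambda>x. q n x * a x)" for n
  proof (rule test_functionI[where R = "2 * real (Suc n) + \<bar>z\<bar> + r"])
    show "Ck k (\<lambda>x. q n x * a x)" for k
    proof (rule Ck_mult)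
      have "Ck k (\<lambda>x. smooth_step ((1 / real (Suc n)) * x + 2))"
        by (rule Ck_compose[OF Ck_smooth_step Ck_affine])
      then show "Ck k (q n)" by (simp add: q_def[abs_def] del: of_nat_Suc)
      have "Ck k (\<lambda>x. 1 + (-1) * smooth_step ((1 / r) * x + - (z / r)))"
        by (rule Ck_add[OF Ck_const Ck_mult[OF Ck_const Ck_compose[OF Ck_smooth_step Ck_affine]]])
      then show "Ck k a" by (simp add: a_def[abs_def] diff_divide_distrib)
    qed
    fix x :: real assume x: "2 * real (Suc n) + \<bar>z\<bar> + r < \<bar>x\<bar>"
    show "q n x * a x = 0"
    proof (cases "x \<ge> 0")
      case True
      then have "r \<le> x - z" using x by linarith
      then have "1 \<le> (x - z) / r" using r by simp
      then show ?thesis by (simp add: a_def smooth_step_1)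
    next
      case False
      then have "x \<le> - 2 * real (Suc n)" using x r by linarith
      then have "x / real (Suc n) \<le> - 2"
        by (subst pos_divide_le_eq) auto
      then show ?thesis by (simp add: q_def smooth_step_0 del: of_nat_Suc)
    qed
  qed
  obtain B where B: "B > 0" "\<And>x. \<bar>bump x\<bar> \<le> B"
    using test_function_bounded[OF test_function_bump] by blast
  have "compact (u ` {s..t})"
    by (intro compact_continuous_image continuous_on_subset[OF u_continuous]) auto
  from compact_imp_bounded[OF this]
  obtain K0 where K0: "\<And>\<tau>. \<tau> \<in> {s..t} \<Longrightarrow> norm (u \<tau>) \<le> K0"
    unfolding bounded_iff by blast
  define K where "K = \<bar>K0\<bar> + \<bar>c\<bar>"
  have K: "\<bar>u \<tau> x - c\<bar> \<le> K" if "\<tau> \<in> {s..t}" for \<tau> x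
    using K0[OF that] norm_bounded[of "u \<tau>" x] by (simp add: K_def)
  have "compact (mass ` {s..t})"
    by (intro compact_continuous_image continuous_on_subset[OF continuous_mass]) auto
  from compact_imp_bounded[OF this]
  obtain m0 where m0: "\<And>\<tau>. \<tau> \<in> {s..t} \<Longrightarrow> norm (mass \<tau>) \<le> m0"
    unfolding bounded_iff by blast
  define \<kappa> where "\<kappa> n = K * B / real (Suc n) * \<bar>m0\<bar>" for n
  define gn where "gn n \<tau> = (LINT x|\<mu> \<tau>. q n (x - c * \<tau>) * a (x - c * \<tau>))" for n \<tau>
  have K_nonneg: "K \<ge> 0" by (simp add: K_def)
  have mono: "\<sigma> * gn n s + \<kappa> n * s \<le> \<sigma> * gn n t + \<kappa> n * t" for n
  proof (rule DERIV_nonneg_imp_nondecreasing[OF st])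
    fix \<tau> assume \<tau>: "s \<le> \<tau>" "\<tau> \<le> t"
    let ?D = "LINT x|\<mu> \<tau>. (u \<tau> x - c) * d n (x - c * \<tau>)"
    have "dir_deriv 1 (\<lambda>x. q n x * a x) y = d n y" for y
      using dir_deriv_real_eqI[OF dA, of 1] by simp
    with transport[OF test[of n], of c \<tau>] have D: "(gn n has_real_derivative ?D) (at \<tau>)"
      by (simp add: gn_def[abs_def])
    have "(LINT x|\<mu> \<tau>. - (K * B / real (Suc n))) \<le> (LINT x|\<mu> \<tau>. \<sigma> * ((u \<tau> x - c) * d n (x - c * \<tau>)))"
    proof (rule integral_mono)
      show "integrable (\<mu> \<tau>) (\<lambda>x. - (K * B / real (Suc n)))"
        using finite_\<mu> by (simp add: finite_measure.integrable_const)
      have tf: "test_function (dir_deriv 1 (\<lambda>x. q n x * a x))"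
        by (rule test_function_deriv[OF test])
      moreover have "dir_deriv 1 (\<lambda>x. q n x * a x) = d n"
        using \<open>\<And>y. dir_deriv 1 (\<lambda>x. q n x * a x) y = d n y\<close> by auto
      ultimately have td: "test_function (d n)" by simp
      obtain C where C: "\<And>x. \<bar>d n x\<bar> \<le> C"
        using test_function_bounded[OF td] by blast
      show "integrable (\<mu> \<tau>) (\<lambda>x. \<sigma> * ((u \<tau> x - c) * d n (x - c * \<tau>)))"
      proof (rule integrable_finite_measure_bounded[OF \<mu>_radon])
        show "continuous_on UNIV (\<lambda>x. \<sigma> * ((u \<tau> x - c) * d n (x - c * \<tau>)))"
          by (intro continuous_intros continuous_on_apply_bcontfun test_function_continuous
              test_function_shift td)
        show "\<bar>\<sigma> * ((u \<tau> x - c) * d n (x - c * \<tau>))\<bar> \<le> K * C" for x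
        proof -
          have "\<bar>u \<tau> x - c\<bar> * \<bar>d n (x - c * \<tau>)\<bar> \<le> K * C"
            using K[of \<tau> x] C[of "x - c * \<tau>"] \<tau> K_nonneg by (intro mult_mono) auto
          then show ?thesis using sg by (auto simp: abs_mult)
        qed
      qed
      fix x
      let ?y = "x - c * \<tau>"
      have e: "\<sigma> * ((u \<tau> x - c) * d n ?y) =
        \<sigma> * (u \<tau> x - c) * (bump (?y / real (Suc n) + 2) * a ?y) / real (Suc n)
        + (- (\<sigma> * (u \<tau> x - c)) * bump ((?y - z) / r)) * (q n ?y / r)"
        by (simp add: d_def algebra_simps add_divide_distrib diff_divide_distrib)
      have "\<bar>\<sigma> * (u \<tau> x - c) * (bump (?y / real (Suc n) + 2) * a ?y)\<bar> \<le> K * (B * 1)"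
        unfolding abs_mult using K[of \<tau> x] \<tau> B(2) a01[of ?y] sg K_nonneg B(1)
        by (intro mult_mono) auto
      then have "- (K * B) \<le> \<sigma> * (u \<tau> x - c) * (bump (?y / real (Suc n) + 2) * a ?y)"
        by linarith
      then have "- (K * B) / real (Suc n) \<le> \<sigma> * (u \<tau> x - c) * (bump (?y / real (Suc n) + 2) * a ?y) / real (Suc n)"
        by (intro divide_right_mono) auto
      moreover have "0 \<le> - (\<sigma> * (u \<tau> x - c)) * bump ((?y - z) / r)"
      proof (cases "(?y - z) / r \<in> {0..1}")
        case True
        then have "z \<le> ?y" "?y \<le> z + r" using r by (auto simp: field_simps)
        then have "\<sigma> * (u \<tau> x - c) \<le> 0" using sign[OF \<tau>] by blast
        then show ?thesis using bump_nonneg by (intro mult_nonneg_nonneg) auto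
      qed (simp add: bump_0)
      then have "0 \<le> (- (\<sigma> * (u \<tau> x - c)) * bump ((?y - z) / r)) * (q n ?y / r)"
        by (rule mult_nonneg_nonneg) (use q01[of n ?y] r in auto)
      ultimately show "- (K * B / real (Suc n)) \<le> \<sigma> * ((u \<tau> x - c) * d n ?y)"
        unfolding e by simp
    qed
    moreover have "(LINT x|\<mu> \<tau>. k) = k * mass \<tau>" for k :: real
      by (simp add: mass_def)
    ultimately have "- (K * B / real (Suc n)) * mass \<tau> \<le> \<sigma> * ?D"
      by (simp only: integral_mult_right_zero)
    moreover have "K * B / real (Suc n) * mass \<tau> \<le> \<kappa> n"
      unfolding \<kappa>_def using m0[of \<tau>] \<tau> K_nonneg B(1) by (intro mult_left_mono) auto
    ultimately have "0 \<le> \<sigma> * ?D + \<kappa> n" by simp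
    moreover have "((\<lambda>\<tau>. \<sigma> * gn n \<tau> + \<kappa> n * \<tau>) has_real_derivative \<sigma> * ?D + \<kappa> n) (at \<tau>)"
      by (rule DERIV_cong[OF DERIV_add[OF DERIV_cmult[OF D] DERIV_cmult[OF DERIV_ident]]]) simp
    ultimately show "\<exists>y. ((\<lambda>\<tau>. \<sigma> * gn n \<tau> + \<kappa> n * \<tau>) has_real_derivative y) (at \<tau>) \<and> 0 \<le> y"
      by blast
  qed
  have ac: "continuous_on UNIV a" and qc: "continuous_on UNIV (q n)" for n
    using da dq by (auto intro!: continuous_at_imp_continuous_on dest: DERIV_isCont)
  have [measurable]: "a \<in> borel_measurable borel" "q n \<in> borel_measurable borel" for n
    using ac qc by (auto intro: borel_measurable_continuous_onI)
  have lim_g: "(\<lambda>n. gn n \<tau>) \<longlonglongrightarrow> g \<tau>" for \<tau>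
    unfolding gn_def g_def
  proof (rule integral_dominated_convergence[where w = "\<lambda>_. 1"])
    show "integrable (\<mu> \<tau>) (\<lambda>_. 1 :: real)"
      using finite_\<mu> by (simp add: finite_measure.integrable_const)
    show "AE x in \<mu> \<tau>. norm (q n (x - c * \<tau>) * a (x - c * \<tau>)) \<le> 1" for n
      using q01 a01 by (intro AE_I2) (auto simp: abs_mult intro!: mult_le_one)
    show "(\<lambda>x. 1 - smooth_step ((x - c * \<tau> - z) / r)) \<in> borel_measurable (\<mu> \<tau>)"
      unfolding a_def[symmetric] by measurable
    show "AE x in \<mu> \<tau>. (\<lambda>n. q n (x - c * \<tau>) * a (x - c * \<tau>)) \<longlonglongrightarrow> 1 - smooth_step ((x - c * \<tau> - z) / r)"
    proof (rule AE_I2)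
      fix x
      obtain N where N: "\<bar>x - c * \<tau>\<bar> < real N" using reals_Archimedean2 by blast
      have "q n (x - c * \<tau>) = 1" if "n \<ge> N" for n
      proof -
        have "- real (Suc n) \<le> x - c * \<tau>" using N that by simp
        then have "- 1 \<le> (x - c * \<tau>) / real (Suc n)"
          by (subst pos_le_divide_eq) auto
        then show ?thesis by (simp add: q_def smooth_step_1 del: of_nat_Suc)
      qed
      then have "eventually (\<lambda>n. q n (x - c * \<tau>) * a (x - c * \<tau>) = 1 - smooth_step ((x - c * \<tau> - z) / r)) sequentially"
        unfolding eventually_sequentially by (auto simp: a_def)
      then show "(\<lambda>n. q n (x - c * \<tau>) * a (x - c * \<tau>)) \<longlonglongrightarrow> 1 - smooth_step ((x - c * \<tau> - z) / r)"
        by (rule tendsto_eventually)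
    qed
  qed measurable
  have lim_\<kappa>: "\<kappa> \<longlonglongrightarrow> 0"
  proof -
    have "(\<lambda>n. (K * B) / real (Suc n) * \<bar>m0\<bar>) \<longlonglongrightarrow> 0 * \<bar>m0\<bar>"
      by (intro tendsto_mult tendsto_const LIMSEQ_Suc[OF lim_const_over_n])
    then show ?thesis by (simp add: \<kappa>_def[abs_def] del: of_nat_Suc)
  qed
  have "(\<lambda>n. \<sigma> * gn n \<tau> + \<kappa> n * \<tau>) \<longlonglongrightarrow> \<sigma> * g \<tau> + 0 * \<tau>" for \<tau>
    by (rule tendsto_add[OF tendsto_mult[OF tendsto_const lim_g] tendsto_mult[OF lim_\<kappa> tendsto_const]])
  from LIMSEQ_le[OF this this] mono
  have "\<sigma> * g s + 0 * s \<le> \<sigma> * g t + 0 * t"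
    by blast
  then show ?thesis by simp
qed

lemma front_sandwich:
  assumes "r > 0"
  shows "F t (z + d) \<le> (LINT x|\<mu> t. 1 - smooth_step ((x - d - z) / r))"
    and "(LINT x|\<mu> t. 1 - smooth_step ((x - d - z) / r)) \<le> F t (z + d + r)"
proof -
  interpret finite_measure "\<mu> t" by (rule finite_\<mu>)
  let ?a = "\<lambda>x. 1 - smooth_step ((x - d - z) / r)"
  have F: "F t y = (LINT x|\<mu> t. indicator {..y} x)" for y
    by (simp add: F_def)
  have ii: "integrable (\<mu> t) (indicator {..y} :: real \<Rightarrow> real)" for y
    by (auto intro!: integrable_real_indicator simp: emeasure_eq_measure)
  have ia: "integrable (\<mu> t) ?a"
  proof (rule integrable_finite_measure_bounded[OF \<mu>_radon])
    have "continuous_on UNIV smooth_step"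
      using smooth_step_has_derivative by (auto intro!: continuous_at_imp_continuous_on dest: DERIV_isCont)
    then have "continuous_on UNIV (\<lambda>x. smooth_step ((x - d - z) / r))"
      by (rule continuous_on_compose2) (use assms in \<open>auto intro!: continuous_intros\<close>)
    then show "continuous_on UNIV ?a" by (intro continuous_intros)
    show "\<bar>?a x\<bar> \<le> 1" for x
      using smooth_step_range[of "(x - d - z) / r"] by auto
  qed
  show "F t (z + d) \<le> (LINT x|\<mu> t. ?a x)"
    unfolding F
  proof (rule integral_mono[OF ii ia])
    fix x
    have "x \<le> z + d \<Longrightarrow> (x - d - z) / r \<le> 0" using assms by (simp add: divide_le_0_iff)
    then show "indicator {..z + d} x \<le> ?a x"
      using smooth_step_range[of "(x - d - z) / r"] by (auto simp: indicator_def smooth_step_0)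
  qed
  show "(LINT x|\<mu> t. ?a x) \<le> F t (z + d + r)"
    unfolding F
  proof (rule integral_mono[OF ia ii])
    fix x
    have "\<not> x \<le> z + d + r \<Longrightarrow> 1 \<le> (x - d - z) / r" using assms by (simp add: field_simps)
    then show "?a x \<le> indicator {..z + d + r} x"
      using smooth_step_range[of "(x - d - z) / r"] by (auto simp: indicator_def smooth_step_1)
  qed
qed

lemma F_le_ahead:
  assumes "s \<le> t" "r > 0"
    and "\<And>\<tau> x. s \<le> \<tau> \<Longrightarrow> \<tau> \<le> t \<Longrightarrow> z + c * (\<tau> - s) \<le> x \<Longrightarrow> x \<le> z + c * (\<tau> - s) + r \<Longrightarrow> u \<tau> x \<le> c"
  shows "F s z \<le> F t (z + c * (t - s) + r)"
proof -
  have "1 * (LINT x|\<mu> s. 1 - smooth_step ((x - c * s - (z - c * s)) / r))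
      \<le> 1 * (LINT x|\<mu> t. 1 - smooth_step ((x - c * t - (z - c * s)) / r))"
  proof (rule front_monotone[OF assms(1,2)])
    fix \<tau> x assume "s \<le> \<tau>" "\<tau> \<le> t" "z - c * s \<le> x - c * \<tau>" "x - c * \<tau> \<le> z - c * s + r"
    then have "u \<tau> x \<le> c"
      by (intro assms(3)) (simp_all add: right_diff_distrib)
    then show "1 * (u \<tau> x - c) \<le> 0" by simp
  qed simp
  then show ?thesis
    using front_sandwich(1)[OF assms(2), of s "z - c * s" "c * s"]
      front_sandwich(2)[OF assms(2), of t "c * t" "z - c * s"]
    by (simp add: algebra_simps)
qed

lemma F_le_behind:
  assumes "s \<le> t" "r > 0"
    and "\<And>\<tau> x. s \<le> \<tau> \<Longrightarrow> \<tau> \<le> t \<Longrightarrow> z + c * (\<tau> - s) \<le> x \<Longrightarrow> x \<le> z + c * (\<tau> - s) + r \<Longrightarrow> c \<le> u \<tau> x"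
  shows "F t (z + c * (t - s)) \<le> F s (z + r)"
proof -
  have "-1 * (LINT x|\<mu> s. 1 - smooth_step ((x - c * s - (z - c * s)) / r))
      \<le> -1 * (LINT x|\<mu> t. 1 - smooth_step ((x - c * t - (z - c * s)) / r))"
  proof (rule front_monotone[OF assms(1,2)])
    fix \<tau> x assume "s \<le> \<tau>" "\<tau> \<le> t" "z - c * s \<le> x - c * \<tau>" "x - c * \<tau> \<le> z - c * s + r"
    then have "c \<le> u \<tau> x"
      by (intro assms(3)) (simp_all add: right_diff_distrib)
    then show "-1 * (u \<tau> x - c) \<le> 0" by simp
  qed simp
  then show ?thesis
    using front_sandwich(2)[OF assms(2), of s "c * s" "z - c * s"]
      front_sandwich(1)[OF assms(2), of t "z - c * s" "c * t"]
    by (simp add: algebra_simps)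
qed

text \<open>Fronts that move with the maximal speed of \<open>u\<close>, to the right or to the left, are never
  overtaken.\<close>

lemma mass_constant: "mass s = mass t"
proof -
  have le: "mass s = mass t" if st: "s \<le> t" for s t
  proof (rule antisym)
    have "compact (u ` {s..t})"
      by (intro compact_continuous_image continuous_on_subset[OF u_continuous]) auto
    from compact_imp_bounded[OF this]
    obtain K where K0: "\<And>\<tau>. \<tau> \<in> {s..t} \<Longrightarrow> norm (u \<tau>) \<le> K"
      unfolding bounded_iff by blast
    have K: "\<bar>u \<tau> x\<bar> \<le> K" if "\<tau> \<in> {s..t}" for \<tau> x
      using order_trans[OF norm_bounded K0[OF that]] by simp
    have K': "u \<tau> x \<le> K" "- K \<le> u \<tau> x" if "s \<le> \<tau>" "\<tau> \<le> t" for \<tau> x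
      using K[of \<tau> x] that by auto
    have "F s z \<le> mass t" for z
    proof -
      have "F s z \<le> F t (z + K * (t - s) + 1)"
        by (rule F_le_ahead[OF st zero_less_one]) (rule K')
      also have "\<dots> \<le> mass t" by (rule F_le_mass)
      finally show ?thesis .
    qed
    then show "mass s \<le> mass t"
      by (intro tendsto_upperbound[OF F_at_top always_eventually]) auto
    have "F t y \<le> mass s" for y
    proof -
      have "F t ((y + K * (t - s)) + - K * (t - s)) \<le> F s ((y + K * (t - s)) + 1)"
        by (rule F_le_behind[OF st zero_less_one]) (rule K')
      then show ?thesis using F_le_mass[of s "(y + K * (t - s)) + 1"] by simp
    qed
    then show "mass t \<le> mass s"
      by (intro tendsto_upperbound[OF F_at_top always_eventually]) auto
  qed
  show ?thesis
  proof (cases "s \<le> t")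
    case False
    then show ?thesis by (intro le[symmetric]) simp
  qed (rule le)
qed

section \<open>Quantile curves are characteristics\<close>

text \<open>The position at time \<open>t\<close> of the particle that has mass \<open>\<eta>\<close> to its left. Mass serves as the
  Lagrangian label: the velocity field is not Lipschitz, so trajectories are not determined by their
  starting point alone.\<close>

definition quantile :: "real \<Rightarrow> real \<Rightarrow> real"
  where "quantile \<eta> t = Inf {y. \<eta> \<le> F t y}"

lemma quantile_le_iff:
  assumes "0 < \<eta>" "\<eta> < mass 0"
  shows "quantile \<eta> t \<le> y \<longleftrightarrow> \<eta> \<le> F t y"
proof -
  let ?S = "{y. \<eta> \<le> F t y}"
  have "\<eta> < mass t" using assms mass_constant[of t 0] by simp
  then have "eventually (\<lambda>y. \<eta> < F t y) at_top"
    by (rule order_tendstoD(1)[OF F_at_top])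
  then obtain y0 where "\<eta> < F t y0"
    by (auto simp: eventually_at_top_linorder)
  then have ne: "?S \<noteq> {}" by (auto intro: less_imp_le)
  have "eventually (\<lambda>y. F t y < \<eta>) at_bot"
    by (rule order_tendstoD(2)[OF F_at_bot assms(1)])
  then obtain b where b: "F t b < \<eta>"
    by (auto simp: eventually_at_bot_linorder)
  have bd: "bdd_below ?S"
  proof (rule bdd_belowI)
    fix y assume "y \<in> ?S"
    then have "F t b < F t y" using b by simp
    then show "b \<le> y" using F_mono[of y b t] by linarith
  qed
  have inS: "\<eta> \<le> F t y" if less: "Inf ?S < y" for y
  proof -
    obtain y' where "y' \<in> ?S" "y' < y"
      using cInf_lessD[OF ne less] by blast
    then show ?thesis using F_mono[of y' y t] by auto
  qed
  have "\<eta> \<le> F t (Inf ?S)"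
  proof (rule tendsto_lowerbound[OF F_right])
    show "eventually (\<lambda>y. \<eta> \<le> F t y) (at_right (Inf ?S))"
      using eventually_at_right_less by (rule eventually_mono) (rule inS)
  qed simp
  then have "\<eta> \<le> F t y" if "Inf ?S \<le> y"
    using F_mono[OF that] by (rule order_trans)
  moreover have "Inf ?S \<le> y" if "\<eta> \<le> F t y"
    using that by (intro cInf_lower bd) simp
  ultimately show ?thesis
    unfolding quantile_def by blast
qed

lemma u_jointly_continuous:
  assumes "e > 0"
  obtains \<rho> where "\<rho> > 0"
    "\<And>\<tau> x. \<bar>\<tau> - s\<bar> < \<rho> \<Longrightarrow> \<bar>x - y\<bar> < \<rho> \<Longrightarrow> \<bar>u \<tau> x - u s y\<bar> \<le> e"
proof -
  have "isCont u s"
    using u_continuous by (simp add: continuous_on_eq_continuous_at)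
  then obtain d1 where d1: "d1 > 0" "\<And>\<tau>. dist \<tau> s < d1 \<Longrightarrow> dist (u \<tau>) (u s) < e / 2"
    using assms unfolding continuous_at_eps_delta by (meson half_gt_zero)
  from isCont_u[where t = s and x = y] obtain d2 where d2: "d2 > 0" "\<And>x. dist x y < d2 \<Longrightarrow> dist (u s x) (u s y) < e / 2"
    using assms unfolding continuous_at_eps_delta by (meson half_gt_zero)
  show ?thesis
  proof (rule that[of "min d1 d2"])
    fix \<tau> x assume "\<bar>\<tau> - s\<bar> < min d1 d2" "\<bar>x - y\<bar> < min d1 d2"
    then have "dist (u \<tau>) (u s) < e / 2" "dist (u s x) (u s y) < e / 2"
      using d1 d2 by (auto simp: dist_real_def)
    moreover have "dist (u \<tau> x) (u s x) \<le> dist (u \<tau>) (u s)"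
      by (rule dist_bounded)
    moreover have "\<bar>u \<tau> x - u s y\<bar> \<le> dist (u \<tau> x) (u s x) + dist (u s x) (u s y)"
      unfolding dist_real_def by linarith
    ultimately show "\<bar>u \<tau> x - u s y\<bar> \<le> e"
      by linarith
  qed (use d1 d2 in auto)
qed

text \<open>Near the point \<open>(quantile \<eta> s, s)\<close> the velocity lies within \<open>e\<close> of its value there. Comparison
  with fronts of speeds \<open>v + e\<close> and \<open>v - e\<close>, forwards and backwards in time, traps the quantile curve
  in a narrow cone. The auxiliary width \<open>r\<close> of the fronts can be taken arbitrarily small.\<close>

lemma quantile_has_derivative:
  assumes \<eta>: "0 < \<eta>" "\<eta> < mass 0"
  shows "(quantile \<eta> has_real_derivative u s (quantile \<eta> s)) (at s)"
proof -
  define Y where "Y = quantile \<eta> s"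
  define v where "v = u s Y"
  note le_iff = quantile_le_iff[OF \<eta>]
  have FY: "\<eta> \<le> F s Y" using le_iff[of s Y] by (simp add: Y_def)
  have FY': "F s y < \<eta>" if "y < Y" for y using le_iff[of s y] that by (simp add: Y_def)
  have "\<exists>d>0. \<forall>t. norm (t - s) < d \<longrightarrow> norm (quantile \<eta> t - quantile \<eta> s - v * (t - s)) \<le> e * norm (t - s)"
    if e: "e > 0" for e
  proof -
    obtain \<rho> where \<rho>: "\<rho> > 0"
      "\<And>\<tau> x. \<bar>\<tau> - s\<bar> < \<rho> \<Longrightarrow> \<bar>x - Y\<bar> < \<rho> \<Longrightarrow> \<bar>u \<tau> x - v\<bar> \<le> e"
      using u_jointly_continuous[OF e, of s Y] unfolding v_def by metis
    \<comment> \<open>Within time \<open>d\<close> fronts of speed \<open>v + e\<close> or \<open>v - e\<close> that start near \<open>Y\<close> stay in the box where \<open>u\<close>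
      is close to \<open>v\<close>.\<close>
    define C where "C = \<bar>v\<bar> + e + 1"
    have C: "C \<ge> 1" "\<bar>v + e\<bar> \<le> C" "\<bar>v - e\<bar> \<le> C" using e by (auto simp: C_def)
    define d where "d = \<rho> / (2 * C)"
    have d: "d > 0" "d \<le> \<rho>" using \<rho>(1) C(1) by (auto simp: d_def field_simps)
    have small: "\<bar>c * h\<bar> < \<rho> / 2" if "\<bar>c\<bar> \<le> C" "\<bar>h\<bar> < d" for c h
    proof -
      have "\<bar>c * h\<bar> \<le> C * \<bar>h\<bar>" unfolding abs_mult using that by (intro mult_right_mono) auto
      also have "\<dots> < C * d" using that C(1) by (intro mult_strict_left_mono) auto
      also have "\<dots> = \<rho> / 2" using C(1) by (simp add: d_def)
      finally show ?thesis .
    qed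
    have box: "u \<tau> x \<le> v + e" "v - e \<le> u \<tau> x" if "\<bar>\<tau> - s\<bar> < d" "\<bar>x - Y\<bar> < \<rho>" for \<tau> x
      using \<rho>(2)[of \<tau> x] that d by auto
    have "\<bar>quantile \<eta> t - Y - v * (t - s)\<bar> \<le> e * \<bar>t - s\<bar>" if t: "\<bar>t - s\<bar> < d" for t
    proof (cases "s \<le> t")
      case True
      have up: "quantile \<eta> t \<le> Y + (v + e) * (t - s)"
      proof (rule le_of_small_add)
        show "\<rho> / 8 > 0" using \<rho> by simp
        fix r assume r: "0 < r" "r < \<rho> / 8"
        have "F s Y \<le> F t (Y + (v + e) * (t - s) + r)"
        proof (rule F_le_ahead[OF True r(1)])
          fix \<tau> x assume \<tau>: "s \<le> \<tau>" "\<tau> \<le> t" and x: "Y + (v + e) * (\<tau> - s) \<le> x" "x \<le> Y + (v + e) * (\<tau> - s) + r"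
          show "u \<tau> x \<le> v + e"
            using small[of "v + e" "\<tau> - s"] C \<tau> t x r by (intro box) auto
        qed
        with FY have "quantile \<eta> t \<le> Y + (v + e) * (t - s) + r" by (simp add: le_iff)
        with r show "quantile \<eta> t \<le> Y + (v + e) * (t - s) + 2 * r" by simp
      qed
      have lo: "Y + (v - e) * (t - s) \<le> quantile \<eta> t"
      proof (rule le_of_small_add)
        show "\<rho> / 8 > 0" using \<rho> by simp
        fix r assume r: "0 < r" "r < \<rho> / 8"
        have "F t (Y - 2 * r + (v - e) * (t - s)) \<le> F s (Y - 2 * r + r)"
        proof (rule F_le_behind[OF True r(1)])
          fix \<tau> x assume \<tau>: "s \<le> \<tau>" "\<tau> \<le> t" and x: "Y - 2 * r + (v - e) * (\<tau> - s) \<le> x" "x \<le> Y - 2 * r + (v - e) * (\<tau> - s) + r"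
          show "v - e \<le> u \<tau> x"
            using small[of "v - e" "\<tau> - s"] C \<tau> t x r by (intro box) auto
        qed
        also have "\<dots> < \<eta>" using r by (intro FY') simp
        finally have "\<not> quantile \<eta> t \<le> Y - 2 * r + (v - e) * (t - s)" by (simp add: le_iff)
        then show "Y + (v - e) * (t - s) \<le> quantile \<eta> t + 2 * r" by simp
      qed
      show ?thesis using up lo True by (simp add: abs_le_iff algebra_simps)
    next
      case False
      then have ts: "t \<le> s" by simp
      have lo: "Y + (v + e) * (t - s) \<le> quantile \<eta> t"
      proof (rule le_of_small_add)
        show "\<rho> / 8 > 0" using \<rho> by simp
        fix r assume r: "0 < r" "r < \<rho> / 8"
        have "F t (Y + (v + e) * (t - s) - 2 * r)
            \<le> F s (Y + (v + e) * (t - s) - 2 * r + (v + e) * (s - t) + r)"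
        proof (rule F_le_ahead[OF ts r(1)])
          fix \<tau> x assume \<tau>: "t \<le> \<tau>" "\<tau> \<le> s"
            and x: "Y + (v + e) * (t - s) - 2 * r + (v + e) * (\<tau> - t) \<le> x"
              "x \<le> Y + (v + e) * (t - s) - 2 * r + (v + e) * (\<tau> - t) + r"
          have "(v + e) * (t - s) + (v + e) * (\<tau> - t) = (v + e) * (\<tau> - s)"
            by (simp add: algebra_simps)
          then show "u \<tau> x \<le> v + e"
            using small[of "v + e" "\<tau> - s"] C \<tau> t x r by (intro box) auto
        qed
        also have "\<dots> < \<eta>" using r by (intro FY') (simp add: algebra_simps)
        finally have "\<not> quantile \<eta> t \<le> Y + (v + e) * (t - s) - 2 * r" by (simp add: le_iff)
        then show "Y + (v + e) * (t - s) \<le> quantile \<eta> t + 2 * r" by simp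
      qed
      have up: "quantile \<eta> t \<le> Y + (v - e) * (t - s)"
      proof (rule le_of_small_add)
        show "\<rho> / 8 > 0" using \<rho> by simp
        fix r assume r: "0 < r" "r < \<rho> / 8"
        have "F s (Y + (v - e) * (t - s) + (v - e) * (s - t)) \<le> F t (Y + (v - e) * (t - s) + r)"
        proof (rule F_le_behind[OF ts r(1)])
          fix \<tau> x assume \<tau>: "t \<le> \<tau>" "\<tau> \<le> s"
            and x: "Y + (v - e) * (t - s) + (v - e) * (\<tau> - t) \<le> x"
              "x \<le> Y + (v - e) * (t - s) + (v - e) * (\<tau> - t) + r"
          have "(v - e) * (t - s) + (v - e) * (\<tau> - t) = (v - e) * (\<tau> - s)"
            by (simp add: algebra_simps)
          then show "v - e \<le> u \<tau> x"
            using small[of "v - e" "\<tau> - s"] C \<tau> t x r by (intro box) auto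
        qed
        moreover have "Y + (v - e) * (t - s) + (v - e) * (s - t) = Y"
          by (simp add: algebra_simps)
        ultimately have "quantile \<eta> t \<le> Y + (v - e) * (t - s) + r"
          using FY by (simp add: le_iff)
        with r show "quantile \<eta> t \<le> Y + (v - e) * (t - s) + 2 * r" by simp
      qed
      show ?thesis using up lo False by (simp add: abs_le_iff algebra_simps)
    qed
    then show ?thesis using d(1) by (auto simp: Y_def)
  qed
  then show ?thesis
    unfolding has_field_derivative_def has_derivative_at_alt
    by (simp add: bounded_linear_mult_right v_def Y_def)
qed

end

section \<open>The velocity along a quantile curve\<close>

lemma bump_deriv_0: "x \<notin> {0..1} \<Longrightarrow> dir_deriv 1 bump x = 0"
  by (rule dir_deriv_locally_constant[of "- {0..1}"])
    (auto intro: open_Compl closed_real_atLeastAtMost bump_0)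

lemma delta_deriv:
  "dir_deriv 1 (\<lambda>x. delta n (x - z)) x = (real (Suc n))\<^sup>2 * dir_deriv 1 bump (real (Suc n) * (x - z))"
proof -
  have 1: "((\<lambda>x. real (Suc n) * (x - z)) has_real_derivative real (Suc n)) (at x)"
    by (auto intro!: derivative_eq_intros simp del: of_nat_Suc)
  have "((\<lambda>x. real (Suc n) * bump (real (Suc n) * (x - z))) has_real_derivative
      real (Suc n) * (dir_deriv 1 bump (real (Suc n) * (x - z)) * real (Suc n))) (at x)"
    by (rule DERIV_cmult[OF DERIV_chain2[OF test_function_has_derivative[OF test_function_bump] 1]])
  from dir_deriv_real_eqI[OF this, of 1] show ?thesis
    by (simp add: delta_def power2_eq_square mult_ac del: of_nat_Suc)
qed

lemma integral_test_function_deriv: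
  fixes a :: "real \<Rightarrow> real"
  assumes "test_function a"
  shows "(LINT x|lborel. dir_deriv 1 a x) = 0"
proof -
  have "primitive (\<lambda>_. 1) (\<lambda>_. 0)"
    by (rule primitiveI_derivative) auto
  from integral_test_function_primitive(2)[OF assms this] show ?thesis by simp
qed

context hs_flow
begin

text \<open>The factor 2 counts the supports of the two mollifiers, each inside an interval of length 1.\<close>

lemma mollified_Lipschitz:
  assumes L: "\<And>x y. \<bar>delta n x - delta n y\<bar> \<le> L * \<bar>x - y\<bar>" and K: "norm (u t) \<le> K"
  shows "\<bar>(LINT x|lborel. delta n (x - z) * u t x) - (LINT x|lborel. delta n (x - z') * u t x)\<bar>
    \<le> 2 * L * K * \<bar>z - z'\<bar>"
proof -
  have int: "integrable lborel (\<lambda>x. delta n (x - z) * u t x)" for z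
    by (intro integrable_mult_test_function test_function_delta continuous_on_apply_bcontfun)
  let ?I = "\<lambda>x. indicator {z..z + 1} x + indicator {z'..z' + 1} x :: real"
  have K0: "0 \<le> K" using K norm_ge_zero order_trans by blast
  have L0: "0 \<le> L" using L[of 1 0] by (auto intro: order_trans[OF abs_ge_zero])
  have "\<bar>LINT x|lborel. delta n (x - z) * u t x - delta n (x - z') * u t x\<bar>
      \<le> (LINT x|lborel. (L * K * \<bar>z - z'\<bar>) * ?I x)"
  proof (rule integral_abs_bound_integral)
    show "integrable lborel (\<lambda>x. delta n (x - z) * u t x - delta n (x - z') * u t x)"
      using int by simp
    show "integrable lborel (\<lambda>x. (L * K * \<bar>z - z'\<bar>) * ?I x)"
      by (intro integrable_mult_right Bochner_Integration.integrable_add integrable_real_indicator)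
        (auto simp: emeasure_lborel_Icc_eq)
    fix x
    have "\<bar>delta n (x - z) - delta n (x - z')\<bar> \<le> L * \<bar>z - z'\<bar> * ?I x"
    proof (cases "x \<in> {z..z+1} \<or> x \<in> {z'..z'+1}")
      case True
      then have "1 \<le> ?I x" by (auto simp: indicator_def)
      have "\<bar>delta n (x - z) - delta n (x - z')\<bar> \<le> L * \<bar>z - z'\<bar>"
        using L[of "x - z" "x - z'"] by (simp add: abs_minus_commute)
      also have "\<dots> \<le> L * \<bar>z - z'\<bar> * ?I x"
        using \<open>1 \<le> ?I x\<close> L0 mult_left_mono[of 1 "?I x" "L * \<bar>z - z'\<bar>"] by simp
      finally show ?thesis .
    next
      case False
      have "delta n (x - w) = 0" if "x \<notin> {w..w+1}" for w
      proof (rule delta_0, rule notI)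
        assume "x - w \<in> {0..1 / real (Suc n)}"
        moreover have "1 / real (Suc n) \<le> 1" by simp
        ultimately have "0 \<le> x - w" "x - w \<le> 1"
          unfolding atLeastAtMost_iff by (blast intro: order_trans)+
        with that show False by auto
      qed
      then show ?thesis using L0 False by simp
    qed
    moreover have "\<bar>u t x\<bar> \<le> K"
      using order_trans[OF norm_bounded K] by simp
    ultimately have "\<bar>delta n (x - z) - delta n (x - z')\<bar> * \<bar>u t x\<bar> \<le> (L * \<bar>z - z'\<bar> * ?I x) * K"
      using L0 by (intro mult_mono) auto
    then show "\<bar>delta n (x - z) * u t x - delta n (x - z') * u t x\<bar> \<le> (L * K * \<bar>z - z'\<bar>) * ?I x"
      by (simp add: abs_mult[symmetric] algebra_simps)
  qed
  also have "\<dots> = 2 * L * K * \<bar>z - z'\<bar>"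
  proof -
    have "(LINT x|lborel. ?I x) = 2"
      by (subst Bochner_Integration.integral_add)
        (auto simp: emeasure_lborel_Icc_eq intro!: integrable_real_indicator)
    then show ?thesis by simp
  qed
  finally show ?thesis using int by simp
qed

text \<open>The rate of change of the mollified velocity along a trajectory through \<open>y\<close>: half the averaged
  distribution function plus a commutator. With \<open>c = u t y\<close>, the flux \<open>u\<^sup>2 / 2 - c u\<close> in the frame of
  speed \<open>c\<close> differs from \<open>(u - c)\<^sup>2 / 2\<close> by a constant, and constants integrate to zero against the
  derivative of a test function; hence the commutator is quadratic in \<open>u - c\<close>.\<close>

definition force :: "nat \<Rightarrow> real \<Rightarrow> real \<Rightarrow> real"
  where "force n t y = 1/2 * (LINT x|lborel. dir_deriv 1 (\<lambda>x. delta n (x - y)) x * (u t x - u t y)\<^sup>2)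
    + 1/2 * (LINT x|lborel. delta n (x - y) * F t x)"

text \<open>At time \<open>t0\<close> the curve \<open>Y\<close> may be replaced by its tangent: the mollified velocity is Lipschitz in
  the base point, so the error is of smaller order than \<open>t - t0\<close>. Along the tangent the momentum
  balance in the frame of speed \<open>u t0 (Y t0)\<close> applies.\<close>

lemma mollified_velocity_derivative:
  assumes Y: "(Y has_real_derivative u t0 (Y t0)) (at t0)"
  shows "((\<lambda>t. LINT x|lborel. delta n (x - Y t) * u t x) has_real_derivative force n t0 (Y t0)) (at t0)"
proof -
  define c where "c = u t0 (Y t0)"
  define z where "z t = Y t0 + c * (t - t0)" for t
  define a where "a x = delta n (x - (Y t0 - c * t0))" for x
  have a: "test_function a"
    unfolding a_def[abs_def] by (rule test_function_delta)
  have a_eq: "a (x - c * t) = delta n (x - z t)" for x t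
    by (simp add: a_def z_def algebra_simps)
  define h where "h t = (LINT x|lborel. delta n (x - z t) * u t x)" for t
  let ?d = "\<lambda>x. dir_deriv 1 (\<lambda>x. delta n (x - Y t0)) x"
  have da: "dir_deriv 1 a (x - c * t0) = ?d x" for x
    using deriv_shift[OF a, of "c * t0" x] unfolding a_eq by (simp add: z_def)
  have dt: "test_function ?d"
    by (intro test_function_deriv test_function_delta)
  have h: "(h has_real_derivative force n t0 (Y t0)) (at t0)"
  proof -
    have i1: "integrable lborel (\<lambda>x. ?d x * ((u t0 x - c)\<^sup>2 / 2))"
      and i2: "integrable lborel (\<lambda>x. ?d x * (c\<^sup>2 / 2))"
      by (intro integrable_mult_test_function dt continuous_intros continuous_on_apply_bcontfun; simp)+
    have "(LINT x|lborel. ?d x * ((u t0 x)\<^sup>2 / 2 - c * u t0 x))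
      = (LINT x|lborel. ?d x * ((u t0 x - c)\<^sup>2 / 2) - ?d x * (c\<^sup>2 / 2))"
      by (intro Bochner_Integration.integral_cong) (auto simp: power2_eq_square field_simps)
    also have "\<dots> = (LINT x|lborel. ?d x * ((u t0 x - c)\<^sup>2 / 2)) - (LINT x|lborel. ?d x * (c\<^sup>2 / 2))"
      using i1 i2 by simp
    also have "(LINT x|lborel. ?d x * (c\<^sup>2 / 2)) = 0"
      using integral_test_function_deriv[OF test_function_delta, of n "Y t0"] by simp
    finally have E: "(LINT x|lborel. ?d x * ((u t0 x)\<^sup>2 / 2 - c * u t0 x))
        = 1/2 * (LINT x|lborel. ?d x * (u t0 x - u t0 (Y t0))\<^sup>2)"
      by (simp add: c_def)
    have "z t0 = Y t0" by (simp add: z_def)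
    with momentum[OF a, of c t0] show ?thesis
      unfolding a_eq da E by (simp add: h_def[abs_def] force_def F_def)
  qed
  define k where "k t = (LINT x|lborel. delta n (x - Y t) * u t x) - h t" for t
  obtain L where L0: "\<And>x y. \<bar>a x - a y\<bar> \<le> L * \<bar>x - y\<bar>"
    using test_function_Lipschitz[OF a] by metis
  have L: "\<bar>delta n x - delta n y\<bar> \<le> L * \<bar>x - y\<bar>" for x y
    using L0[of "x + (Y t0 - c * t0)" "y + (Y t0 - c * t0)"] by (simp add: a_def)
  define K where "K = norm (u t0) + 1"
  have "((\<lambda>t. norm (u t)) \<longlongrightarrow> norm (u t0)) (at t0)"
    using u_continuous by (intro tendsto_norm) (simp add: continuous_on_def)
  then have "eventually (\<lambda>t. norm (u t) < K) (at t0)"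
    by (rule order_tendstoD) (simp add: K_def)
  then have kb: "eventually (\<lambda>t. norm (k t / (t - t0)) \<le> 2 * L * K * \<bar>(Y t - Y t0) / (t - t0) - c\<bar>) (at t0)"
    using eventually_neq_at_within[of t0 t0 UNIV]
  proof (eventually_elim)
    case (elim t)
    then have ne: "t - t0 \<noteq> 0" by simp
    have "\<bar>k t\<bar> \<le> 2 * L * K * \<bar>Y t - z t\<bar>"
      unfolding k_def h_def by (rule mollified_Lipschitz[OF L]) (use elim in simp)
    also have "Y t - z t = ((Y t - Y t0) / (t - t0) - c) * (t - t0)"
      using ne by (simp add: z_def field_simps)
    finally have "\<bar>k t\<bar> \<le> (2 * L * K * \<bar>(Y t - Y t0) / (t - t0) - c\<bar>) * \<bar>t - t0\<bar>"
      by (simp add: abs_mult mult.assoc)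
    then show ?case
      using ne by (simp add: pos_divide_le_eq)
  qed
  have "((\<lambda>t. (Y t - Y t0) / (t - t0)) \<longlongrightarrow> c) (at t0)"
    using Y by (simp add: has_field_derivative_iff c_def)
  then have "((\<lambda>t. 2 * L * K * \<bar>(Y t - Y t0) / (t - t0) - c\<bar>) \<longlongrightarrow> 2 * L * K * \<bar>c - c\<bar>) (at t0)"
    by (intro tendsto_mult tendsto_rabs tendsto_diff tendsto_const)
  then have "((\<lambda>t. 2 * L * K * \<bar>(Y t - Y t0) / (t - t0) - c\<bar>) \<longlongrightarrow> 0) (at t0)"
    by simp
  with kb have "((\<lambda>t. k t / (t - t0)) \<longlongrightarrow> 0) (at t0)"
    by (rule Lim_null_comparison)
  then have "(k has_real_derivative 0) (at t0)"
    by (simp add: has_field_derivative_iff k_def h_def z_def)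
  from DERIV_add[OF h this] show ?thesis
    by (simp add: k_def)
qed

lemma F_diff: "x \<le> y \<Longrightarrow> measure (\<mu> t) {x<..y} = F t y - F t x"
  using finite_borel_measure.cdf_diff_eq[OF \<mu>_borel[of t], of x y]
  by (cases "x = y") (auto simp: F_cdf)

text \<open>On the support of the mollifier, of length \<open>e = 1 / (n + 1)\<close>, the energy bound gives
  \<open>(u t x - u t y)\<^sup>2 \<le> e m\<close> with \<open>m\<close> the mass in \<open>(y, y + e]\<close>, whereas the derivative of the
  mollifier is of size \<open>e\<^sup>-\<^sup>2\<close>. The powers of \<open>e\<close> cancel, and what remains is the mass of a
  shrinking half-open interval.\<close>

lemma force_commutator:
  assumes B: "\<And>x. \<bar>dir_deriv 1 bump x\<bar> \<le> B"
  shows "\<bar>LINT x|lborel. dir_deriv 1 (\<lambda>x. delta n (x - y)) x * (u t x - u t y)\<^sup>2\<bar>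
    \<le> B * (F t (y + 1 / real (Suc n)) - F t y)"
proof -
  define e where "e = 1 / real (Suc n)"
  have e: "e > 0" "real (Suc n) * e = 1" by (auto simp: e_def)
  have B0: "0 \<le> B" using B[of 0] by linarith
  let ?m = "F t (y + e) - F t y"
  have "\<bar>LINT x|lborel. dir_deriv 1 (\<lambda>x. delta n (x - y)) x * (u t x - u t y)\<^sup>2\<bar>
      \<le> (LINT x|lborel. (real (Suc n))\<^sup>2 * B * (e * ?m) * indicator {y..y + e} x)"
  proof (rule integral_abs_bound_integral)
    show "integrable lborel (\<lambda>x. dir_deriv 1 (\<lambda>x. delta n (x - y)) x * (u t x - u t y)\<^sup>2)"
      by (intro integrable_mult_test_function test_function_deriv test_function_delta
          continuous_intros continuous_on_apply_bcontfun)
    show "integrable lborel (\<lambda>x. (real (Suc n))\<^sup>2 * B * (e * ?m) * indicator {y..y + e} x)"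
      by (intro integrable_mult_right integrable_real_indicator) (auto simp: emeasure_lborel_Icc_eq)
    fix x
    show "\<bar>dir_deriv 1 (\<lambda>x. delta n (x - y)) x * (u t x - u t y)\<^sup>2\<bar>
        \<le> (real (Suc n))\<^sup>2 * B * (e * ?m) * indicator {y..y + e} x"
    proof (cases "x \<in> {y..y + e}")
      case True
      then have "(u t x - u t y)\<^sup>2 \<le> (x - y) * measure (\<mu> t) {y<..<x}"
        by (intro energy) simp
      also have "\<dots> \<le> e * measure (\<mu> t) {y<..y+e}"
        using True e by (intro mult_mono finite_measure.finite_measure_mono[OF finite_\<mu>]) auto
      also have "\<dots> = e * ?m" using e by (simp add: F_diff)
      finally have "(u t x - u t y)\<^sup>2 \<le> e * ?m" .
      then have "(real (Suc n))\<^sup>2 * \<bar>dir_deriv 1 bump (real (Suc n) * (x - y))\<bar> * (u t x - u t y)\<^sup>2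
          \<le> (real (Suc n))\<^sup>2 * B * (e * ?m)"
        using B B0 by (intro mult_mono) auto
      then show ?thesis using True by (simp add: delta_deriv abs_mult del: of_nat_Suc)
    next
      case False
      have "real (Suc n) * (x - y) \<notin> {0..1}"
      proof
        assume "real (Suc n) * (x - y) \<in> {0..1}"
        then have "0 * e \<le> (real (Suc n) * (x - y)) * e" "(real (Suc n) * (x - y)) * e \<le> 1 * e"
          using e(1) by (intro mult_right_mono; simp)+
        moreover have "(real (Suc n) * (x - y)) * e = x - y"
          by (simp add: e_def del: of_nat_Suc)
        ultimately have "0 \<le> x - y" "x - y \<le> e"
          by (simp_all only: mult_zero_left mult_1)
        with False show False by auto
      qed
      then show ?thesis using False by (simp add: delta_deriv bump_deriv_0 del: of_nat_Suc)
    qed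
  qed
  also have "\<dots> = (real (Suc n))\<^sup>2 * B * (e * ?m) * e"
    using e by simp
  also have "\<dots> = B * ((real (Suc n) * e) * (real (Suc n) * e)) * ?m"
    by (simp only: power2_eq_square mult_ac)
  also have "\<dots> = B * ?m" by (simp only: e(2) mult_1 mult_1_right)
  finally show ?thesis by (simp add: e_def)
qed

lemma F_measurable [measurable]: "F t \<in> borel_measurable borel"
  unfolding F_def[abs_def] by (rule measure_atMost_borel[OF \<mu>_radon])

lemma force_bounded: "\<exists>C. \<forall>n t y. \<bar>force n t y\<bar> \<le> C"
proof -
  obtain B where B: "B > 0" "\<And>x. \<bar>dir_deriv 1 bump x\<bar> \<le> B"
    using test_function_bounded[OF test_function_deriv[OF test_function_bump]] by blast
  define m where "m = mass 0"
  have "\<bar>force n t y\<bar> \<le> 1/2 * (B * m) + 1/2 * m" for n t y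
  proof -
    have Fm: "0 \<le> F t x" "F t x \<le> m" for x
      using F_nonneg F_le_mass[of t x] mass_constant[of t 0] by (auto simp: m_def)
    have "\<bar>LINT x|lborel. dir_deriv 1 (\<lambda>x. delta n (x - y)) x * (u t x - u t y)\<^sup>2\<bar> \<le> B * m"
    proof -
      have "F t (y + 1 / real (Suc n)) - F t y \<le> m"
        using Fm[of y] Fm[of "y + 1 / real (Suc n)"] by linarith
      then have "B * (F t (y + 1 / real (Suc n)) - F t y) \<le> B * m"
        using B(1) by (intro mult_left_mono) auto
      with force_commutator[OF B(2), of n y t] show ?thesis by (rule order_trans)
    qed
    moreover have "\<bar>LINT x|lborel. delta n (x - y) * F t x\<bar> \<le> m"
    proof -
      have "\<bar>LINT x|lborel. delta n (x - y) * F t x\<bar> = \<bar>LINT s|lborel. bump s * F t (y + s / real (Suc n))\<bar>"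
        by (simp only: delta_integral_scaled)
      also have "\<dots> \<le> (LINT s|lborel. bump s * m)"
      proof (rule integral_abs_bound_integral)
        show "integrable lborel (\<lambda>s. bump s * m)" using integrable_bump by simp
        then show "integrable lborel (\<lambda>s. bump s * F t (y + s / real (Suc n)))"
          by (rule Bochner_Integration.integrable_bound)
            (use Fm bump_nonneg in \<open>auto simp: abs_mult intro!: mult_left_mono order_trans[OF Fm(2)]\<close>)
        show "\<bar>bump s * F t (y + s / real (Suc n))\<bar> \<le> bump s * m" for s
          using Fm bump_nonneg by (auto simp: abs_mult intro!: mult_left_mono)
      qed
      finally show ?thesis by (simp add: integral_bump)
    qed
    ultimately show ?thesis unfolding force_def by linarith
  qed
  then show ?thesis by blast
qed

lemma force_tendsto: "(\<lambda>n. force n t y) \<longlonglongrightarrow> F t y / 2"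
proof -
  obtain B where B: "B > 0" "\<And>x. \<bar>dir_deriv 1 bump x\<bar> \<le> B"
    using test_function_bounded[OF test_function_deriv[OF test_function_bump]] by blast
  have "filterlim (\<lambda>n. y + 1 / real (Suc n)) (at_right y) sequentially"
  proof -
    have "(\<lambda>n. y + 1 / real (Suc n)) \<longlonglongrightarrow> y + 0"
      by (intro tendsto_add tendsto_const LIMSEQ_Suc[OF lim_const_over_n])
    then show ?thesis by (auto simp: filterlim_at)
  qed
  from filterlim_compose[OF F_right this]
  have "(\<lambda>n. B * (F t (y + 1 / real (Suc n)) - F t y)) \<longlonglongrightarrow> B * (F t y - F t y)"
    by (intro tendsto_mult tendsto_diff tendsto_const)
  then have lim: "(\<lambda>n. B * (F t (y + 1 / real (Suc n)) - F t y)) \<longlonglongrightarrow> 0"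
    by simp
  have "(\<lambda>n. LINT x|lborel. dir_deriv 1 (\<lambda>x. delta n (x - y)) x * (u t x - u t y)\<^sup>2) \<longlonglongrightarrow> 0"
  proof (rule Lim_null_comparison[OF always_eventually lim], rule allI)
    show "norm (LINT x|lborel. dir_deriv 1 (\<lambda>x. delta n (x - y)) x * (u t x - u t y)\<^sup>2)
        \<le> B * (F t (y + 1 / real (Suc n)) - F t y)" for n
      unfolding real_norm_def by (rule force_commutator[OF B(2)])
  qed
  moreover have "(\<lambda>n. LINT x|lborel. delta n (x - y) * F t x) \<longlonglongrightarrow> F t y"
    by (rule delta_tendsto[where B = "mass t"])
      (auto simp: F_right F_nonneg F_le_mass)
  ultimately have "(\<lambda>n. force n t y) \<longlonglongrightarrow> 1/2 * 0 + 1/2 * F t y"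
    unfolding force_def by (intro tendsto_add tendsto_mult tendsto_const)
  then show ?thesis by simp
qed

text \<open>Where \<open>\<mu> t\<close> has no atoms its distribution function is continuous and takes the value \<open>\<eta>\<close> at
  the quantile.\<close>

lemma F_quantile_ae:
  assumes \<eta>: "0 < \<eta>" "\<eta> < mass 0"
  shows "\<exists>N. negligible N \<and> (\<forall>t. t \<notin> N \<longrightarrow> F t (quantile \<eta> t) = \<eta>)"
proof -
  obtain N where N: "N \<in> null_sets lborel" "{t. \<not> (\<forall>x. measure (\<mu> t) {x} = 0)} \<subseteq> N"
    using no_atoms by (auto simp: eventually_ae_filter)
  have "negligible N"
    using N(1) by (simp add: negligible_iff_null_sets null_sets_completionI)
  moreover have "F t (quantile \<eta> t) = \<eta>" if "t \<notin> N" for t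
  proof (rule antisym)
    let ?y = "quantile \<eta> t"
    show "\<eta> \<le> F t ?y" using quantile_le_iff[OF \<eta>, of t ?y] by simp
    have "measure (\<mu> t) {?y} = 0" using that N(2) by auto
    then have "isCont (F t) ?y"
      unfolding F_cdf using finite_borel_measure.isCont_cdf[OF \<mu>_borel] by blast
    then have lim: "(F t \<longlongrightarrow> F t ?y) (at_left ?y)"
      by (simp add: isCont_def filterlim_at_split)
    have "eventually (\<lambda>y. y < ?y) (at_left ?y)"
      by (simp add: eventually_at_filter)
    then have "eventually (\<lambda>y. F t y \<le> \<eta>) (at_left ?y)"
    proof eventually_elim
      case (elim y)
      then show ?case using quantile_le_iff[OF \<eta>, of t y] by linarith
    qed
    then show "F t ?y \<le> \<eta>"
      by (rule tendsto_upperbound[OF lim]) simp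
  qed
  ultimately show ?thesis by blast
qed

text \<open>Integrate the rate of change of the mollified velocity in time and let the mollification shrink.
  The times at which \<open>\<mu> t\<close> has atoms, where the limit of the rate may differ from \<open>\<eta> / 2\<close>, form a null
  set.\<close>

lemma velocity_on_quantile:
  assumes \<eta>: "0 < \<eta>" "\<eta> < mass 0"
  shows "u t (quantile \<eta> t) = u 0 (quantile \<eta> 0) + \<eta> / 2 * t"
proof -
  let ?Y = "quantile \<eta>"
  obtain N where N: "negligible N" "\<And>t. t \<notin> N \<Longrightarrow> F t (?Y t) = \<eta>"
    using F_quantile_ae[OF \<eta>] by auto
  obtain C where C: "\<And>n t y. \<bar>force n t y\<bar> \<le> C"
    using force_bounded by auto
  define v where "v n t = (LINT x|lborel. delta n (x - ?Y t) * u t x)" for n t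
  have dv: "(v n has_real_derivative force n t (?Y t)) (at t)" for n t
    unfolding v_def[abs_def] by (rule mollified_velocity_derivative[OF quantile_has_derivative[OF \<eta>]])
  have lim_v: "(\<lambda>n. v n t) \<longlonglongrightarrow> u t (?Y t)" for t
    unfolding v_def
  proof (rule delta_tendsto[where B = "norm (u t)"])
    show c: "apply_bcontfun (u t) \<in> borel_measurable borel"
      by (intro borel_measurable_continuous_onI continuous_on_apply_bcontfun)
    show "\<bar>u t x\<bar> \<le> norm (u t)" for x
      using norm_bounded[of "u t" x] by simp
    from isCont_u[where t = t and x = "?Y t"] show "(apply_bcontfun (u t) \<longlongrightarrow> u t (?Y t)) (at_right (?Y t))"
      by (simp add: isCont_def filterlim_at_split)
  qed
  have inc: "u t (?Y t) - u s (?Y s) = \<eta> / 2 * (t - s)" if st: "s \<le> t" for s t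
  proof -
    have I: "((\<lambda>\<tau>. force n \<tau> (?Y \<tau>)) has_integral v n t - v n s) {s..t}" for n
      by (rule fundamental_theorem_of_calculus[OF st])
        (rule has_vector_derivative_at_within, rule dv[unfolded has_real_derivative_iff_has_vector_derivative])
    have "(\<lambda>n. integral {s..t} (\<lambda>\<tau>. force n \<tau> (?Y \<tau>))) \<longlonglongrightarrow> integral {s..t} (\<lambda>\<tau>. F \<tau> (?Y \<tau>) / 2)"
    proof (rule dominated_convergence(2)[where h = "\<lambda>_. C"])
      show "(\<lambda>\<tau>. force n \<tau> (?Y \<tau>)) integrable_on {s..t}" for n
        by (rule has_integral_integrable[OF I])
      show "(\<lambda>_. C) integrable_on {s..t}"
        by (rule integrable_const_ivl)
      show "norm (force n \<tau> (?Y \<tau>)) \<le> C" for n \<tau>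
        unfolding real_norm_def by (rule C)
      show "(\<lambda>n. force n \<tau> (?Y \<tau>)) \<longlonglongrightarrow> F \<tau> (?Y \<tau>) / 2" for \<tau>
        by (rule force_tendsto)
    qed
    moreover have "integral {s..t} (\<lambda>\<tau>. force n \<tau> (?Y \<tau>)) = v n t - v n s" for n
      by (rule integral_unique[OF I])
    ultimately have lim_I: "(\<lambda>n. v n t - v n s) \<longlonglongrightarrow> integral {s..t} (\<lambda>\<tau>. F \<tau> (?Y \<tau>) / 2)"
      by (simp only:)
    have "u t (?Y t) - u s (?Y s) = integral {s..t} (\<lambda>\<tau>. F \<tau> (?Y \<tau>) / 2)"
      by (rule LIMSEQ_unique[OF tendsto_diff[OF lim_v lim_v] lim_I])
    also have "\<dots> = integral {s..t} (\<lambda>\<tau>. \<eta> / 2)"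
      by (rule integral_spike[OF N(1)]) (use N(2) in auto)
    also have "\<dots> = \<eta> / 2 * (t - s)" using st by simp
    finally show ?thesis .
  qed
  show ?thesis
  proof (cases "0 \<le> t")
    case True
    from inc[OF this] show ?thesis by (simp add: algebra_simps)
  next
    case False
    then have "t \<le> 0" by simp
    from inc[OF this] show ?thesis by (simp add: algebra_simps)
  qed
qed

lemma quantile_trajectory:
  assumes \<eta>: "0 < \<eta>" "\<eta> < mass 0"
  shows "quantile \<eta> t = quantile \<eta> 0 + u 0 (quantile \<eta> 0) * t + \<eta> / 4 * t\<^sup>2"
proof -
  define w where "w = u 0 (quantile \<eta> 0)"
  define r where "r t = quantile \<eta> t - (w * t + \<eta> / 4 * t\<^sup>2)" for t
  have "(r has_real_derivative 0) (at t)" for t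
  proof -
    have "((\<lambda>t. w * t + \<eta> / 4 * t\<^sup>2) has_real_derivative w + \<eta> / 2 * t) (at t)"
      by (auto intro!: derivative_eq_intros)
    moreover have "(quantile \<eta> has_real_derivative w + \<eta> / 2 * t) (at t)"
      using quantile_has_derivative[OF \<eta>, of t] unfolding velocity_on_quantile[OF \<eta>, of t] w_def .
    ultimately have "((\<lambda>t. quantile \<eta> t - (w * t + \<eta> / 4 * t\<^sup>2)) has_real_derivative
        (w + \<eta> / 2 * t) - (w + \<eta> / 2 * t)) (at t)"
      by (intro DERIV_diff)
    then show ?thesis by (simp add: r_def[abs_def])
  qed
  then have "r t = r 0" by (intro DERIV_isconst_all) blast
  then show ?thesis by (simp add: r_def w_def)
qed

end

section \<open>Every point lies on a parabola\<close>

text \<open>The data of the parabolas that pass through a fixed point \<open>x\<close> at large times \<open>t\<close>: initial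
  position \<open>X t\<close>, initial velocity \<open>w (X t)\<close> and label \<open>E t\<close>. The label lies between the left and the
  right limit of the initial distribution function \<open>F0\<close> at \<open>X t\<close>. \<open>U t\<close> is the velocity at \<open>x\<close>.\<close>

locale hs_orbit =
  fixes x C K :: real and w F0 X E U :: "real \<Rightarrow> real"
  assumes position: "eventually (\<lambda>t. x = X t + w (X t) * t + E t / 4 * t\<^sup>2) at_top"
    and velocity: "eventually (\<lambda>t. U t = w (X t) + E t / 2 * t) at_top"
    and label_upper: "eventually (\<lambda>t. E t \<le> F0 (X t)) at_top"
    and label_lower: "eventually (\<lambda>t. \<forall>y<X t. F0 y \<le> E t) at_top"
    and label_nonneg: "\<And>t. 0 \<le> E t"
    and label_lim: "(E \<longlongrightarrow> 0) at_top"
    and w_bound: "\<And>y. \<bar>w y\<bar> \<le> K"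
    and C_pos: "F0 C > 0"

context hs_flow
begin

lemma u_constant_on_gap:
  assumes "z1 \<le> z2" and gap: "\<And>z. z < z2 \<Longrightarrow> F t z \<le> F t z1"
  shows "u t z1 = u t z2"
proof (cases "z1 = z2")
  case False
  then have lt: "z1 < z2" using assms(1) by simp
  have eq: "u t z = u t z1" if "z1 < z" "z < z2" for z
  proof -
    have "(u t z - u t z1)\<^sup>2 \<le> (z - z1) * measure (\<mu> t) {z1<..<z}"
      using that by (intro energy) simp
    also have "\<dots> \<le> (z - z1) * measure (\<mu> t) {z1<..z}"
      using that by (intro mult_left_mono finite_measure.finite_measure_mono[OF finite_\<mu>]) auto
    also have "\<dots> \<le> 0"
      using that gap[of z] by (subst F_diff) (auto intro: mult_nonneg_nonpos)
    finally show ?thesis by simp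
  qed
  have lim: "(apply_bcontfun (u t) \<longlongrightarrow> u t z2) (at_left z2)"
    using isCont_u[where t = t and x = z2] by (simp add: isCont_def filterlim_at_split)
  have "eventually (\<lambda>z. z1 < z \<and> z < z2) (at_left z2)"
    by (rule eventually_at_leftI[OF _ lt]) auto
  then have "eventually (\<lambda>z. u t z1 = u t z) (at_left z2)"
    by eventually_elim (simp add: eq)
  from tendsto_unique[OF trivial_limit_at_left_real Lim_transform_eventually[OF tendsto_const this] lim]
  show ?thesis .
qed simp

lemma u_bound: "\<bar>u t x\<bar> \<le> norm (u t)"
  using norm_bounded[of "u t" x] by simp

text \<open>With \<open>\<eta> = F t x\<close>, no mass lies strictly between \<open>x\<close> and a point \<open>b\<close>, the limit of the trajectories
  with labels \<open>e k\<close> decreasing to \<open>\<eta>\<close>. They start at points decreasing to \<open>b0\<close>, so the parabola from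
  \<open>b0\<close> reaches \<open>b\<close> at time \<open>t\<close>. Velocities are constant across gaps, at time 0 as well as at time \<open>t\<close>;
  therefore the gap is translated rigidly, and \<open>x\<close> comes from the point \<open>x0\<close> at the same distance from
  \<open>b0\<close>. Labels that approach from above also cover the case \<open>\<eta> = 0\<close>, in which there is no quantile to
  the left of \<open>x\<close>.\<close>

lemma parabola_through_point:
  assumes "F t x < mass 0"
  shows "\<exists>x0. x = x0 + u 0 x0 * t + F t x / 4 * t\<^sup>2 \<and> u t x = u 0 x0 + F t x / 2 * t
    \<and> F t x \<le> F 0 x0 \<and> (\<forall>y<x0. F 0 y \<le> F t x)"
proof -
  define m where "m = mass 0"
  define \<eta> where "\<eta> = F t x"
  have \<eta>: "0 \<le> \<eta>" "\<eta> < m" using assms F_nonneg by (auto simp: \<eta>_def m_def)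
  define e where "e k = \<eta> + (m - \<eta>) / real (Suc (Suc k))" for k
  have e1: "\<eta> < e k" for k
    using \<eta> by (simp add: e_def)
  have e2: "e k < m" for k
  proof -
    have "(m - \<eta>) * 1 < (m - \<eta>) * real (Suc (Suc k))"
      using \<eta> by (intro mult_strict_left_mono) auto
    then have "(m - \<eta>) / real (Suc (Suc k)) < m - \<eta>"
      by (subst pos_divide_less_eq) auto
    then show ?thesis by (simp add: e_def)
  qed
  have ek: "0 < e k" "e k < mass 0" for k
    using e1[of k] e2[of k] \<eta> by (auto simp: m_def)
  have e_lim: "e \<longlonglongrightarrow> \<eta>"
  proof -
    have "(\<lambda>k. \<eta> + (m - \<eta>) / real (Suc (Suc k))) \<longlonglongrightarrow> \<eta> + 0"
      by (intro tendsto_add tendsto_const LIMSEQ_Suc[OF LIMSEQ_Suc[OF lim_const_over_n]])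
    then show ?thesis by (simp add: e_def[abs_def])
  qed
  define q where "q k = quantile (e k) 0" for k
  define y where "y k = quantile (e k) t" for k
  have y_eq: "y k = q k + u 0 (q k) * t + e k / 4 * t\<^sup>2" for k
    unfolding y_def q_def by (rule quantile_trajectory[OF ek])
  have uy: "u t (y k) = u 0 (q k) + e k / 2 * t" for k
    unfolding y_def q_def by (rule velocity_on_quantile[OF ek])
  have q_le: "q k \<le> z \<longleftrightarrow> e k \<le> F 0 z" for k z
    unfolding q_def by (rule quantile_le_iff[OF ek])
  have y_le: "y k \<le> z \<longleftrightarrow> e k \<le> F t z" for k z
    unfolding y_def by (rule quantile_le_iff[OF ek])
  have xy: "x < y k" for k
    using y_le[of k x] e1[of k] by (auto simp: \<eta>_def not_le[symmetric])
  define S where "S = {z. \<eta> < F 0 z}"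
  define b0 where "b0 = Inf S"
  have "eventually (\<lambda>z. \<eta> < F 0 z) at_top"
    using \<eta>(2) unfolding m_def by (rule order_tendstoD(1)[OF F_at_top])
  then have ne: "S \<noteq> {}"
    by (auto simp: S_def eventually_at_top_linorder)
  \<comment> \<open>The curves with labels \<open>e k\<close> are to the right of \<open>x\<close> at time \<open>t\<close>; their speed is bounded, so they
    cannot have started to the left of \<open>w0\<close>.\<close>
  define w0 where "w0 = x - norm (u 0) * \<bar>t\<bar> - m / 4 * t\<^sup>2"
  have q_low: "w0 < q k" for k
  proof -
    have "u 0 (q k) * t \<le> norm (u 0) * \<bar>t\<bar>"
      using u_bound[of 0 "q k"] by (metis abs_ge_self abs_ge_zero abs_mult mult_right_mono order_trans)
    moreover have "e k / 4 * t\<^sup>2 \<le> m / 4 * t\<^sup>2"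
      using e2[of k] by (intro mult_right_mono) auto
    ultimately show ?thesis
      using xy[of k] y_eq[of k] by (simp add: w0_def)
  qed
  have "F 0 w0 \<le> \<eta>"
  proof (rule tendsto_lowerbound[OF e_lim])
    show "eventually (\<lambda>k. F 0 w0 \<le> e k) sequentially"
      using q_low q_le by (intro always_eventually allI) (metis not_le less_imp_le)
  qed simp
  have bd: "bdd_below S"
  proof (rule bdd_belowI)
    fix z assume "z \<in> S"
    then have "F 0 w0 < F 0 z" using \<open>F 0 w0 \<le> \<eta>\<close> by (simp add: S_def)
    then show "w0 \<le> z" using F_mono[of z w0 0] by linarith
  qed
  have above: "\<eta> < F 0 z" if less: "b0 < z" for z
  proof -
    obtain z' where "z' \<in> S" "z' < z"
      using cInf_lessD[OF ne less[unfolded b0_def]] by blast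
    then show ?thesis using F_mono[of z' z 0] by (simp add: S_def)
  qed
  have below: "F 0 z \<le> \<eta>" if "z < b0" for z
  proof (rule ccontr)
    assume "\<not> F 0 z \<le> \<eta>"
    then have "b0 \<le> z" unfolding b0_def by (intro cInf_lower bd) (simp add: S_def)
    with that show False by simp
  qed
  have Fb0: "\<eta> \<le> F 0 b0"
  proof (rule tendsto_lowerbound[OF F_right])
    have "eventually (\<lambda>z. \<eta> < F 0 z) (at_right b0)"
      using eventually_at_right_less by (rule eventually_mono) (rule above)
    then show "eventually (\<lambda>z. \<eta> \<le> F 0 z) (at_right b0)"
      by (rule eventually_mono) simp
  qed simp
  have q_lim: "q \<longlonglongrightarrow> b0"
  proof (rule order_tendstoI)
    fix z assume "z < b0"
    have "b0 \<le> q k" for k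
    proof -
      have "e k \<le> F 0 (q k)" using q_le[of k "q k"] by simp
      then have "\<eta> < F 0 (q k)" using e1[of k] by simp
      then show ?thesis unfolding b0_def by (intro cInf_lower bd) (simp add: S_def)
    qed
    then show "eventually (\<lambda>k. z < q k) sequentially"
      using \<open>z < b0\<close> by (intro always_eventually allI) (rule less_le_trans)
  next
    fix z assume "b0 < z"
    then obtain z' where z': "b0 < z'" "z' < z" using dense by blast
    have "eventually (\<lambda>k. e k < F 0 z') sequentially"
      by (rule order_tendstoD(2)[OF e_lim above[OF z'(1)]])
    then show "eventually (\<lambda>k. q k < z) sequentially"
    proof eventually_elim
      case (elim k)
      then have "q k \<le> z'" by (simp add: q_le)
      with z' show ?case by simp
    qed
  qed
  define b where "b = b0 + u 0 b0 * t + \<eta> / 4 * t\<^sup>2"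
  have uq: "(\<lambda>k. u 0 (q k)) \<longlonglongrightarrow> u 0 b0"
    by (rule isCont_tendsto_compose[OF isCont_u q_lim])
  have y_lim: "y \<longlonglongrightarrow> b"
    unfolding y_eq[abs_def] b_def
    by (intro tendsto_add tendsto_mult tendsto_divide tendsto_const q_lim uq e_lim) simp
  have ub: "u t b = u 0 b0 + \<eta> / 2 * t"
  proof (rule LIMSEQ_unique[OF isCont_tendsto_compose[OF isCont_u y_lim]])
    show "(\<lambda>k. u t (y k)) \<longlonglongrightarrow> u 0 b0 + \<eta> / 2 * t"
      unfolding uy by (intro tendsto_add tendsto_mult tendsto_divide tendsto_const uq e_lim) simp
  qed
  have xb: "x \<le> b"
    by (rule LIMSEQ_le_const[OF y_lim]) (use xy in \<open>auto intro: less_imp_le\<close>)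
  have below_t: "F t z \<le> \<eta>" if "z < b" for z
  proof (rule tendsto_lowerbound[OF e_lim])
    have "eventually (\<lambda>k. z < y k) sequentially"
      by (rule order_tendstoD(1)[OF y_lim that])
    then show "eventually (\<lambda>k. F t z \<le> e k) sequentially"
    proof eventually_elim
      case (elim k)
      then show ?case using y_le[of k z] by linarith
    qed
  qed simp
  have ux: "u t x = u 0 b0 + \<eta> / 2 * t"
    using u_constant_on_gap[OF xb] below_t ub by (simp add: \<eta>_def)
  define x0 where "x0 = b0 - (b - x)"
  have x0b0: "x0 \<le> b0" using xb by (simp add: x0_def)
  have Fx0: "\<eta> \<le> F 0 x0"
  proof (cases "\<eta> = 0")
    case True
    then show ?thesis by (simp add: F_nonneg)
  next
    case False
    then have \<eta>': "0 < \<eta>" "\<eta> < mass 0" using \<eta> by (auto simp: m_def)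
    define a0 where "a0 = quantile \<eta> 0"
    have a0: "a0 \<le> z \<longleftrightarrow> \<eta> \<le> F 0 z" for z
      unfolding a0_def by (rule quantile_le_iff[OF \<eta>'])
    have "u 0 a0 = u 0 b0"
    proof (rule u_constant_on_gap)
      show "a0 \<le> b0" using Fb0 by (simp add: a0)
      show "F 0 z \<le> F 0 a0" if "z < b0" for z
        using below[OF that] a0[of a0] by simp
    qed
    then have "quantile \<eta> t = a0 + (b - b0)"
      using quantile_trajectory[OF \<eta>', of t] by (simp add: a0_def b_def)
    moreover have "quantile \<eta> t \<le> x"
      unfolding quantile_le_iff[OF \<eta>'] by (simp add: \<eta>_def)
    ultimately have "a0 \<le> x0" by (simp add: x0_def)
    then show ?thesis by (simp add: a0)
  qed
  have u0: "u 0 x0 = u 0 b0"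
    by (rule u_constant_on_gap[OF x0b0]) (use below Fx0 in \<open>auto intro: order_trans\<close>)
  have "x = x0 + u 0 x0 * t + \<eta> / 4 * t\<^sup>2"
    unfolding u0 by (simp add: x0_def b_def)
  moreover have "u t x = u 0 x0 + \<eta> / 2 * t"
    by (simp add: u0 ux)
  moreover have "\<forall>y<x0. F 0 y \<le> \<eta>"
    using below x0b0 by auto
  ultimately show ?thesis
    using Fx0 unfolding \<eta>_def by blast
qed

text \<open>Every particle of positive label accelerates to the right and eventually passes \<open>x\<close>.\<close>

lemma F_vanishes:
  assumes "0 < mass 0"
  shows "((\<lambda>t. F t x) \<longlongrightarrow> 0) at_top"
proof (rule order_tendstoI)
  fix e :: real assume "e < 0"
  then show "eventually (\<lambda>t. e < F t x) at_top"
    using F_nonneg by (intro always_eventually allI) (rule less_le_trans)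
next
  fix e :: real assume e: "0 < e"
  define \<eta> where "\<eta> = min e (mass 0 / 2)"
  have \<eta>: "0 < \<eta>" "\<eta> < mass 0" "\<eta> \<le> e"
    using e assms by (auto simp: \<eta>_def min_def)
  define q where "q = quantile \<eta> 0"
  define v where "v = u 0 q"
  \<comment> \<open>For \<open>t\<close> beyond \<open>4 c / \<eta>\<close> the accelerated term \<open>\<eta> / 4 t\<^sup>2\<close> exceeds \<open>c t\<close>, which outweighs the
    initial position and velocity.\<close>
  define c where "c = \<bar>v\<bar> + 1 + \<bar>x\<bar> + \<bar>q\<bar>"
  have "eventually (\<lambda>t. max 1 (4 * c / \<eta>) \<le> t) at_top"
    by (rule eventually_ge_at_top)
  then show "eventually (\<lambda>t. F t x < e) at_top"
  proof eventually_elim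
    case (elim t)
    then have t: "1 \<le> t" "c \<le> \<eta> / 4 * t" using \<eta>(1) by (auto simp: field_simps)
    have "c * t \<le> \<eta> / 4 * t * t" using t by (intro mult_right_mono) auto
    moreover have "1 + \<bar>x\<bar> + \<bar>q\<bar> \<le> (1 + \<bar>x\<bar> + \<bar>q\<bar>) * t"
      using mult_left_mono[OF t(1), of "1 + \<bar>x\<bar> + \<bar>q\<bar>"] by simp
    moreover have "- (\<bar>v\<bar> * t) \<le> v * t"
      using t(1) mult_right_mono[of "- \<bar>v\<bar>" v t] by simp
    moreover have "c * t = \<bar>v\<bar> * t + (1 + \<bar>x\<bar> + \<bar>q\<bar>) * t"
      by (simp add: c_def algebra_simps)
    ultimately have "x < q + v * t + \<eta> / 4 * t * t"
      by linarith
    then have "x < quantile \<eta> t"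
      using quantile_trajectory[OF \<eta>(1,2), of t] by (simp add: q_def v_def power2_eq_square)
    then have "F t x < \<eta>"
      using quantile_le_iff[OF \<eta>(1,2), of t x] by linarith
    with \<eta>(3) show ?case by simp
  qed
qed

lemma orbit_through_point:
  assumes m: "0 < mass 0"
  shows "\<exists>C X. hs_orbit x C (norm (u 0)) (u 0) (F 0) X (\<lambda>t. F t x) (\<lambda>t. u t x)"
proof -
  have "eventually (\<lambda>t. F t x < mass 0) at_top"
    by (rule order_tendstoD(2)[OF F_vanishes[OF m] m])
  moreover have "\<forall>t. \<exists>x0. F t x < mass 0 \<longrightarrow> x = x0 + u 0 x0 * t + F t x / 4 * t\<^sup>2
      \<and> u t x = u 0 x0 + F t x / 2 * t \<and> F t x \<le> F 0 x0 \<and> (\<forall>y<x0. F 0 y \<le> F t x)"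
    using parabola_through_point by blast
  then obtain X where X: "\<And>t. F t x < mass 0 \<Longrightarrow> x = X t + u 0 (X t) * t + F t x / 4 * t\<^sup>2
      \<and> u t x = u 0 (X t) + F t x / 2 * t \<and> F t x \<le> F 0 (X t) \<and> (\<forall>y<X t. F 0 y \<le> F t x)"
    by metis
  have "eventually (\<lambda>y. 0 < F 0 y) at_top"
    by (rule order_tendstoD(1)[OF F_at_top m])
  then obtain C where C: "0 < F 0 C"
    by (auto simp: eventually_at_top_linorder)
  have ev: "eventually (\<lambda>t. F t x < mass 0) at_top" by fact
  have "hs_orbit x C (norm (u 0)) (u 0) (F 0) X (\<lambda>t. F t x) (\<lambda>t. u t x)"
  proof
    show "eventually (\<lambda>t. x = X t + u 0 (X t) * t + F t x / 4 * t\<^sup>2) at_top"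
      using ev by (rule eventually_mono) (use X in blast)
    show "eventually (\<lambda>t. u t x = u 0 (X t) + F t x / 2 * t) at_top"
      using ev by (rule eventually_mono) (use X in blast)
    show "eventually (\<lambda>t. F t x \<le> F 0 (X t)) at_top"
      using ev by (rule eventually_mono) (use X in blast)
    show "eventually (\<lambda>t. \<forall>y<X t. F 0 y \<le> F t x) at_top"
      using ev by (rule eventually_mono) (use X in blast)
  qed (rule F_nonneg F_vanishes[OF m] u_bound C)+
  then show ?thesis by blast
qed

end

section \<open>Long-time behaviour along an orbit\<close>

lemma tendsto_sqrt_of_square:
  fixes f g :: "real \<Rightarrow> real"
  assumes sq: "((\<lambda>t. (f t)\<^sup>2) \<longlongrightarrow> c) at_top"
    and low: "eventually (\<lambda>t. - g t \<le> f t) at_top" and g: "(g \<longlongrightarrow> 0) at_top"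
    and g0: "eventually (\<lambda>t. 0 \<le> g t) at_top"
  shows "(f \<longlongrightarrow> sqrt c) at_top"
proof (rule tendsto_sandwich)
  have abs: "((\<lambda>t. \<bar>f t\<bar>) \<longlongrightarrow> sqrt c) at_top"
    using tendsto_real_sqrt[OF sq] by simp
  from tendsto_diff[OF abs tendsto_mult[OF tendsto_const g, of 2]]
  show "((\<lambda>t. \<bar>f t\<bar> - 2 * g t) \<longlongrightarrow> sqrt c) at_top" by simp
  show "((\<lambda>t. \<bar>f t\<bar>) \<longlongrightarrow> sqrt c) at_top" by fact
  show "eventually (\<lambda>t. \<bar>f t\<bar> - 2 * g t \<le> f t) at_top"
    using low g0 by eventually_elim linarith
  show "eventually (\<lambda>t. f t \<le> \<bar>f t\<bar>) at_top"
    by (intro always_eventually allI abs_ge_self)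
qed

context hs_orbit
begin

text \<open>The label tends to zero, and it bounds the mass to the left of \<open>X t\<close>; so \<open>X t\<close> cannot stay to
  the right of any positive initial mass.\<close>

lemma label_below: "F0 z > 0 \<Longrightarrow> eventually (\<lambda>t. X t \<le> z) at_top"
proof -
  assume "F0 z > 0"
  from order_tendstoD(2)[OF label_lim this] label_lower
  show ?thesis
  proof eventually_elim
    case (elim t)
    then show ?case by (meson not_le)
  qed
qed

text \<open>Eliminating \<open>t\<close> between position and velocity, as for motion with constant acceleration. The
  limits below start from this identity.\<close>

lemma energy_identity:
  "eventually (\<lambda>t. (U t)\<^sup>2 = (w (X t))\<^sup>2 + E t * (x - X t)) at_top"
  using position velocity
proof eventually_elim
  case (elim t)
  from elim(1) have "x - X t = w (X t) * t + E t / 4 * t\<^sup>2" by linarith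
  then show ?case
    unfolding elim(2) by (simp add: power2_eq_square algebra_simps)
qed

definition lag :: "real \<Rightarrow> real" where "lag t = \<bar>x - C\<bar> / t"

lemma lag_tendsto: "(lag \<longlongrightarrow> 0) at_top"
  unfolding lag_def[abs_def]
  by (intro real_tendsto_divide_at_top[OF tendsto_const] filterlim_ident)

lemma lag_nonneg: "eventually (\<lambda>t. 0 \<le> lag t) at_top"
  using eventually_gt_at_top[of 0] by eventually_elim (simp add: lag_def)

text \<open>The identity for \<open>(U t)\<^sup>2\<close> leaves the sign of \<open>U t\<close> open. The mean velocity of the particle is at least
  \<open>- lag t\<close>, since it starts to the left of \<open>C\<close> and ends at \<open>x\<close>, and its final velocity is no smaller
  than its mean velocity.\<close>

lemma U_lower: "eventually (\<lambda>t. - lag t \<le> U t) at_top"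
  using position velocity label_below[OF C_pos] eventually_gt_at_top[of 0]
proof eventually_elim
  case (elim t)
  have "t * (w (X t) + E t / 4 * t) = x - X t"
    using elim(1) by (simp add: power2_eq_square algebra_simps)
  also have "\<dots> \<ge> - \<bar>x - C\<bar>" using elim(3) by linarith
  finally have "- lag t \<le> w (X t) + E t / 4 * t"
    using elim(4) by (simp add: lag_def field_simps)
  moreover have "0 \<le> E t / 4 * t"
    using label_nonneg[of t] elim(4) by simp
  ultimately show ?case unfolding elim(2) by simp
qed

lemma velocity_limit:
  assumes W: "((\<lambda>t. w (X t)) \<longlongrightarrow> L) at_top" and EX: "((\<lambda>t. E t * (x - X t)) \<longlongrightarrow> A) at_top"
  shows "(U \<longlongrightarrow> sqrt (L\<^sup>2 + A)) at_top"
proof (rule tendsto_sqrt_of_square[OF _ U_lower lag_tendsto lag_nonneg])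
  have "((\<lambda>t. (w (X t))\<^sup>2 + E t * (x - X t)) \<longlongrightarrow> L\<^sup>2 + A) at_top"
    by (intro tendsto_add tendsto_power W EX)
  moreover have "eventually (\<lambda>t. (w (X t))\<^sup>2 + E t * (x - X t) = (U t)\<^sup>2) at_top"
    using energy_identity by eventually_elim simp
  ultimately show "((\<lambda>t. (U t)\<^sup>2) \<longlongrightarrow> L\<^sup>2 + A) at_top"
    by (rule Lim_transform_eventually)
qed

lemma bounded_part: "eventually (\<lambda>t. \<bar>(w (X t))\<^sup>2 + E t * x\<bar> \<le> K\<^sup>2 + \<bar>x\<bar>) at_top"
  using order_tendstoD(2)[OF label_lim zero_less_one]
proof eventually_elim
  case (elim t)
  have "\<bar>w (X t)\<bar>\<^sup>2 \<le> K\<^sup>2"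
    by (rule power_mono[OF w_bound]) simp
  moreover have "\<bar>E t * x\<bar> \<le> 1 * \<bar>x\<bar>"
    unfolding abs_mult using elim label_nonneg[of t] by (intro mult_right_mono) auto
  moreover have "0 \<le> (w (X t))\<^sup>2" by simp
  ultimately show ?case
    unfolding power2_abs by linarith
qed

lemma label_at_bot:
  assumes "\<And>z. F0 z > 0"
  shows "filterlim X at_bot at_top"
  unfolding filterlim_at_bot using label_below[OF assms] by blast

text \<open>A particle that starts to the left of the support has label 0; the others start close to its edge
  \<open>l\<close>. In both cases the product of label and displacement vanishes in the limit.\<close>

lemma velocity_limit_finite_support:
  assumes below: "\<And>y. y < l \<Longrightarrow> F0 y = 0" and above: "\<And>y. l < y \<Longrightarrow> F0 y > 0"
    and w: "\<And>y. y \<le> l \<Longrightarrow> w y = L" and cont: "isCont w l"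
  shows "(U \<longlongrightarrow> \<bar>L\<bar>) at_top"
proof -
  have "((\<lambda>t. w (X t)) \<longlongrightarrow> L) at_top"
  proof (rule tendstoI)
    fix e :: real assume e: "e > 0"
    then obtain d where d: "d > 0" "\<And>y. dist y l < d \<Longrightarrow> dist (w y) (w l) < e"
      using cont unfolding continuous_at_eps_delta by blast
    have "F0 (l + d / 2) > 0" using d(1) by (intro above) simp
    from label_below[OF this] show "eventually (\<lambda>t. dist (w (X t)) L < e) at_top"
    proof eventually_elim
      case (elim t)
      show ?case
      proof (cases "X t \<le> l")
        case True
        then show ?thesis using w e by simp
      next
        case False
        then have "dist (X t) l < d" using elim d(1) by (simp add: dist_real_def)
        then show ?thesis using d(2) w[of l] by simp
      qed
    qed
  qed
  moreover have "((\<lambda>t. E t * (x - X t)) \<longlongrightarrow> 0) at_top"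
  proof (rule Lim_null_comparison)
    have "((\<lambda>t. E t * (\<bar>x\<bar> + \<bar>l\<bar> + 1)) \<longlongrightarrow> 0 * (\<bar>x\<bar> + \<bar>l\<bar> + 1)) at_top"
      by (intro tendsto_mult label_lim tendsto_const)
    then show "((\<lambda>t. E t * (\<bar>x\<bar> + \<bar>l\<bar> + 1)) \<longlongrightarrow> 0) at_top" by simp
    have "F0 (l + 1) > 0" by (rule above) simp
    from label_below[OF this] label_upper
    show "eventually (\<lambda>t. norm (E t * (x - X t)) \<le> E t * (\<bar>x\<bar> + \<bar>l\<bar> + 1)) at_top"
    proof eventually_elim
      case (elim t)
      show ?case
      proof (cases "X t < l")
        case True
        then have "E t = 0" using below elim(2) label_nonneg[of t] by force
        then show ?thesis by simp
      next
        case False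
        then have "\<bar>x - X t\<bar> \<le> \<bar>x\<bar> + \<bar>l\<bar> + 1" using elim(1) by linarith
        then show ?thesis
          using label_nonneg[of t] by (simp add: abs_mult mult_left_mono)
      qed
    qed
  qed
  ultimately have "(U \<longlongrightarrow> sqrt (L\<^sup>2 + 0)) at_top"
    by (rule velocity_limit)
  then show ?thesis by simp
qed

text \<open>\<open>E t\<close> lies between \<open>G (X t - 1)\<close> and \<open>G (X t + 1)\<close>, and a shift by 1 does not change the
  asymptotics of a power.\<close>

lemma scaled_label_tendsto:
  assumes tail: "((\<lambda>r. r powr p * G (- r)) \<longlongrightarrow> A) at_top"
    and G: "\<And>y. G y \<le> F0 y" "\<And>y. F0 y \<le> G (y + 1)"
    and X: "filterlim X at_bot at_top"
  shows "((\<lambda>t. (- X t) powr p * E t) \<longlongrightarrow> A) at_top"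
proof -
  have v: "filterlim (\<lambda>t. - X t) at_top at_top"
    using X by (simp add: filterlim_uminus_at_bot)
  have large: "eventually (\<lambda>t. 1 < - X t) at_top"
    by (rule filterlim_at_top_dense[THEN iffD1, OF v, rule_format])
  have shifted: "((\<lambda>t. (- X t) powr p * G (X t - s)) \<longlongrightarrow> A) at_top" if s: "\<bar>s\<bar> \<le> 1" for s
  proof -
    have vs: "filterlim (\<lambda>t. - X t + s) at_top at_top"
      using filterlim_tendsto_add_at_top[OF tendsto_const v, of s] by (simp add: add.commute)
    have "((\<lambda>t. 1 - s / (- X t + s)) \<longlongrightarrow> 1 - 0) at_top"
      by (intro tendsto_diff tendsto_const real_tendsto_divide_at_top[OF tendsto_const vs])
    then have "((\<lambda>t. (1 - s / (- X t + s)) powr p) \<longlongrightarrow> (1 - 0) powr p) at_top"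
      by (rule tendsto_powr[OF _ tendsto_const]) simp
    from tendsto_mult[OF this filterlim_compose[OF tail vs]]
    have "((\<lambda>t. (1 - s / (- X t + s)) powr p * ((- X t + s) powr p * G (- (- X t + s)))) \<longlongrightarrow> A) at_top"
      by simp
    moreover have "eventually (\<lambda>t. (1 - s / (- X t + s)) powr p * ((- X t + s) powr p * G (- (- X t + s)))
        = (- X t) powr p * G (X t - s)) at_top"
      using large
    proof eventually_elim
      case (elim t)
      have pos: "0 < - X t + s" using elim s by linarith
      then have eq: "1 - s / (- X t + s) = (- X t) / (- X t + s)"
        by (simp add: field_simps)
      have "((- X t) / (- X t + s)) powr p * (- X t + s) powr p
          = ((- X t) / (- X t + s) * (- X t + s)) powr p"
        by (rule powr_mult[symmetric]; use pos elim in simp)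
      also have "(- X t) / (- X t + s) * (- X t + s) = - X t"
        using pos by simp
      finally show ?case
        unfolding eq by (simp add: mult.assoc[symmetric])
    qed
    ultimately show ?thesis by (rule Lim_transform_eventually)
  qed
  show ?thesis
  proof (rule tendsto_sandwich[OF _ _ shifted[of 1] shifted[of "-1"]])
    show "eventually (\<lambda>t. (- X t) powr p * E t \<le> (- X t) powr p * G (X t - - 1)) at_top"
      using label_upper
    proof eventually_elim
      case (elim t)
      then show ?case using G(2)[of "X t"] by (intro mult_left_mono) auto
    qed
    show "eventually (\<lambda>t. (- X t) powr p * G (X t - 1) \<le> (- X t) powr p * E t) at_top"
      using label_lower
    proof eventually_elim
      case (elim t)
      then have "F0 (X t - 1) \<le> E t" by simp
      then show ?case using G(1)[of "X t - 1"] by (intro mult_left_mono) auto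
    qed
  qed auto
qed

lemma velocity_limit_linear_tail:
  assumes tail: "((\<lambda>t. (- X t) powr 1 * E t) \<longlongrightarrow> A) at_top" and X: "filterlim X at_bot at_top"
    and L: "(w \<longlongrightarrow> L) at_bot"
  shows "(U \<longlongrightarrow> sqrt (L\<^sup>2 + A)) at_top"
proof (rule velocity_limit)
  show "((\<lambda>t. w (X t)) \<longlongrightarrow> L) at_top" by (rule filterlim_compose[OF L X])
  have "((\<lambda>t. E t * x + (- X t) powr 1 * E t) \<longlongrightarrow> 0 * x + A) at_top"
    by (intro tendsto_add tendsto_mult label_lim tendsto_const tail)
  moreover have "eventually (\<lambda>t. E t * x + (- X t) powr 1 * E t = E t * (x - X t)) at_top"
  proof -
    have "eventually (\<lambda>t. X t < 0) at_top"
      using X by (simp add: filterlim_at_bot_dense)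
    then show ?thesis by eventually_elim (simp add: algebra_simps)
  qed
  ultimately show "((\<lambda>t. E t * (x - X t)) \<longlongrightarrow> A) at_top"
    using Lim_transform_eventually by fastforce
qed

end

lemma powr_at_top:
  fixes s :: real
  assumes "0 < s"
  shows "filterlim (\<lambda>x. x powr s) at_top at_top"
proof -
  have "filterlim (\<lambda>x. exp (s * ln x)) at_top at_top"
    by (intro filterlim_compose[OF exp_at_top] filterlim_tendsto_pos_mult_at_top[OF tendsto_const assms]
        ln_at_top)
  moreover have "eventually (\<lambda>x::real. exp (s * ln x) = x powr s) at_top"
    using eventually_gt_at_top[of 0] by eventually_elim (simp add: powr_def)
  ultimately show ?thesis
    by (simp cong: filterlim_cong)
qed

text \<open>The identity is multiplicative in \<open>U\<close>, \<open>D\<close>, \<open>e\<close> and \<open>v\<close>: compare logarithms. It expresses the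
  growth rate through factors that have limits, namely the scaled label and two ratios that tend
  to 1.\<close>

lemma growth_rate_identity:
  fixes U D e v :: real
  assumes pos: "0 < U" "0 < D" "0 < e" "0 < v" and \<theta>: "0 < \<theta>"
  shows "U / (2 * D / e) powr \<theta> = 2 powr (- \<theta>) * (v powr ((1 - \<theta>) / (1 + \<theta>)) * e) powr ((1 + \<theta>) / 2)
    * (U\<^sup>2 / (e * v)) powr ((1 - \<theta>) / 2) * (U / D) powr \<theta>"
proof -
  have "(1 + \<theta>) / 2 * ((1 - \<theta>) / (1 + \<theta>)) = (1 - \<theta>) / 2"
    using \<theta> by (simp add: field_simps)
  then have k: "(1 + \<theta>) / 2 * ((1 - \<theta>) / (1 + \<theta>) * ln v + ln e) = (1 - \<theta>) / 2 * ln v + (1 + \<theta>) / 2 * ln e"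
    by (simp only: distrib_left mult.assoc[symmetric])
  have "ln (U / (2 * D / e) powr \<theta>) = ln U - \<theta> * (ln 2 + ln D - ln e)"
    using pos by (simp add: ln_div ln_mult)
  moreover have "ln (2 powr (- \<theta>) * (v powr ((1 - \<theta>) / (1 + \<theta>)) * e) powr ((1 + \<theta>) / 2)
      * (U\<^sup>2 / (e * v)) powr ((1 - \<theta>) / 2) * (U / D) powr \<theta>)
    = - \<theta> * ln 2 + ((1 - \<theta>) / 2 * ln v + (1 + \<theta>) / 2 * ln e)
      + (1 - \<theta>) / 2 * (2 * ln U - (ln e + ln v)) + \<theta> * (ln U - ln D)"
    unfolding k[symmetric] using pos by (simp add: ln_div ln_mult ln_realpow)
  moreover have "ln U - \<theta> * (ln 2 + ln D - ln e)
    = - \<theta> * ln 2 + ((1 - \<theta>) / 2 * ln v + (1 + \<theta>) / 2 * ln e)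
      + (1 - \<theta>) / 2 * (2 * ln U - (ln e + ln v)) + \<theta> * (ln U - ln D)"
    by (simp add: field_simps)
  ultimately have "ln (U / (2 * D / e) powr \<theta>) = ln (2 powr (- \<theta>)
      * (v powr ((1 - \<theta>) / (1 + \<theta>)) * e) powr ((1 + \<theta>) / 2)
      * (U\<^sup>2 / (e * v)) powr ((1 - \<theta>) / 2) * (U / D) powr \<theta>)"
    by simp
  then show ?thesis
    by (subst (asm) ln_inj_iff) (use pos in auto)
qed

context hs_orbit
begin

text \<open>The scaled label \<open>Q t\<close> has a positive limit and \<open>p < 1\<close>, so the product of the label with the
  distance \<open>v t\<close> tends to infinity and dominates \<open>(U t)\<^sup>2\<close>. Time is recovered from the velocity
  gain: \<open>t = 2 (U t - w (X t)) / E t\<close>.\<close>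

lemma growth_positive_tail:
  assumes \<theta>: "0 < \<theta>" "\<theta> < 1" and A: "A > 0"
    and Q: "((\<lambda>t. (- X t) powr ((1 - \<theta>) / (1 + \<theta>)) * E t) \<longlongrightarrow> A) at_top"
    and X: "filterlim X at_bot at_top"
  shows "((\<lambda>t. U t / t powr \<theta>) \<longlongrightarrow> 2 * (A / 4) powr ((1 + \<theta>) / 2)) at_top"
proof -
  define p where "p = (1 - \<theta>) / (1 + \<theta>)"
  have p: "0 < p" "p < 1" using \<theta> by (auto simp: p_def)
  define v where "v t = - X t" for t
  define Q where "Q t = v t powr p * E t" for t
  have v: "filterlim v at_top at_top"
    using X by (simp add: v_def[abs_def] filterlim_uminus_at_bot)
  have vpos: "eventually (\<lambda>t. 0 < v t) at_top"
    using v by (simp add: filterlim_at_top_dense)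
  have Q: "(Q \<longlongrightarrow> A) at_top"
    using Q by (simp add: Q_def[abs_def] v_def p_def)
  have Epos: "eventually (\<lambda>t. 0 < E t) at_top"
    using order_tendstoD(1)[OF Q A] by eventually_elim (simp add: Q_def zero_less_mult_iff)
  have "filterlim (\<lambda>t. Q t * v t powr (1 - p)) at_top at_top"
    by (intro filterlim_tendsto_pos_mult_at_top[OF Q A] filterlim_compose[OF powr_at_top v])
      (use p in simp)
  moreover have "eventually (\<lambda>t. Q t * v t powr (1 - p) = E t * v t) at_top"
    using vpos by eventually_elim (simp add: Q_def powr_diff)
  ultimately have Ev: "filterlim (\<lambda>t. E t * v t) at_top at_top"
    by (simp cong: filterlim_cong)
  define rest where "rest t = (w (X t))\<^sup>2 + E t * x" for t
  note rest_bound = bounded_part[folded rest_def]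
  have ratio: "((\<lambda>t. rest t / (E t * v t)) \<longlongrightarrow> 0) at_top"
  proof (rule Lim_null_comparison)
    show "((\<lambda>t. (K\<^sup>2 + \<bar>x\<bar>) / (E t * v t)) \<longlongrightarrow> 0) at_top"
      by (rule real_tendsto_divide_at_top[OF tendsto_const Ev])
    show "eventually (\<lambda>t. norm (rest t / (E t * v t)) \<le> (K\<^sup>2 + \<bar>x\<bar>) / (E t * v t)) at_top"
      using rest_bound Epos vpos
      by eventually_elim (simp add: abs_mult divide_right_mono)
  qed
  have Usq: "eventually (\<lambda>t. (U t)\<^sup>2 = rest t + E t * v t) at_top"
    using energy_identity by eventually_elim (simp add: rest_def v_def algebra_simps)
  have S: "((\<lambda>t. (U t)\<^sup>2 / (E t * v t)) \<longlongrightarrow> 1) at_top"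
  proof (rule Lim_transform_eventually)
    show "((\<lambda>t. 1 + rest t / (E t * v t)) \<longlongrightarrow> 1) at_top"
      using tendsto_add[OF tendsto_const ratio, of 1] by simp
    show "eventually (\<lambda>t. 1 + rest t / (E t * v t) = (U t)\<^sup>2 / (E t * v t)) at_top"
      using Usq Epos vpos by eventually_elim (simp add: field_simps)
  qed
  have "filterlim (\<lambda>t. (U t)\<^sup>2 / (E t * v t) * (E t * v t)) at_top at_top"
    by (rule filterlim_tendsto_pos_mult_at_top[OF S _ Ev]) simp
  moreover have "eventually (\<lambda>t. (U t)\<^sup>2 / (E t * v t) * (E t * v t) = (U t)\<^sup>2) at_top"
    using Epos vpos by eventually_elim simp
  ultimately have sq_top: "filterlim (\<lambda>t. (U t)\<^sup>2) at_top at_top"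
    by (simp cong: filterlim_cong)
  then have "eventually (\<lambda>t. 1 < (U t)\<^sup>2) at_top"
    by (simp add: filterlim_at_top_dense)
  moreover have "eventually (\<lambda>t. lag t < 1) at_top"
    by (rule order_tendstoD(2)[OF lag_tendsto]) simp
  ultimately have Upos: "eventually (\<lambda>t. 0 < U t) at_top"
    using U_lower
  proof eventually_elim
    case (elim t)
    show ?case
    proof (rule ccontr)
      assume "\<not> 0 < U t"
      with elim(2,3) have "\<bar>U t\<bar> \<le> 1" by linarith
      then have "(U t)\<^sup>2 \<le> 1" by (simp add: abs_square_le_1)
      with elim(1) show False by simp
    qed
  qed
  have U_top: "filterlim U at_top at_top"
  proof -
    have "filterlim (\<lambda>t. sqrt ((U t)\<^sup>2)) at_top at_top"
      by (rule filterlim_compose[OF sqrt_at_top sq_top])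
    moreover have "eventually (\<lambda>t. sqrt ((U t)\<^sup>2) = U t) at_top"
      using Upos by eventually_elim simp
    ultimately show ?thesis by (simp cong: filterlim_cong)
  qed
  define D where "D t = U t - w (X t)" for t
  have Dpos: "eventually (\<lambda>t. 0 < D t) at_top"
  proof -
    have "eventually (\<lambda>t. K < U t) at_top"
      using U_top by (simp add: filterlim_at_top_dense)
    then show ?thesis
    proof eventually_elim
      case (elim t)
      then show ?case using w_bound[of "X t"] by (simp add: D_def)
    qed
  qed
  have R: "((\<lambda>t. U t / D t) \<longlongrightarrow> 1) at_top"
  proof -
    have "((\<lambda>t. w (X t) / U t) \<longlongrightarrow> 0) at_top"
    proof (rule Lim_null_comparison)
      show "((\<lambda>t. K / U t) \<longlongrightarrow> 0) at_top"
        by (rule real_tendsto_divide_at_top[OF tendsto_const U_top])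
      show "eventually (\<lambda>t. norm (w (X t) / U t) \<le> K / U t) at_top"
        using Upos by eventually_elim (simp add: divide_right_mono w_bound)
    qed
    then have "((\<lambda>t. 1 / (1 - w (X t) / U t)) \<longlongrightarrow> 1 / (1 - 0)) at_top"
      by (intro tendsto_divide tendsto_diff tendsto_const) simp_all
    moreover have "eventually (\<lambda>t. 1 / (1 - w (X t) / U t) = U t / D t) at_top"
      using Upos Dpos by eventually_elim (simp add: D_def field_simps)
    ultimately show ?thesis
      using Lim_transform_eventually by fastforce
  qed
  have "((\<lambda>t. 2 powr (- \<theta>) * Q t powr ((1 + \<theta>) / 2)
      * ((U t)\<^sup>2 / (E t * v t)) powr ((1 - \<theta>) / 2) * (U t / D t) powr \<theta>)
    \<longlongrightarrow> 2 powr (- \<theta>) * A powr ((1 + \<theta>) / 2) * 1 powr ((1 - \<theta>) / 2) * 1 powr \<theta>) at_top"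
    using A by (intro tendsto_mult tendsto_const tendsto_powr Q S R) auto
  moreover have "eventually (\<lambda>t. 2 powr (- \<theta>) * Q t powr ((1 + \<theta>) / 2)
      * ((U t)\<^sup>2 / (E t * v t)) powr ((1 - \<theta>) / 2) * (U t / D t) powr \<theta> = U t / t powr \<theta>) at_top"
    using Upos Dpos Epos vpos velocity
  proof eventually_elim
    case (elim t)
    have "2 * D t / E t = t"
      using elim(3,5) by (simp add: D_def)
    then show ?case
      using growth_rate_identity[OF elim(1-4) \<theta>(1)] by (simp add: Q_def p_def)
  qed
  ultimately have "((\<lambda>t. U t / t powr \<theta>)
      \<longlongrightarrow> 2 powr (- \<theta>) * A powr ((1 + \<theta>) / 2) * 1 powr ((1 - \<theta>) / 2) * 1 powr \<theta>) at_top"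
    by (rule Lim_transform_eventually)
  also have "2 powr (- \<theta>) * A powr ((1 + \<theta>) / 2) * 1 powr ((1 - \<theta>) / 2) * 1 powr \<theta>
      = 2 * (A / 4) powr ((1 + \<theta>) / 2)"
  proof -
    have "(4::real) powr ((1 + \<theta>) / 2) = (2 powr 2) powr ((1 + \<theta>) / 2)"
      by simp
    also have "\<dots> = 2 powr (1 + \<theta>)"
    proof -
      have "2 * ((1 + \<theta>) / 2) = 1 + \<theta>" by simp
      then show ?thesis by (simp only: powr_powr)
    qed
    also have "\<dots> = 2 * 2 powr \<theta>"
      by (simp add: powr_add)
    finally show ?thesis
      using A by (simp add: powr_divide powr_minus field_simps)
  qed
  finally show ?thesis .
qed

text \<open>The distance \<open>v t\<close> is at most a linear term in \<open>t\<close>, due to the initial velocity, plus the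
  accelerated term \<open>E t t\<^sup>2 / 4\<close>. Whichever dominates, \<open>E t v t\<close> is bounded by a vanishing factor
  times \<open>t\<^bsup>2 \<theta>\<^esup>\<close>: in the second case \<open>v\<^bsup>1 + p\<^esup> \<le> Q t\<^sup>2\<close>, and \<open>(1 + p) \<theta> = 1 - p\<close>.\<close>

lemma growth_null_tail:
  assumes \<theta>: "0 < \<theta>" "\<theta> < 1"
    and Q: "((\<lambda>t. (- X t) powr ((1 - \<theta>) / (1 + \<theta>)) * E t) \<longlongrightarrow> 0) at_top"
    and X: "filterlim X at_bot at_top"
  shows "((\<lambda>t. U t / t powr \<theta>) \<longlongrightarrow> 0) at_top"
proof -
  define p where "p = (1 - \<theta>) / (1 + \<theta>)"
  have p: "0 < p" "p < 1" "1 - p \<le> 2 * \<theta>" "(1 + p) * \<theta> = 1 - p"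
    using \<theta> by (auto simp: p_def field_simps)
  define v where "v t = - X t" for t
  define Q where "Q t = v t powr p * E t" for t
  define K1 where "K1 = K + \<bar>x\<bar>"
  have K: "0 \<le> K" using w_bound[of 0] by linarith
  have v: "filterlim v at_top at_top"
    using X by (simp add: v_def[abs_def] filterlim_uminus_at_bot)
  have vpos: "eventually (\<lambda>t. 0 < v t) at_top"
    using v by (simp add: filterlim_at_top_dense)
  have Q: "(Q \<longlongrightarrow> 0) at_top"
    using Q by (simp add: Q_def[abs_def] v_def p_def)
  have Q0: "0 \<le> Q t" for t
    using label_nonneg[of t] by (simp add: Q_def)
  have main: "eventually (\<lambda>t. E t * v t \<le> Q t * ((2 * K1) powr (1 - p) + Q t powr \<theta>) * t powr (2 * \<theta>)) at_top"
    using vpos position eventually_ge_at_top[of 1]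
  proof eventually_elim
    case (elim t)
    have t: "1 \<le> t" "0 < t" using elim(3) by auto
    have "v t = w (X t) * t + E t / 4 * t\<^sup>2 - x" using elim(2) by (simp add: v_def)
    also have "\<dots> \<le> K * t + E t / 4 * t\<^sup>2 + \<bar>x\<bar> * t"
    proof -
      have "w (X t) * t \<le> K * t" using w_bound[of "X t"] t by (intro mult_right_mono) auto
      moreover have "- x \<le> \<bar>x\<bar> * t" using mult_left_mono[OF t(1), of "\<bar>x\<bar>"] by linarith
      ultimately show ?thesis by linarith
    qed
    finally have vle: "v t \<le> K1 * t + E t / 4 * t\<^sup>2" by (simp add: K1_def algebra_simps)
    have "v t powr (1 - p) \<le> ((2 * K1) powr (1 - p) + Q t powr \<theta>) * t powr (2 * \<theta>)"
    proof (cases "v t \<le> 2 * K1 * t")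
      case True
      have "v t powr (1 - p) \<le> (2 * K1 * t) powr (1 - p)"
        using True elim(1) p by (intro powr_mono2) auto
      also have "\<dots> = (2 * K1) powr (1 - p) * t powr (1 - p)"
        using t K by (simp add: powr_mult K1_def)
      also have "\<dots> \<le> (2 * K1) powr (1 - p) * t powr (2 * \<theta>)"
        using t p by (intro mult_left_mono powr_mono) auto
      also have "\<dots> \<le> ((2 * K1) powr (1 - p) + Q t powr \<theta>) * t powr (2 * \<theta>)"
        by (intro mult_right_mono) auto
      finally show ?thesis .
    next
      case False
      then have "v t \<le> E t / 2 * t\<^sup>2" using vle by linarith
      also have "\<dots> \<le> E t * t\<^sup>2" using label_nonneg[of t] by (intro mult_right_mono) auto
      finally have "v t powr p * v t \<le> v t powr p * (E t * t\<^sup>2)" by (intro mult_left_mono) auto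
      also have "v t powr p * v t = v t powr (1 + p)" using elim(1) by (simp add: powr_add)
      finally have "v t powr (1 + p) \<le> Q t * t\<^sup>2" by (simp add: Q_def mult.assoc)
      then have "(v t powr (1 + p)) powr \<theta> \<le> (Q t * t\<^sup>2) powr \<theta>"
        using \<theta> by (intro powr_mono2) auto
      then have "v t powr (1 - p) \<le> Q t powr \<theta> * (t\<^sup>2) powr \<theta>"
        using Q0 by (simp add: powr_powr p powr_mult)
      also have "(t\<^sup>2) powr \<theta> = t powr (2 * \<theta>)"
      proof -
        have "t\<^sup>2 = t powr 2" using t by simp
        then show ?thesis by (simp only: powr_powr)
      qed
      also have "Q t powr \<theta> * t powr (2 * \<theta>) \<le> ((2 * K1) powr (1 - p) + Q t powr \<theta>) * t powr (2 * \<theta>)"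
        by (intro mult_right_mono) auto
      finally show ?thesis .
    qed
    then have "Q t * v t powr (1 - p) \<le> Q t * (((2 * K1) powr (1 - p) + Q t powr \<theta>) * t powr (2 * \<theta>))"
      using Q0 by (intro mult_left_mono)
    moreover have "Q t * v t powr (1 - p) = E t * v t"
      using elim(1) by (simp add: Q_def powr_diff)
    ultimately show ?case by (simp add: mult.assoc)
  qed
  define h where "h t = (K\<^sup>2 + \<bar>x\<bar>) * t powr (- (2 * \<theta>)) + Q t * ((2 * K1) powr (1 - p) + Q t powr \<theta>)" for t
  have "((\<lambda>t. t powr (- (2 * \<theta>))) \<longlongrightarrow> 0) at_top"
    by (rule tendsto_neg_powr) (use \<theta> in \<open>auto simp: filterlim_ident\<close>)
  moreover have "((\<lambda>t. Q t powr \<theta>) \<longlongrightarrow> 0) at_top"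
    by (rule tendsto_zero_powrI[OF Q tendsto_const]) (use Q0 \<theta> in auto)
  ultimately have "(h \<longlongrightarrow> (K\<^sup>2 + \<bar>x\<bar>) * 0 + 0 * ((2 * K1) powr (1 - p) + 0)) at_top"
    unfolding h_def[abs_def] by (intro tendsto_add tendsto_mult tendsto_const Q)
  then have h: "((\<lambda>t. sqrt (h t)) \<longlongrightarrow> 0) at_top"
    using tendsto_real_sqrt by fastforce
  show ?thesis
  proof (rule Lim_null_comparison[OF _ h])
    from main energy_identity eventually_ge_at_top[of 1] bounded_part
    show "eventually (\<lambda>t. norm (U t / t powr \<theta>) \<le> sqrt (h t)) at_top"
    proof eventually_elim
      case (elim t)
      have "(U t)\<^sup>2 = (w (X t))\<^sup>2 + E t * x + E t * v t"
        unfolding elim(2) by (simp add: v_def algebra_simps)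
      then have "(U t)\<^sup>2 \<le> (K\<^sup>2 + \<bar>x\<bar>) + Q t * ((2 * K1) powr (1 - p) + Q t powr \<theta>) * t powr (2 * \<theta>)"
        using elim(1,4) by linarith
      also have "\<dots> = h t * t powr (2 * \<theta>)"
      proof -
        have "t powr (- (2 * \<theta>)) * t powr (2 * \<theta>) = 1"
          using elim(3) by (simp add: powr_minus)
        then show ?thesis by (simp add: h_def distrib_right mult.assoc)
      qed
      finally have "(U t)\<^sup>2 / t powr (2 * \<theta>) \<le> h t"
        using elim(3) by (simp add: pos_divide_le_eq)
      moreover have "(U t / t powr \<theta>)\<^sup>2 = (U t)\<^sup>2 / t powr (2 * \<theta>)"
        by (simp add: power_divide power2_eq_square powr_add[symmetric])
      ultimately show ?case
        by (metis real_norm_def real_sqrt_abs real_sqrt_le_iff)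
    qed
  qed
qed

end

section \<open>The limits of the velocity\<close>

text \<open>Substitute \<open>r = \<bar>x\<bar>\<^bsup>1 + \<theta>\<^esup>\<close>.\<close>

lemma tail_in_distance:
  fixes G :: "real \<Rightarrow> real"
  assumes lim: "((\<lambda>x. \<bar>x\<bar> powr (1 - \<theta>) * G (- (\<bar>x\<bar> powr (1 + \<theta>)))) \<longlongrightarrow> A) at_bot" and \<theta>: "0 \<le> \<theta>"
  shows "((\<lambda>r. r powr ((1 - \<theta>) / (1 + \<theta>)) * G (- r)) \<longlongrightarrow> A) at_top"
proof -
  have "filterlim (\<lambda>r::real. - (r powr (1 / (1 + \<theta>)))) at_bot at_top"
    using powr_at_top[of "1 / (1 + \<theta>)"] \<theta> by (simp add: filterlim_uminus_at_bot)
  from filterlim_compose[OF lim this]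
  have "((\<lambda>r. (r powr (1 / (1 + \<theta>))) powr (1 - \<theta>) * G (- ((r powr (1 / (1 + \<theta>))) powr (1 + \<theta>)))) \<longlongrightarrow> A) at_top"
    by simp
  moreover have "eventually (\<lambda>r. (r powr (1 / (1 + \<theta>))) powr (1 - \<theta>) * G (- ((r powr (1 / (1 + \<theta>))) powr (1 + \<theta>)))
      = r powr ((1 - \<theta>) / (1 + \<theta>)) * G (- r)) at_top"
    using eventually_gt_at_top[of 0] by eventually_elim (use \<theta> in \<open>simp add: powr_powr\<close>)
  ultimately show ?thesis by (rule Lim_transform_eventually)
qed

text \<open>The complement of the support is a union of open null sets, of which countably many suffice by
  Lindelof's theorem.\<close>

lemma measure_below_support:
  assumes sets: "sets \<nu> = sets borel" and b: "\<And>z. z \<in> measure_support \<nu> \<Longrightarrow> b \<le> z" and y: "y < b"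
  shows "measure \<nu> {..y} = 0"
proof -
  define \<U> where "\<U> = {V. open V \<and> emeasure \<nu> V = 0}"
  have op: "open V" if "V \<in> \<U>" for V
    using that by (simp add: \<U>_def)
  obtain \<V> where \<V>: "\<V> \<subseteq> \<U>" "countable \<V>" "\<Union>\<V> = \<Union>\<U>"
    by (rule Lindelof[OF op])
  have "{..y} \<subseteq> \<Union>\<U>"
  proof
    fix z assume "z \<in> {..y}"
    then have "\<not> b \<le> z" using y by simp
    then have "z \<notin> measure_support \<nu>" using b by blast
    then obtain V where "open V" "z \<in> V" "\<not> 0 < emeasure \<nu> V"
      unfolding measure_support_def by blast
    then show "z \<in> \<Union>\<U>"
      unfolding \<U>_def by (auto simp: not_gr_zero)
  qed
  moreover have "(\<Union>V\<in>\<V>. V) \<in> null_sets \<nu>"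
  proof (rule null_sets_UN'[OF \<V>(2)])
    fix V assume "V \<in> \<V>"
    then have "V \<in> \<U>" using \<V>(1) by blast
    then show "V \<in> null_sets \<nu>"
      using sets by (simp add: \<U>_def null_sets_def)
  qed
  ultimately have "{..y} \<in> null_sets \<nu>"
    using \<V>(3) sets by (intro null_sets_subset[of "\<Union>\<V>" \<nu> "{..y}"]) simp_all
  then show ?thesis by (simp add: null_sets_def measure_def)
qed

context hs_flow
begin

lemma open_tail_bounds:
  "measure (\<mu> t) {..<y} \<le> F t y" "F t y \<le> measure (\<mu> t) {..<y + 1}"
  unfolding F_def by (auto intro!: finite_measure.finite_measure_mono[OF finite_\<mu>])

lemma initial_support_edge:
  assumes S: "measure_support (\<mu> 0) \<noteq> {}" "bdd_below (measure_support (\<mu> 0))"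
  shows "0 < mass 0" "\<exists>l. (\<forall>y<l. F 0 y = 0) \<and> (\<forall>y>l. 0 < F 0 y)"
proof -
  obtain s where "s \<in> measure_support (\<mu> 0)" using S(1) by blast
  then have "0 < emeasure (\<mu> 0) UNIV" unfolding measure_support_def by auto
  then show m: "0 < mass 0"
    unfolding mass_def using finite_measure.emeasure_eq_measure[OF finite_\<mu>[of 0]]
    by simp
  obtain b where b: "\<And>z. z \<in> measure_support (\<mu> 0) \<Longrightarrow> b \<le> z"
    using S(2) unfolding bdd_below_def by blast
  have zero: "F 0 y = 0" if "y < b" for y
    unfolding F_def by (rule measure_below_support[OF sets_\<mu> b that])
  define P where "P = {y. 0 < F 0 y}"
  have "eventually (\<lambda>y. 0 < F 0 y) at_top"
    by (rule order_tendstoD(1)[OF F_at_top m])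
  then have ne: "P \<noteq> {}" by (auto simp: P_def eventually_at_top_linorder)
  have bd: "bdd_below P"
  proof (rule bdd_belowI)
    fix y assume "y \<in> P"
    then show "b \<le> y" using zero[of y] by (force simp: P_def)
  qed
  have "F 0 y = 0" if "y < Inf P" for y
  proof (rule ccontr)
    assume "F 0 y \<noteq> 0"
    then have "y \<in> P" using F_nonneg[of 0 y] by (simp add: P_def)
    then have "Inf P \<le> y" by (rule cInf_lower[OF _ bd])
    with that show False by simp
  qed
  moreover have "0 < F 0 y" if less: "Inf P < y" for y
  proof -
    obtain z where "z \<in> P" "z < y" using cInf_lessD[OF ne less] by blast
    then show ?thesis using F_mono[of z y 0] by (simp add: P_def)
  qed
  ultimately show "\<exists>l. (\<forall>y<l. F 0 y = 0) \<and> (\<forall>y>l. 0 < F 0 y)" by blast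
qed

lemma limits_finite_support:
  assumes S: "measure_support (\<mu> 0) \<noteq> {}" "bdd_below (measure_support (\<mu> 0))"
    and L: "(apply_bcontfun (u 0) \<longlongrightarrow> L) at_bot"
  shows "((\<lambda>t. u t x) \<longlongrightarrow> \<bar>L\<bar>) at_top"
proof -
  obtain l where l: "\<And>y. y < l \<Longrightarrow> F 0 y = 0" "\<And>y. l < y \<Longrightarrow> 0 < F 0 y"
    using initial_support_edge(2)[OF S] by blast
  have const: "u 0 y = u 0 l" if "y \<le> l" for y
    by (rule u_constant_on_gap[OF that]) (simp add: l(1) F_nonneg)
  have "eventually (\<lambda>y. u 0 l = u 0 y) at_bot"
    using eventually_le_at_bot[of l] by eventually_elim (rule const[symmetric])
  from Lim_transform_eventually[OF tendsto_const this]
  have "L = u 0 l" by (rule tendsto_unique[OF trivial_limit_at_bot_linorder L])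
  obtain C X where "hs_orbit x C (norm (u 0)) (u 0) (F 0) X (\<lambda>t. F t x) (\<lambda>t. u t x)"
    using orbit_through_point[OF initial_support_edge(1)[OF S]] by blast
  then interpret hs_orbit x C "norm (u 0)" "u 0" "F 0" X "\<lambda>t. F t x" "\<lambda>t. u t x" .
  show ?thesis
    unfolding \<open>L = u 0 l\<close> by (rule velocity_limit_finite_support[OF l const isCont_u])
qed

lemma limits_infinite_support:
  assumes tail: "((\<lambda>r. r powr ((1 - \<theta>) / (1 + \<theta>)) * measure (\<mu> 0) {..< - r}) \<longlongrightarrow> A) at_top"
    and \<theta>: "0 \<le> \<theta>" "\<theta> < 1" and pos: "\<And>z. 0 < measure (\<mu> 0) {..<z}"
  shows "0 < \<theta> \<Longrightarrow> 0 < A \<Longrightarrow> ((\<lambda>t. u t x / t powr \<theta>) \<longlongrightarrow> 2 * (A / 4) powr ((1 + \<theta>) / 2)) at_top"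
    and "0 < \<theta> \<Longrightarrow> A = 0 \<Longrightarrow> ((\<lambda>t. u t x / t powr \<theta>) \<longlongrightarrow> 0) at_top"
    and "\<theta> = 0 \<Longrightarrow> (apply_bcontfun (u 0) \<longlongrightarrow> L) at_bot \<Longrightarrow>
      ((\<lambda>t. u t x) \<longlongrightarrow> sqrt (L\<^sup>2 + A)) at_top"
proof -
  have Fpos: "0 < F 0 z" for z
    using pos[of z] open_tail_bounds(1)[where t = 0 and y = z] by linarith
  have m: "0 < mass 0" using Fpos[of 0] F_le_mass[of 0 0] by linarith
  obtain C X where "hs_orbit x C (norm (u 0)) (u 0) (F 0) X (\<lambda>t. F t x) (\<lambda>t. u t x)"
    using orbit_through_point[OF m] by blast
  then interpret hs_orbit x C "norm (u 0)" "u 0" "F 0" X "\<lambda>t. F t x" "\<lambda>t. u t x" .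
  have X: "filterlim X at_bot at_top"
    by (rule label_at_bot[OF Fpos])
  have Q: "((\<lambda>t. (- X t) powr ((1 - \<theta>) / (1 + \<theta>)) * F t x) \<longlongrightarrow> A) at_top"
    by (rule scaled_label_tendsto[where G = "\<lambda>y. measure (\<mu> 0) {..<y}", OF tail open_tail_bounds X])
  show "((\<lambda>t. u t x / t powr \<theta>) \<longlongrightarrow> 2 * (A / 4) powr ((1 + \<theta>) / 2)) at_top" if "0 < \<theta>" "0 < A"
    by (rule growth_positive_tail[OF that(1) \<theta>(2) that(2) Q X])
  show "((\<lambda>t. u t x / t powr \<theta>) \<longlongrightarrow> 0) at_top" if "0 < \<theta>" "A = 0"
    by (rule growth_null_tail[OF that(1) \<theta>(2) Q[unfolded that(2)] X])
  show "((\<lambda>t. u t x) \<longlongrightarrow> sqrt (L\<^sup>2 + A)) at_top" if "\<theta> = 0" "(apply_bcontfun (u 0) \<longlongrightarrow> L) at_bot"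
    by (rule velocity_limit_linear_tail[OF _ X that(2)]) (use Q that(1) in simp)
qed

lemma positive_tail_mass:
  assumes tail: "((\<lambda>r. r powr p * measure (\<mu> 0) {..< - r}) \<longlongrightarrow> A) at_top" and A: "0 < A"
  shows "0 < measure (\<mu> 0) {..<z}"
proof -
  have "eventually (\<lambda>r. 0 < r powr p * measure (\<mu> 0) {..< - r}) at_top"
    by (rule order_tendstoD(1)[OF tail A])
  then have "eventually (\<lambda>r. 0 < measure (\<mu> 0) {..< - r} \<and> - z \<le> r) at_top"
    using eventually_ge_at_top[of "- z"]
    by eventually_elim (auto simp: zero_less_mult_iff)
  then obtain r where r: "0 < measure (\<mu> 0) {..< - r}" "- z \<le> r"
    by (auto simp: eventually_at_top_linorder)
  have "measure (\<mu> 0) {..< - r} \<le> measure (\<mu> 0) {..<z}"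
    by (rule finite_measure.finite_measure_mono[OF finite_\<mu>]) (use r(2) in auto)
  with r(1) show ?thesis by simp
qed

end

theorem theorem1p7:
  fixes ubar :: "real \<Rightarrow>\<^sub>C real" and \<mu>bar :: "real measure"
    and u :: "real \<Rightarrow> (real \<Rightarrow>\<^sub>C real)" and \<mu> :: "real \<Rightarrow> real measure"
    and \<theta>1 A1 :: real
  assumes "(ubar, \<mu>bar) \<in> \<D>"
    and "conservative_solution ubar \<mu>bar u \<mu>"
    and "0 \<le> \<theta>1" and "\<theta>1 < 1" and "0 \<le> A1"
    and "((\<lambda>x. \<bar>x\<bar> powr (1 - \<theta>1) * measure \<mu>bar {..< - (\<bar>x\<bar> powr (1 + \<theta>1))}) \<longlongrightarrow> A1) at_bot"
  shows "\<forall>x.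
    (A1 > 0 \<and> 0 < \<theta>1 \<longrightarrow>
      ((\<lambda>t. u t x / t powr \<theta>1) \<longlongrightarrow> 2 * (A1 / 4) powr ((1 + \<theta>1) / 2)) at_top) \<and>
    (\<forall>L. A1 > 0 \<and> \<theta>1 = 0 \<and> (apply_bcontfun ubar \<longlongrightarrow> L) at_bot \<longrightarrow>
      ((\<lambda>t. u t x) \<longlongrightarrow> sqrt (L\<^sup>2 + A1)) at_top) \<and>
    (A1 = 0 \<and> 0 < \<theta>1 \<and> (\<forall>z. measure \<mu>bar {..<z} > 0) \<longrightarrow>
      ((\<lambda>t. u t x / t powr \<theta>1) \<longlongrightarrow> 0) at_top) \<and>
    (\<forall>L. A1 = 0 \<and> \<theta>1 = 0 \<and> (\<forall>z. measure \<mu>bar {..<z} > 0) \<and>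
        (apply_bcontfun ubar \<longlongrightarrow> L) at_bot \<longrightarrow>
      ((\<lambda>t. u t x) \<longlongrightarrow> \<bar>L\<bar>) at_top) \<and>
    (\<forall>L. measure_support \<mu>bar \<noteq> {} \<and> bdd_below (measure_support \<mu>bar) \<and>
        (apply_bcontfun ubar \<longlongrightarrow> L) at_bot \<longrightarrow>
      ((\<lambda>t. u t x) \<longlongrightarrow> \<bar>L\<bar>) at_top)"
proof -
  interpret hs_flow u \<mu>
    by (rule conservative_solution_hs_flow[OF assms(2)])
  have init: "u 0 = ubar" "\<mu> 0 = \<mu>bar"
    using assms(2) by (auto simp: conservative_solution_def)
  have tail: "((\<lambda>r. r powr ((1 - \<theta>1) / (1 + \<theta>1)) * measure (\<mu> 0) {..< - r}) \<longlongrightarrow> A1) at_top"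
    unfolding init by (rule tail_in_distance[OF assms(6,3)])
  have pos: "0 < measure (\<mu> 0) {..<z}" if "A1 > 0" for z
    by (rule positive_tail_mass[OF tail that])
  note lim = limits_infinite_support[OF tail assms(3,4)]
  show ?thesis
  proof (intro allI conjI impI)
    fix x
    show "((\<lambda>t. u t x / t powr \<theta>1) \<longlongrightarrow> 2 * (A1 / 4) powr ((1 + \<theta>1) / 2)) at_top"
      if "A1 > 0 \<and> 0 < \<theta>1"
      by (rule lim(1)) (use that pos in simp_all)
    show "((\<lambda>t. u t x) \<longlongrightarrow> sqrt (L\<^sup>2 + A1)) at_top"
      if "A1 > 0 \<and> \<theta>1 = 0 \<and> (apply_bcontfun ubar \<longlongrightarrow> L) at_bot" for L
      by (rule lim(3)) (use that pos in \<open>simp_all add: init\<close>)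
    show "((\<lambda>t. u t x / t powr \<theta>1) \<longlongrightarrow> 0) at_top"
      if "A1 = 0 \<and> 0 < \<theta>1 \<and> (\<forall>z. measure \<mu>bar {..<z} > 0)"
      by (rule lim(2)) (use that in \<open>simp_all add: init\<close>)
    show "((\<lambda>t. u t x) \<longlongrightarrow> \<bar>L\<bar>) at_top"
      if "A1 = 0 \<and> \<theta>1 = 0 \<and> (\<forall>z. measure \<mu>bar {..<z} > 0) \<and> (apply_bcontfun ubar \<longlongrightarrow> L) at_bot" for L
    proof -
      have "((\<lambda>t. u t x) \<longlongrightarrow> sqrt (L\<^sup>2 + A1)) at_top"
        by (rule lim(3)) (use that in \<open>simp_all add: init\<close>)
      with that show ?thesis by simp
    qed
    show "((\<lambda>t. u t x) \<longlongrightarrow> \<bar>L\<bar>) at_top"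
      if "measure_support \<mu>bar \<noteq> {} \<and> bdd_below (measure_support \<mu>bar) \<and> (apply_bcontfun ubar \<longlongrightarrow> L) at_bot" for L
      by (rule limits_finite_support) (use that in \<open>simp_all add: init\<close>)
  qed
qed

end
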